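(* For $s\geq 1$ let $\eta_s$ be a homogeneous Poisson process on $B^d(0,1)$ with intensity $s$, i.e. a Poisson process on $\mathbb{R}^d$ with intensity measure $s\lambda_d|_{B^d(0,1)}$. Let $Q=\mathrm{Conv}(\eta_s\cup\{0\})$ and for $p\in[0,1]$ let $A_p=A_p(Q)$ be its $L^p$ surface area. Let $p_1,p_2\in[0,1]$ with $p_1\neq p_2$. Then the asymptotic covariance matrix (as $s\to\infty$) of the vector $s^{(d+3)/(2(d+1))}(A_{p_1},A_{p_2})$ is positive definite, i.e. for any $\alpha=(\alpha_1,\alpha_2)\in\mathbb{R}^2\setminus\{0\}$ there exists a constant $c>0$ such that for $s$ sufficiently large $$\mathrm{Var}[\alpha_1A_{p_1}+\alpha_2A_{p_2}]\geq cs^{-(d+3)/(d+1)}.$$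
   Context: Here $d$ is the dimension of the underlying space $\mathbb{R}^d$, $\lambda_d$ (resp. $\lambda_{d-1}$) is the $d$-dimensional (resp. $(d-1)$-dimensional) Lebesgue measure, $B^d(0,1)$ is the closed Euclidean unit ball in $\mathbb{R}^d$, and $\lambda_d|_{B^d(0,1)}$ is the restriction of $\lambda_d$ to it. The point process $\eta_s$ is identified with the random set of its points and $\mathrm{Conv}$ denotes the convex hull. For $p\in[0,1]$ the $L^p$ surface area of the polytope $Q$ is $$A_p(Q)=\sum_{F\text{ facet of }Q}\mathrm{dist}(0,F)^{1-p}\lambda_{d-1}(F),$$ where facets are the $(d-1)$-dimensional faces and $\mathrm{dist}(0,F)$ is the distance of $F$ to the origin $0$. "The asymptotic covariance matrix is positive definite" is to be understood as the variance lower bound stated after "i.e.".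
   Formalization: The dimension d is assumed to be at least 2; for d = 1 the claim is false for every p_1 ≠ p_2 (e.g. p_1 = 1, α = (1,0): A_1 is the number of end points of an interval, whose variance is exponentially small). *)

theory Defs
  imports "HOL-Probability.Probability"
begin

section \<open>Poisson processes\<close>

text \<open>
  A point process is identified with the random set of its points, a locally finite
  random set \<open>\<eta> \<omega>\<close>.  The number of points in \<open>B\<close> is taken in \<open>ennreal\<close> by means of
  \<open>count_space\<close>, so that infinite sets are not counted as having \<open>0\<close> points.
\<close>

definition num_points :: "'a set \<Rightarrow> 'a set \<Rightarrow> ennreal" where
  "num_points X B = emeasure (count_space UNIV) (X \<inter> B)"

locale poisson_process = prob_space M
  for M :: "'w measure" +
  fixes \<mu> :: "'a::metric_space measure"
    and \<eta> :: "'w \<Rightarrow> 'a set"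
  assumes sets_intensity: "sets \<mu> = sets borel"
    and locally_finite:
      "\<And>\<omega> B. \<omega> \<in> space M \<Longrightarrow> bounded B \<Longrightarrow> finite (\<eta> \<omega> \<inter> B)"
    and num_points_measurable:
      "\<And>B. B \<in> sets \<mu> \<Longrightarrow> random_variable borel (\<lambda>\<omega>. num_points (\<eta> \<omega>) B)"
    and num_points_poisson:
      "\<And>B k. B \<in> sets \<mu> \<Longrightarrow> emeasure \<mu> B < \<infinity> \<Longrightarrow>
        prob {\<omega> \<in> space M. num_points (\<eta> \<omega>) B = of_nat k} =
          measure \<mu> B ^ k / fact k * exp (- measure \<mu> B)"
    and num_points_infinite:
      "\<And>B. B \<in> sets \<mu> \<Longrightarrow> emeasure \<mu> B = \<infinity> \<Longrightarrow>
        AE \<omega> in M. num_points (\<eta> \<omega>) B = \<infinity>"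
    and num_points_indep:
      "\<And>(n::nat) B. (\<And>i. i < n \<Longrightarrow> B i \<in> sets \<mu>) \<Longrightarrow> disjoint_family_on B {..<n} \<Longrightarrow>
        indep_vars (\<lambda>_. borel) (\<lambda>i \<omega>. num_points (\<eta> \<omega>) (B i)) {..<n}"

definition ball_intensity :: "real \<Rightarrow> 'a::euclidean_space measure" where
  "ball_intensity s = density lborel (\<lambda>x. ennreal (s * indicator (cball 0 1) x))"


section \<open>Lebesgue measure in the affine hull\<close>

text \<open>
  The library has no lower-dimensional Lebesgue measure on subsets of a Euclidean space.
  If \<open>F\<close> is nonempty and has dimension \<open>k\<close>, choose a point \<open>a\<close> of \<open>F\<close> and an orthonormal
  basis \<open>E\<close> (necessarily with \<open>k\<close> elements) of the direction space of the affine hull of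
  \<open>F\<close>.  The measure \<open>\<lambda>\<^sub>k(F)\<close> is the measure of the set of coordinate vectors of the points
  of \<open>F\<close>, under the product of \<open>k\<close> copies of one-dimensional Lebesgue measure.  The value
  does not depend on the choice of the frame.
\<close>

definition affine_frame :: "'a::euclidean_space set \<Rightarrow> 'a \<Rightarrow> 'a set \<Rightarrow> bool" where
  "affine_frame F a E \<longleftrightarrow>
     a \<in> F \<and> pairwise orthogonal E \<and> (\<forall>e\<in>E. norm e = 1) \<and>
     span E = span {x - y | x y. x \<in> F \<and> y \<in> F}"

definition frame_lebesgue :: "'a::euclidean_space \<Rightarrow> 'a set \<Rightarrow> 'a set \<Rightarrow> real" where
  "frame_lebesgue a E F =
     measure (\<Pi>\<^sub>M e\<in>E. lborel)
       {c \<in> space (\<Pi>\<^sub>M e\<in>E. lborel). a + (\<Sum>e\<in>E. c e *\<^sub>R e) \<in> F}"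

definition affine_lebesgue :: "'a::euclidean_space set \<Rightarrow> real" where
  "affine_lebesgue F =
     (let (a, E) = (SOME (a, E). affine_frame F a E) in frame_lebesgue a E F)"


section \<open>The \<open>L\<^sup>p\<close> surface area\<close>

text \<open>
  Facets are the faces of dimension \<open>d - 1\<close>, where \<open>d\<close> is the dimension of the space; unlike
  in the library's \<open>facet_of\<close>, this is not relative to the dimension of the polytope.
\<close>

definition facets :: "'a::euclidean_space set \<Rightarrow> 'a set set" where
  "facets Q = {F. F face_of Q \<and> aff_dim F = int DIM('a) - 1}"

text \<open>
  For \<open>p = 1\<close> the weight is \<open>1\<close>, also for a facet through the origin, so that the \<open>L\<^sup>1\<close>
  surface area is the surface area; this case is separate since \<open>0 powr 0 = 0\<close>.  The \<open>L\<^sup>p\<close>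
  surface area is meaningful for polytopes only and is set to \<open>0\<close> otherwise.
\<close>

definition Lp_surface_area :: "real \<Rightarrow> 'a::euclidean_space set \<Rightarrow> real" where
  "Lp_surface_area p Q =
     (if polytope Q
      then \<Sum>F\<in>facets Q. (if p = 1 then 1 else infdist 0 F powr (1 - p)) * affine_lebesgue F
      else 0)"

end

theory Submission
  imports Defs
begin

text \<open>At the scale \<open>r = s powr (- 1 / (d + 1))\<close> there are of the order of \<open>r powr (1 - d)\<close> disjoint
  caps of height \<open>2 r\<^sup>2\<close> in the ball, and a cap has bounded intensity.  With a probability bounded below,
  the points of the process in a cap, apart from those in a small region \<open>W\<close> near its apex, are \<open>d\<close>
  anchor points close to the vertices of a regular simplex.  A point in \<open>W\<close> then replaces the facet
  through the anchor points by the \<open>d\<close> lateral facets of a flat pyramid over it.  If the relative height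
  of the pyramid is \<open>\<tau>\<close>, this changes \<open>A\<^sub>p\<close> by \<open>r ^ (d + 1)\<close> times a quantity proportional, up to a small
  error, to \<open>p d (d - 1) \<tau>\<^sup>2 / 2 + (1 - p) \<tau>\<close>: new area against smaller distance from the origin.  Since
  \<open>p\<^sub>1 \<noteq> p\<^sub>2\<close>, the corresponding combination with weights \<open>\<alpha>\<^sub>1\<close>, \<open>\<alpha>\<^sub>2\<close> is nonzero for a suitable \<open>\<tau>\<close>.

  Each cap carries a bounded statistic that compares one point in \<open>W\<close> with none.  These statistics are
  centred, pairwise orthogonal, and have covariance at least of order \<open>1 / s\<close> with the functional;
  projecting on their span gives \<open>Var \<ge> const * r powr (1 - d) * s powr (- 2)\<close>.

  Measurability of \<open>A\<^sub>p\<close> rests on the formula for it as an integral over the unit prisms erected on the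
  facets; they consist of the points at distance less than \<open>1\<close> from the polytope near which the distance
  function is affine.\<close>


text \<open>The process is known only through its counts in Borel sets, so conditioning on the
  points outside \<open>W\<close> is replaced by \<open>void_algebra W\<close>, generated by the
  events that a Borel set disjoint from \<open>W\<close> is empty; it is independent of the event
  that \<open>W\<close> holds exactly \<open>k\<close> points. The surface area of the hull of the
  points outside \<open>W\<close> must be measurable for this small sigma-algebra. That forces the
  detour through the distance function: the distance to a hull exceeds \<open>t\<close> exactly if
  some half-space from a countable family is empty, and the prism formula needs only countably many
  values of the distance. The formula also disposes of the arbitrary frame chosen in
  \<open>affine_lebesgue\<close>.

  In the geometry \<open>\<tau>\<close> is fixed first, so that the main term does not vanish; then
  \<open>\<delta>\<close>, small against \<open>\<tau>\<close> squared and against the main term,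
  bounds every deviation from an ideal pyramid; finally the square of \<open>r\<close> is at most
  \<open>\<delta>\<close>. All estimates are thus uniform in \<open>r\<close> and in the position of
  the cap.

  The exponent arises from \<open>s * r ^ (d + 1) = 1\<close>: the product of
  \<open>r powr (1 - d)\<close> and \<open>s powr (- 2)\<close> is
  \<open>r ^ (d + 3)\<close>.\<close>

section \<open>Orthogonal maps and Lebesgue measure\<close>

text \<open>The change of variables theorems of the library need a well-ordered index type.\<close>

typedef 'a wo = "UNIV :: 'a set" by simp

instance wo :: (finite) finite
  by (intro_classes, rule finite_imageD[of Rep_wo]) (auto simp: inj_on_def Rep_wo_inject)

instantiation wo :: (finite) linorder
begin

definition less_eq_wo :: "'a wo \<Rightarrow> 'a wo \<Rightarrow> bool" where
  "x \<le> y \<longleftrightarrow> to_nat_on UNIV (Rep_wo x) \<le> to_nat_on UNIV (Rep_wo y)"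

definition less_wo :: "'a wo \<Rightarrow> 'a wo \<Rightarrow> bool" where
  "x < y \<longleftrightarrow> to_nat_on UNIV (Rep_wo x) < to_nat_on UNIV (Rep_wo y)"

instance
proof intro_classes
  fix x y :: "'a wo"
  have inj: "inj (to_nat_on (UNIV :: 'a set))"
    by (rule inj_on_to_nat_on) (rule countable_finite, simp)
  assume "x \<le> y" "y \<le> x"
  then have "to_nat_on UNIV (Rep_wo x) = to_nat_on UNIV (Rep_wo y)"
    by (simp add: less_eq_wo_def)
  then show "x = y"
    using injD[OF inj] Rep_wo_inject by blast
qed (auto simp: less_eq_wo_def less_wo_def)

end

instance wo :: (finite) wellorder
proof (rule wf_wellorderI)
  have "{(x, y :: 'a wo). x < y} = inv_image less_than (\<lambda>x. to_nat_on UNIV (Rep_wo x))"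
    by (auto simp: less_wo_def inv_image_def)
  then show "wf {(x, y :: 'a wo). x < y}" by simp
qed intro_classes

text \<open>A Lebesgue set is a Borel set together with a part of a null set. Images under
  \<open>J\<close> are preimages under \<open>K\<close>, so measurability of \<open>K\<close>
  settles the Borel part, and null sets pull back to null sets.\<close>

lemma lebesgue_image_preserving:
  fixes J :: "'a::euclidean_space \<Rightarrow> 'b::euclidean_space"
  assumes inv: "\<And>x. K (J x) = x" "\<And>y. J (K y) = y"
    and K: "K \<in> borel_measurable borel" "distr lborel borel K = lborel"
    and S: "S \<in> lmeasurable"
  shows "J ` S \<in> lmeasurable" "measure lebesgue (J ` S) = measure lebesgue S"
proof -
  have eq: "J ` X = K -` X" for X using inv by (auto simp: image_iff) metis
  have Kb: "K -` X \<in> sets lborel" "emeasure lborel (K -` X) = emeasure lborel X" if "X \<in> sets lborel" for X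
  proof -
    show "K -` X \<in> sets lborel" using measurable_sets[OF K(1), of X] that by simp
    show "emeasure lborel (K -` X) = emeasure lborel X"
      using that emeasure_distr[OF K(1)[folded measurable_lborel2], of X] K(2) by simp
  qed
  have SL: "S \<in> sets lebesgue" using S by auto
  obtain N where N: "N \<in> null_sets lborel" "null_part lborel S \<subseteq> N"
    using null_part[OF SL] by blast
  have "K -` N \<in> null_sets lborel" using Kb[of N] N by (auto simp: null_sets_def)
  then have null: "K -` null_part lborel S \<in> null_sets lebesgue"
    using N(2) null_sets_completion_subset[of "K -` null_part lborel S" "K -` N" lborel]
      null_sets_completionI by blast
  have main: "main_part lborel S \<in> sets lborel" using SL by (rule main_part_sets)
  have dec: "J ` S = K -` main_part lborel S \<union> K -` null_part lborel S"
    unfolding eq using main_part_null_part_Un[OF SL] by blast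
  have KL: "K -` main_part lborel S \<in> sets lebesgue" using Kb[OF main] by auto
  have "emeasure lebesgue (J ` S) = emeasure lebesgue (K -` main_part lborel S)"
    unfolding dec using emeasure_Un_null_set[OF KL null] .
  also have "\<dots> = emeasure lborel (main_part lborel S)"
    using Kb[OF main] by (simp add: emeasure_completion)
  also have "\<dots> = emeasure lebesgue S" using SL by (simp add: emeasure_completion)
  finally have em: "emeasure lebesgue (J ` S) = emeasure lebesgue S" .
  have "J ` S \<in> sets lebesgue" unfolding dec using KL null by auto
  then show "J ` S \<in> lmeasurable" using em S by (auto simp: fmeasurable_def)
  show "measure lebesgue (J ` S) = measure lebesgue S" using em by (simp add: measure_def)
qed

definition to_wo :: "real^'d \<Rightarrow> real^('d::finite wo)" where
  "to_wo x = (\<chi> i. x $ Rep_wo i)"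

definition of_wo :: "real^('d::finite wo) \<Rightarrow> real^'d" where
  "of_wo x = (\<chi> i. x $ Abs_wo i)"

lemma of_to_wo [simp]: "of_wo (to_wo x) = x" and to_of_wo [simp]: "to_wo (of_wo y) = y"
  by (auto simp: to_wo_def of_wo_def vec_eq_iff Abs_wo_inverse Rep_wo_inverse)

lemma linear_to_wo: "linear to_wo" and linear_of_wo: "linear of_wo"
  by (auto intro!: linearI simp: to_wo_def of_wo_def vec_eq_iff)

lemma bij_Rep_wo: "bij Rep_wo"
  by (metis Abs_wo_inverse Rep_wo_inverse UNIV_I bijI')

lemma inner_to_wo: "to_wo x \<bullet> to_wo y = x \<bullet> y"
  unfolding inner_vec_def to_wo_def
  by (simp add: sum.reindex_bij_betw[OF bij_Rep_wo, of "\<lambda>i. x $ i * y $ i"])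

lemma to_wo_measurable: "(to_wo :: real^'d \<Rightarrow> _) \<in> borel_measurable borel"
  and of_wo_measurable: "(of_wo :: _ \<Rightarrow> real^'d) \<in> borel_measurable borel"
  using linear_to_wo linear_of_wo
  by (auto intro!: borel_measurable_continuous_onI linear_continuous_on
      simp: linear_conv_bounded_linear)

text \<open>Relabelling coordinates sends boxes to boxes with the same side lengths, and these
  determine Lebesgue measure. The first claim follows from the second because the two maps are
  inverse to each other.\<close>

lemma distr_wo:
  "distr lborel borel (to_wo :: real^'d \<Rightarrow> _) = lborel"
  "distr lborel borel (of_wo :: _ \<Rightarrow> real^'d) = lborel"
proof -
  have [measurable]: "(to_wo :: real^'d \<Rightarrow> _) \<in> borel_measurable borel" "(of_wo :: _ \<Rightarrow> real^'d) \<in> borel_measurable borel"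
    using to_wo_measurable of_wo_measurable by blast+
  show "distr lborel borel (of_wo :: _ \<Rightarrow> real^'d) = lborel"
  proof (rule lborel_eqI[symmetric])
    fix l u :: "real^'d" assume lu: "\<And>b. b \<in> Basis \<Longrightarrow> l \<bullet> b \<le> u \<bullet> b"
    have "of_wo -` box l u = box (to_wo l) (to_wo u)"
      by (auto simp: mem_box_cart of_wo_def to_wo_def Rep_wo_inverse)
         (metis Abs_wo_inverse Rep_wo_inverse UNIV_I)+
    moreover have "l $ i \<le> u $ i" for i using lu[of "axis i 1"] by (simp add: inner_axis)
    ultimately show "emeasure (distr lborel borel of_wo) (box l u) = (\<Prod>b\<in>Basis. (u - l) \<bullet> b)"
      by (subst emeasure_distr) (auto simp: emeasure_lborel_box_eq Basis_vec_def inner_axis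
         prod.UNION_disjoint prod.reindex inj_on_def axis_eq_axis to_wo_def
         prod.reindex_bij_betw[OF bij_Rep_wo, of "\<lambda>i. u $ i - l $ i"])
  qed simp
  then have "distr lborel borel (to_wo :: real^'d \<Rightarrow> _)
     = distr (distr lborel borel (of_wo :: _ \<Rightarrow> real^'d)) borel to_wo" by simp
  also have "\<dots> = distr lborel borel (to_wo \<circ> (of_wo :: _ \<Rightarrow> real^'d))"
    by (rule distr_distr) measurable
  also have "\<dots> = distr lborel borel (\<lambda>x. x)" by (simp add: o_def)
  also have "\<dots> = lborel" by (simp add: distr_id2)
  finally show "distr lborel borel (to_wo :: real^'d \<Rightarrow> _) = lborel" .
qed

lemmas lebesgue_to_wo = lebesgue_image_preserving[OF of_to_wo to_of_wo of_wo_measurable distr_wo(2)]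
lemmas lebesgue_of_wo = lebesgue_image_preserving[OF to_of_wo of_to_wo to_wo_measurable distr_wo(1)]

text \<open>Conjugation by \<open>to_wo\<close> transports the claim to a well-ordered index
  type.\<close>

lemma orthogonal_image_lebesgue:
  fixes T :: "real^'d \<Rightarrow> real^'d"
  assumes T: "orthogonal_transformation T" and S: "S \<in> lmeasurable"
  shows "T ` S \<in> lmeasurable" "measure lebesgue (T ` S) = measure lebesgue S"
proof -
  let ?T = "\<lambda>x. to_wo (T (of_wo x))"
  have o: "orthogonal_transformation ?T"
  proof -
    have "linear (to_wo \<circ> (T \<circ> of_wo))"
      using T by (intro linear_compose linear_of_wo linear_to_wo) (simp add: orthogonal_transformation_def)
    moreover have "?T v \<bullet> ?T w = v \<bullet> w" for v w
      using T inner_to_wo[of "of_wo v" "of_wo w"] by (simp add: inner_to_wo orthogonal_transformation_def)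
    ultimately show ?thesis by (simp add: orthogonal_transformation_def o_def)
  qed
  have eq: "T ` S = of_wo ` ?T ` to_wo ` S" by (simp add: image_image)
  show "T ` S \<in> lmeasurable" "measure lebesgue (T ` S) = measure lebesgue S"
    unfolding eq using lebesgue_to_wo[OF S] measurable_orthogonal_image[OF o] measure_orthogonal_image[OF o]
      lebesgue_of_wo by metis+
qed


lemma orthogonal_transformation_distr_lborel:
  fixes T :: "real^'d \<Rightarrow> real^'d"
  assumes T: "orthogonal_transformation T"
  shows "distr lborel borel T = lborel"
proof -
  have [measurable]: "T \<in> borel_measurable borel"
    using T orthogonal_transformation_linear linear_continuous_on borel_measurable_continuous_onI
      linear_conv_bounded_linear by blast
  obtain S where S: "orthogonal_transformation S" "\<And>x. S (T x) = x" "\<And>x. T (S x) = x"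
    using T orthogonal_transformation_bij[OF T] orthogonal_transformation_inv[OF T]
    by (metis bij_inv_eq_iff)
  show ?thesis
  proof (rule lborel_eqI[symmetric])
    fix l u :: "real^'d" assume lu: "\<And>b. b \<in> Basis \<Longrightarrow> l \<bullet> b \<le> u \<bullet> b"
    have eq: "T -` box l u = S ` box l u"
      using S by (auto simp: image_iff) metis
    have m: "S ` box l u \<in> lmeasurable"
      using orthogonal_image_lebesgue(1)[OF S(1)] by blast
    have "emeasure (distr lborel borel T) (box l u) = emeasure lborel (S ` box l u)"
      by (subst emeasure_distr) (auto simp: eq)
    also have "\<dots> = emeasure lebesgue (S ` box l u)"
  using measurable_sets[OF \<open>T \<in> borel_measurable borel\<close>, of "box l u"]
      by (simp add: eq emeasure_completion)
    also have "\<dots> = ennreal (measure lebesgue (S ` box l u))"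
      using m by (simp add: emeasure_eq_measure2)
    also have "measure lebesgue (S ` box l u) = measure lebesgue (box l u)"
      using orthogonal_image_lebesgue(2)[OF S(1)] by blast
    also have "\<dots> = (\<Prod>b\<in>Basis. (u - l) \<bullet> b)"
      using lu by (simp add: measure_completion measure_lborel_box_eq inner_diff_left)
    finally show "emeasure (distr lborel borel T) (box l u) = (\<Prod>b\<in>Basis. (u - l) \<bullet> b)" .
  qed simp
qed

text \<open>The isometry \<open>T\<close> that carries the standard basis to \<open>B\<close>
  preserves Lebesgue measure, and the product measure over \<open>B\<close> is the one over
  \<open>Basis\<close> reindexed along \<open>\<sigma>\<close>.\<close>

lemma lborel_eq_orthonormal:
  fixes B :: "(real^'d) set"
  assumes B: "finite B" "pairwise orthogonal B" "\<And>b. b \<in> B \<Longrightarrow> norm b = 1" "card B = CARD('d)"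
  shows "lborel = distr (\<Pi>\<^sub>M b\<in>B. lborel) borel (\<lambda>f. \<Sum>b\<in>B. f b *\<^sub>R b)"
proof -
  interpret product_sigma_finite "\<lambda>_::real^'d. lborel :: real measure" by standard
  obtain \<sigma> where \<sigma>: "bij_betw \<sigma> B (Basis :: (real^'d) set)"
    using B(1,4) by (metis DIM_cart DIM_real finite_Basis finite_same_card_bij mult.right_neutral)
  define T where "T x = (\<Sum>b\<in>B. (x \<bullet> \<sigma> b) *\<^sub>R b)" for x :: "real^'d"
  have ort: "b \<bullet> c = (if b = c then 1 else 0)" if "b \<in> B" "c \<in> B" for b c
    using B(2,3) that by (auto simp: pairwise_def orthogonal_def norm_eq_1)
  have "T x \<bullet> T y = x \<bullet> y" for x y
  proof -
    have "T x \<bullet> T y = (\<Sum>b\<in>B. \<Sum>c\<in>B. (x \<bullet> \<sigma> b) * (y \<bullet> \<sigma> c) * (b \<bullet> c))"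
      by (simp add: T_def inner_sum_left inner_sum_right sum_distrib_left mult_ac)
         (subst sum.swap, simp)
    also have "\<dots> = (\<Sum>b\<in>B. (x \<bullet> \<sigma> b) * (y \<bullet> \<sigma> b))"
      using B(1) by (intro sum.cong refl) (simp add: ort if_distrib cong: if_cong)
    also have "\<dots> = (\<Sum>b\<in>Basis. (x \<bullet> b) * (y \<bullet> b))"
      by (rule sum.reindex_bij_betw[OF \<sigma>, of "\<lambda>b. (x \<bullet> b) * (y \<bullet> b)"])
    finally show ?thesis by (simp add: euclidean_inner[of x y])
  qed
  moreover have "linear T"
    by (rule linearI) (auto simp: T_def inner_add_left scaleR_add_left sum.distrib scaleR_sum_right)
  ultimately have oT: "orthogonal_transformation T"
    by (simp add: orthogonal_transformation_def)
  have [measurable]: "T \<in> borel_measurable borel"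
    using oT orthogonal_transformation_linear linear_continuous_on borel_measurable_continuous_onI
      linear_conv_bounded_linear by blast
  have reidx: "(\<Pi>\<^sub>M b\<in>B. lborel :: real measure)
      = distr (\<Pi>\<^sub>M b\<in>Basis. lborel) (\<Pi>\<^sub>M b\<in>B. lborel) (\<lambda>f. \<lambda>b\<in>B. f (\<sigma> b))"
  proof (rule sym, rule PiM_eqI)
    have meas: "(\<lambda>f. \<lambda>b\<in>B. f (\<sigma> b)) \<in> measurable (\<Pi>\<^sub>M b\<in>Basis. lborel :: real measure) (\<Pi>\<^sub>M b\<in>B. lborel)"
      using \<sigma> by (intro measurable_restrict measurable_component_singleton) (auto simp: bij_betw_def)
    fix A :: "real^'d \<Rightarrow> real set" assume A: "\<And>i. i \<in> B \<Longrightarrow> A i \<in> sets lborel"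
    have inv: "\<And>b. b \<in> B \<Longrightarrow> inv_into B \<sigma> (\<sigma> b) = b"
      using \<sigma> by (auto simp: bij_betw_def)
    have "emeasure (distr (\<Pi>\<^sub>M b\<in>Basis. lborel) (\<Pi>\<^sub>M b\<in>B. lborel) (\<lambda>f. \<lambda>b\<in>B. f (\<sigma> b))) (Pi\<^sub>E B A)
      = emeasure (\<Pi>\<^sub>M b\<in>Basis. lborel) ((\<lambda>f. \<lambda>b\<in>B. f (\<sigma> b)) -` Pi\<^sub>E B A \<inter> space (\<Pi>\<^sub>M b\<in>Basis. lborel))"
      using A B(1) meas by (subst emeasure_distr) (auto intro!: sets_PiM_I_finite)
    also have "(\<lambda>f. \<lambda>b\<in>B. f (\<sigma> b)) -` Pi\<^sub>E B A \<inter> space (\<Pi>\<^sub>M b\<in>Basis. lborel :: real measure)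
       = Pi\<^sub>E Basis (\<lambda>b. A (inv_into B \<sigma> b))"
    proof -
      have s: "\<sigma> (inv_into B \<sigma> i) = i \<and> inv_into B \<sigma> i \<in> B" if "i \<in> Basis" for i
        using that \<sigma> by (auto simp: bij_betw_def f_inv_into_f inv_into_into)
      have sB: "\<sigma> b \<in> Basis" if "b \<in> B" for b using that \<sigma> by (auto simp: bij_betw_def)
      have "(\<forall>b\<in>B. f (\<sigma> b) \<in> A b) \<longleftrightarrow> (\<forall>i\<in>Basis. f i \<in> A (inv_into B \<sigma> i))" for f
      proof
        assume L: "\<forall>b\<in>B. f (\<sigma> b) \<in> A b"
        show "\<forall>i\<in>Basis. f i \<in> A (inv_into B \<sigma> i)"
        proof
          fix i :: "real^'d" assume "i \<in> Basis"
          with s[of i] L show "f i \<in> A (inv_into B \<sigma> i)" by force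
        qed
      next
        assume L: "\<forall>i\<in>Basis. f i \<in> A (inv_into B \<sigma> i)"
        show "\<forall>b\<in>B. f (\<sigma> b) \<in> A b"
        proof
          fix b assume b: "b \<in> B"
          with sB[of b] L have "f (\<sigma> b) \<in> A (inv_into B \<sigma> (\<sigma> b))" by blast
          with inv[OF b] show "f (\<sigma> b) \<in> A b" by simp
        qed
      qed
      then show ?thesis by (auto simp: space_PiM PiE_iff)
    qed
    also have "emeasure (\<Pi>\<^sub>M b\<in>Basis. lborel) \<dots> = (\<Prod>b\<in>Basis. emeasure lborel (A (inv_into B \<sigma> b)))"
      using A \<sigma> by (intro emeasure_PiM) (auto simp: bij_betw_def inv_into_into)
    also have "\<dots> = (\<Prod>b\<in>B. emeasure lborel (A (inv_into B \<sigma> (\<sigma> b))))"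
      by (rule prod.reindex_bij_betw[OF \<sigma>, symmetric])
    also have "\<dots> = (\<Prod>b\<in>B. emeasure lborel (A b))"
      using inv by simp
    finally show "emeasure (distr (\<Pi>\<^sub>M b\<in>Basis. lborel) (\<Pi>\<^sub>M b\<in>B. lborel) (\<lambda>f. \<lambda>b\<in>B. f (\<sigma> b))) (Pi\<^sub>E B A)
       = (\<Prod>b\<in>B. emeasure lborel (A b))" .
  qed (use B in simp_all)
  have meas: "(\<lambda>f. \<lambda>b\<in>B. f (\<sigma> b)) \<in> measurable (\<Pi>\<^sub>M b\<in>Basis. lborel :: real measure) (\<Pi>\<^sub>M b\<in>B. lborel)"
    using \<sigma> by (intro measurable_restrict measurable_component_singleton) (auto simp: bij_betw_def)
  have "distr (\<Pi>\<^sub>M b\<in>B. lborel) borel (\<lambda>f. \<Sum>b\<in>B. f b *\<^sub>R b)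
     = distr (\<Pi>\<^sub>M b\<in>Basis. lborel) borel ((\<lambda>f. \<Sum>b\<in>B. f b *\<^sub>R b) \<circ> (\<lambda>f. \<lambda>b\<in>B. f (\<sigma> b)))"
    by (subst reidx, rule distr_distr[OF _ meas]) measurable
  also have "\<dots> = distr (\<Pi>\<^sub>M b\<in>Basis. lborel) borel (T \<circ> (\<lambda>f. \<Sum>b\<in>Basis. f b *\<^sub>R b))"
  proof (rule distr_cong[OF refl refl])
    fix f :: "real^'d \<Rightarrow> real"
    show "((\<lambda>f. \<Sum>b\<in>B. f b *\<^sub>R b) \<circ> (\<lambda>f. \<lambda>b\<in>B. f (\<sigma> b))) f = (T \<circ> (\<lambda>f. \<Sum>b\<in>Basis. f b *\<^sub>R b)) f"
    proof -
      have "\<sigma> b \<in> Basis" if "b \<in> B" for b using that \<sigma> by (auto simp: bij_betw_def)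
      then show ?thesis by (auto simp: T_def inner_sum_left_Basis intro!: sum.cong)
    qed
  qed
  also have "\<dots> = distr (distr (\<Pi>\<^sub>M b\<in>Basis. lborel) borel (\<lambda>f. \<Sum>b\<in>Basis. f b *\<^sub>R b)) borel T"
    by (rule distr_distr[symmetric]) measurable
  also have "\<dots> = lborel"
    using orthogonal_transformation_distr_lborel[OF oT] by (simp flip: lborel_eq)
  finally show ?thesis by simp
qed


section \<open>Volumes of prisms\<close>

text \<open>Height one turns area into volume when \<open>n\<close> is a unit normal of
  \<open>F\<close>. Both ends are left out, so that over a face of a polytope the distance from the
  polytope stays strictly between 0 and 1.\<close>

definition prism :: "'a::real_vector \<Rightarrow> 'a set \<Rightarrow> 'a set" where
  "prism n F = {x + t *\<^sub>R n | x t. x \<in> F \<and> 0 < t \<and> t < (1::real)}"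

lemma prism_eq:
  fixes n :: "'a::real_inner"
  assumes "F \<subseteq> {x. n \<bullet> x = h}" "norm n = 1"
  shows "prism n F = {y. 0 < n \<bullet> y - h \<and> n \<bullet> y - h < 1 \<and> y - (n \<bullet> y - h) *\<^sub>R n \<in> F}"
proof -
  have nn: "n \<bullet> n = 1" using assms(2) by (simp add: norm_eq_1)
  show ?thesis
  proof (rule set_eqI, rule iffI)
    fix y assume "y \<in> prism n F"
    then obtain x t where "y = x + t *\<^sub>R n" "x \<in> F" "0 < t" "t < 1"
      by (auto simp: prism_def)
    then show "y \<in> {y. 0 < n \<bullet> y - h \<and> n \<bullet> y - h < 1 \<and> y - (n \<bullet> y - h) *\<^sub>R n \<in> F}"
      using assms(1) nn by (auto simp: inner_add_right)
  next
    fix y assume "y \<in> {y. 0 < n \<bullet> y - h \<and> n \<bullet> y - h < 1 \<and> y - (n \<bullet> y - h) *\<^sub>R n \<in> F}"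
    then show "y \<in> prism n F"
      unfolding prism_def
      by (intro CollectI exI[of _ "y - (n \<bullet> y - h) *\<^sub>R n"] exI[of _ "n \<bullet> y - h"]) auto
  qed
qed

lemma prism_borel:
  fixes n :: "'a::euclidean_space"
  assumes "F \<subseteq> {x. n \<bullet> x = h}" "norm n = 1" "closed F"
  shows "prism n F \<in> sets borel"
proof -
  have 1: "(\<lambda>y. y - (n \<bullet> y - h) *\<^sub>R n) \<in> borel_measurable borel"
    by measurable
  have 2: "F \<in> sets borel" using assms(3) by simp
  have "{y. y - (n \<bullet> y - h) *\<^sub>R n \<in> F} \<in> sets borel"
    using measurable_sets[OF 1 2] by (simp add: vimage_def)
  then show ?thesis unfolding prism_eq[OF assms(1,2)]
    by (simp add: Collect_conj_eq)
qed

lemma prism_convex: "convex F \<Longrightarrow> convex (prism n F)"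
proof -
  assume "convex F"
  moreover have "prism n F = (\<Union>x\<in>F. \<Union>y\<in>(\<lambda>t. t *\<^sub>R n) ` {0<..<1}. {x + y})"
    by (auto simp: prism_def) (metis greaterThanLessThan_iff)+
  moreover have "convex ((\<lambda>t. t *\<^sub>R n) ` {0<..<1::real})"
    by (intro convex_linear_image) (auto intro: linear_scaleR_left convex_real_interval simp: linear_iff scaleR_add_left)
  ultimately show ?thesis by (simp only: convex_sums)
qed

lemma prism_bounded:
  fixes n :: "'a::real_normed_vector"
  assumes "bounded F" shows "bounded (prism n F)"
proof -
  obtain K where K: "\<And>x. x \<in> F \<Longrightarrow> norm x \<le> K" using assms bounded_iff by blast
  show ?thesis
  proof (rule boundedI[where B = "K + norm n"])
    fix y assume "y \<in> prism n F"
    then obtain x t where y: "y = x + t *\<^sub>R n" "x \<in> F" "0 < t" "t < 1" by (auto simp: prism_def)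
    have "norm y \<le> norm x + \<bar>t\<bar> * norm n" using y norm_triangle_ineq[of x "t *\<^sub>R n"] by simp
    also have "\<bar>t\<bar> * norm n \<le> 1 * norm n" using y by (intro mult_right_mono) auto
    finally show "norm y \<le> K + norm n" using K y by force
  qed
qed

lemma prism_lmeasurable:
  fixes n :: "'a::euclidean_space"
  shows "convex F \<Longrightarrow> bounded F \<Longrightarrow> prism n F \<in> lmeasurable"
  by (intro measurable_convex prism_convex prism_bounded)

text \<open>Adding the normal \<open>n\<close> to the frame \<open>E\<close> yields an orthonormal
  basis of the whole space; integrating out the coordinate along \<open>n\<close> first contributes
  the length 1 of the open unit interval.\<close>

lemma frame_lebesgue_eq_prism:
  fixes F :: "(real^'d) set"
  assumes fr: "affine_frame F a E" and F: "F \<subseteq> {x. n \<bullet> x = h}" "norm n = 1" "closed F"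
    and dim: "aff_dim F = int CARD('d) - 1"
  shows "frame_lebesgue a E F = measure lborel (prism n F)"
proof -
  interpret product_sigma_finite "\<lambda>_::real^'d. lborel :: real measure" by standard
  have a: "a \<in> F" and oE: "pairwise orthogonal E" and nE: "\<And>e. e \<in> E \<Longrightarrow> norm e = 1"
    and sE: "span E = span {x - y | x y. x \<in> F \<and> y \<in> F}"
    using fr by (auto simp: affine_frame_def)
  have sub: "{x - y | x y. x \<in> F \<and> y \<in> F} \<subseteq> {x. n \<bullet> x = 0}"
    using F(1) by (auto simp: inner_diff_right subset_iff)
  have "E \<subseteq> {x. n \<bullet> x = 0}"
    using sE sub span_superset[of E] span_minimal[OF sub subspace_hyperplane] by blast
  then have nE0: "\<And>e. e \<in> E \<Longrightarrow> n \<bullet> e = 0" by auto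
  have nn: "n \<bullet> n = 1" using F(2) by (simp add: norm_eq_1)
  have nnE: "n \<notin> E" using nE0 nn by force
  have indE: "independent E"
    using oE nE by (intro pairwise_orthogonal_independent) force+
  have finE: "finite E" using indE by (rule independent_imp_finite)
  \<comment> \<open>The frame has exactly d - 1 elements: at least as many by the dimension of
    \<open>F\<close>, at most as many because \<open>insert n E\<close> is still
    independent.\<close>
  have "int (card E) = int (dim (span E))" using indE by (simp add: dim_eq_card_independent)
  also have "dim (span E) = dim {x - y | x y. x \<in> F \<and> y \<in> F}" unfolding sE by simp
  also have "int \<dots> \<ge> int (dim ((\<lambda>x. x - a) ` F))"
    using a by (intro iffD2[OF of_nat_le_iff] dim_subset) auto
  also have "int (dim ((\<lambda>x. x - a) ` F)) = aff_dim F"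
    using aff_dim_dim_affine_diffs
    by (metis a aff_dim_eq_dim_subtract hull_inc)
  finally have cE1: "int (card E) \<ge> int CARD('d) - 1" using dim by simp
  have B: "finite (insert n E)" "pairwise orthogonal (insert n E)" "\<And>b. b \<in> insert n E \<Longrightarrow> norm b = 1"
    using finE oE nE nE0 F(2) by (auto simp: pairwise_insert orthogonal_def inner_commute)
  have "independent (insert n E)"
    using B by (intro pairwise_orthogonal_independent) force+
  then have "card (insert n E) \<le> CARD('d)"
    using independent_bound by fastforce
  then have cB: "card (insert n E) = CARD('d)" using cE1 nnE finE by simp
  define \<Phi> where "\<Phi> f = (\<Sum>b\<in>insert n E. f b *\<^sub>R b)" for f :: "real^'d \<Rightarrow> real"
  have \<Phi>m: "\<Phi> \<in> measurable (Pi\<^sub>M (insert n E) (\<lambda>_. lborel)) borel" unfolding \<Phi>_def by measurable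
  have Pb: "prism n F \<in> sets borel" by (rule prism_borel[OF F])
  let ?Q = "(\<lambda>x. a + x) -` prism n F"
  have Qb: "?Q \<in> sets borel"
    using measurable_sets[OF _ Pb, of "\<lambda>x. a + x" borel] by (simp add: vimage_def)
  have "emeasure lborel (prism n F) = emeasure lborel ?Q"
    using Pb by (subst lborel_distr_plus[of a, symmetric], subst emeasure_distr) (auto simp: vimage_def)
  also have "\<dots> = emeasure (distr (Pi\<^sub>M (insert n E) (\<lambda>_. lborel)) borel \<Phi>) ?Q"
    using lborel_eq_orthonormal[OF B cB] unfolding \<Phi>_def by metis
  also have "\<dots> = emeasure (Pi\<^sub>M (insert n E) (\<lambda>_. lborel)) (\<Phi> -` ?Q \<inter> space (Pi\<^sub>M (insert n E) (\<lambda>_. lborel)))"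
    using \<Phi>m Qb by (rule emeasure_distr)
  also have "\<dots> = (\<integral>\<^sup>+ f. indicator (\<Phi> -` ?Q \<inter> space (Pi\<^sub>M (insert n E) (\<lambda>_. lborel))) f \<partial>(Pi\<^sub>M (insert n E) (\<lambda>_. lborel)))"
    using \<Phi>m Qb by (simp add: measurable_sets)
  also have "\<dots> = (\<integral>\<^sup>+ f. indicator ?Q (\<Phi> f) \<partial>(Pi\<^sub>M (insert n E) (\<lambda>_. lborel)))"
    by (intro nn_integral_cong) (auto split: split_indicator)
  also have "\<dots> = (\<integral>\<^sup>+ x. (\<integral>\<^sup>+ y. indicator ?Q (\<Phi> (x(n := y))) \<partial>lborel) \<partial>(Pi\<^sub>M E (\<lambda>_. lborel)))"
    using \<Phi>m Qb finE nnE by (intro product_nn_integral_insert) auto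
  also have "\<dots> = (\<integral>\<^sup>+ x. indicator {c \<in> space (\<Pi>\<^sub>M e\<in>E. lborel). a + (\<Sum>e\<in>E. c e *\<^sub>R e) \<in> F} x \<partial>(Pi\<^sub>M E (\<lambda>_. lborel)))"
  proof (rule nn_integral_cong)
    fix x assume x: "x \<in> space (Pi\<^sub>M E (\<lambda>_. lborel :: real measure))"
    let ?s = "a + (\<Sum>e\<in>E. x e *\<^sub>R e)"
    have na: "n \<bullet> ?s = h"
      using a F(1) nE0 by (auto simp: inner_add_right inner_sum_right)
    have \<Phi>eq: "a + \<Phi> (x(n := y)) = ?s + y *\<^sub>R n" for y
    proof -
      have "(\<Sum>b\<in>E. (x(n := y)) b *\<^sub>R b) = (\<Sum>b\<in>E. x b *\<^sub>R b)"
        using nnE by (intro sum.cong) auto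
      then show ?thesis using finE nnE by (simp add: \<Phi>_def algebra_simps)
    qed
    have "a + \<Phi> (x(n := y)) \<in> prism n F \<longleftrightarrow> ?s \<in> F \<and> 0 < y \<and> y < 1" for y
    proof -
      have "n \<bullet> (?s + y *\<^sub>R n) - h = y" using na nn by (simp only: inner_add_right inner_scaleR_right)
      then show ?thesis unfolding \<Phi>eq prism_eq[OF F(1,2)] by auto
    qed
    then have ind: "indicator ?Q (\<Phi> (x(n := y))) = (indicator F ?s * indicator {0<..<1} y :: ennreal)" for y
      by (auto simp: indicator_def)
    have "(\<integral>\<^sup>+ y. indicator ?Q (\<Phi> (x(n := y))) \<partial>lborel)
      = (\<integral>\<^sup>+ y. indicator F ?s * indicator {0<..<1::real} y \<partial>lborel)"
      by (rule nn_integral_cong) (rule ind)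
    also have "\<dots> = indicator F ?s * emeasure lborel {0<..<1::real}"
      by (subst nn_integral_cmult) auto
    also have "\<dots> = indicator {c \<in> space (\<Pi>\<^sub>M e\<in>E. lborel). a + (\<Sum>e\<in>E. c e *\<^sub>R e) \<in> F} x"
      using x by (auto simp: indicator_def)
    finally show "(\<integral>\<^sup>+ y. indicator ?Q (\<Phi> (x(n := y))) \<partial>lborel) = \<dots>" .
  qed
  also have "\<dots> = emeasure (Pi\<^sub>M E (\<lambda>_. lborel)) {c \<in> space (\<Pi>\<^sub>M e\<in>E. lborel). a + (\<Sum>e\<in>E. c e *\<^sub>R e) \<in> F}"
  proof -
    have "(\<lambda>c. a + (\<Sum>e\<in>E. c e *\<^sub>R e)) \<in> measurable (\<Pi>\<^sub>M e\<in>E. lborel) borel" by measurable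
    from measurable_sets[OF this, of F] F(3)
    have "{c \<in> space (\<Pi>\<^sub>M e\<in>E. lborel). a + (\<Sum>e\<in>E. c e *\<^sub>R e) \<in> F} \<in> sets (\<Pi>\<^sub>M e\<in>E. lborel)"
      by (simp add: vimage_def Int_def conj_commute)
    then show ?thesis by simp
  qed
  finally show ?thesis unfolding frame_lebesgue_def measure_def by simp
qed

text \<open>Every frame gives the volume of the prism, hence so does the one picked by the choice
  operator once some frame is known to exist.\<close>

lemma affine_lebesgue_eq_prism:
  fixes F :: "(real^'d) set"
  assumes F: "F \<subseteq> {x. n \<bullet> x = h}" "norm n = 1" "closed F"
    and dim: "aff_dim F = int CARD('d) - 1"
  shows "affine_lebesgue F = measure lebesgue (prism n F)"
proof -
  have "F \<noteq> {}" using dim by auto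
  then obtain a where a: "a \<in> F" by blast
  obtain E where "E \<subseteq> span {x - y | x y. x \<in> F \<and> y \<in> F}" "pairwise orthogonal E" "\<And>x. x \<in> E \<Longrightarrow> norm x = 1"
     "span E = span {x - y | x y. x \<in> F \<and> y \<in> F}"
    by (rule orthonormal_basis_subspace[OF subspace_span[of "{x - y | x y. x \<in> F \<and> y \<in> F}"]]) (rule that)
  then have "affine_frame F a E" using a by (auto simp: affine_frame_def)
  then have "\<exists>p. (case p of (a, E) \<Rightarrow> affine_frame F a E)" by (intro exI[of _ "(a, E)"]) simp
  then have "case (SOME (a, E). affine_frame F a E) of (a, E) \<Rightarrow> affine_frame F a E" by (rule someI_ex)
  then obtain a' E' where eq: "(SOME (a, E). affine_frame F a E) = (a', E')" and fr: "affine_frame F a' E'"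
    by (cases "SOME (a, E). affine_frame F a E") auto
  show ?thesis unfolding affine_lebesgue_def Let_def eq
    using frame_lebesgue_eq_prism[OF fr F dim] prism_borel[OF F] by (simp add: measure_completion)
qed

section \<open>Rank-one perturbations of the identity and shears\<close>

text \<open>Rotating \<open>b\<close> onto a multiple of a coordinate axis turns the map into the
  identity matrix with one column replaced, the situation of Cramer's rule.\<close>

lemma det_rank_one:
  fixes a b :: "real^'d"
  shows "det (matrix (\<lambda>x. x + (b \<bullet> x) *\<^sub>R a)) = 1 + b \<bullet> a"
proof -
  fix k :: 'd
  obtain R :: "real^'d \<Rightarrow> real^'d" where R: "orthogonal_transformation R" "R b = norm b *\<^sub>R axis k 1"
  proof (rule orthogonal_transformation_exists)
    show "norm b = norm (norm b *\<^sub>R axis k (1::real))" by simp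
  qed (rule that)
  obtain S where S: "orthogonal_transformation S" "\<And>x. S (R x) = x" "\<And>x. R (S x) = x"
    using R(1) orthogonal_transformation_bij[OF R(1)] orthogonal_transformation_inv[OF R(1)]
    by (metis bij_inv_eq_iff)
  have lR: "linear R" and lS: "linear S" using R S by (auto simp: orthogonal_transformation_def)
  define g where "g = (\<lambda>x. x + (b \<bullet> x) *\<^sub>R a)"
  have lg: "linear g" by (rule linearI) (auto simp: g_def inner_add_right algebra_simps)
  have RgS: "R (g (S x)) = x + (norm b * x $ k) *\<^sub>R R a" for x
  proof -
    have "b \<bullet> S x = R b \<bullet> R (S x)" using R(1) by (simp add: orthogonal_transformation_def)
    then have "b \<bullet> S x = norm b * x $ k" by (simp add: R(2) S(3) inner_axis')
    then show ?thesis
      by (simp add: g_def linear_add[OF lR] linear_cmul[OF lR] S(3))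
  qed
  have "det (matrix g) = det (matrix S) * det (matrix R) * det (matrix g)"
  proof -
    have "matrix S ** matrix R = mat 1"
      using matrix_compose[OF lR lS] S(2) by (simp add: o_def matrix_id_mat_1[unfolded id_def])
    then have "det (matrix S) * det (matrix R) = 1" by (metis det_I det_mul)
    then show ?thesis by simp
  qed
  also have "\<dots> = det (matrix R ** (matrix g ** matrix S))" by (simp add: det_mul)
  also have "matrix R ** (matrix g ** matrix S) = matrix (R \<circ> (g \<circ> S))"
    using matrix_compose[OF lS lg] matrix_compose[OF linear_compose[OF lS lg] lR] by simp
  also have "matrix (R \<circ> (g \<circ> S)) =
     (\<chi> i j. if j = k then (mat 1 *v (axis k 1 + norm b *\<^sub>R R a)) $ i else (mat 1 :: real^'d^'d) $ i $ j)"
    unfolding matrix_vector_mul_lid by (auto simp: vec_eq_iff matrix_def RgS axis_def mat_def)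
  also have "det \<dots> = (axis k 1 + norm b *\<^sub>R R a) $ k * det (mat 1 :: real^'d^'d)"
    by (rule cramer_lemma)
  also have "\<dots> = 1 + norm b * (R a $ k)" by (simp add: axis_def)
  also have "norm b * (R a $ k) = R b \<bullet> R a" by (simp add: R(2) inner_axis')
  also have "\<dots> = b \<bullet> a" using R(1) by (simp add: orthogonal_transformation_def)
  finally show ?thesis by (simp add: g_def)
qed

lemma measure_rank_one_image:
  fixes a b :: "real^'d"
  assumes "S \<in> lmeasurable"
  shows "measure lebesgue ((\<lambda>x. x + (b \<bullet> x) *\<^sub>R a + e) ` S) = \<bar>1 + b \<bullet> a\<bar> * measure lebesgue S"
    and "(\<lambda>x. x + (b \<bullet> x) *\<^sub>R a + e) ` S \<in> lmeasurable"
proof -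
  let ?b = "to_wo b" and ?a = "to_wo a"
  have lin: "linear (\<lambda>x. x + (?b \<bullet> x) *\<^sub>R ?a)"
    by (rule linearI) (auto simp: inner_add_right algebra_simps)
  have wo: "(\<lambda>x. x + (b \<bullet> x) *\<^sub>R a) ` S = of_wo ` (\<lambda>x. x + (?b \<bullet> x) *\<^sub>R ?a) ` to_wo ` S"
    by (simp add: image_image inner_to_wo linear_add[OF linear_of_wo] linear_cmul[OF linear_of_wo])
  note m = lebesgue_to_wo[OF assms]
  note m2 = measurable_linear_image[OF lin m(1)] measure_linear_image[OF lin m(1)]
  have eq: "(\<lambda>x. x + (b \<bullet> x) *\<^sub>R a + e) ` S = (+) e ` (\<lambda>x. x + (b \<bullet> x) *\<^sub>R a) ` S"
    by (auto simp: image_image add_ac)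
  show "measure lebesgue ((\<lambda>x. x + (b \<bullet> x) *\<^sub>R a + e) ` S) = \<bar>1 + b \<bullet> a\<bar> * measure lebesgue S"
    unfolding eq measure_translation wo lebesgue_of_wo(2)[OF m2(1)] m2(2) m(2) det_rank_one inner_to_wo ..
  show "(\<lambda>x. x + (b \<bullet> x) *\<^sub>R a + e) ` S \<in> lmeasurable"
    unfolding eq wo using lebesgue_of_wo(1)[OF m2(1)] by (rule measurable_translation)
qed

text \<open>The affine map that fixes the hyperplane of \<open>F\<close> and sends \<open>n\<close>
  to \<open>u\<close> is a rank-one perturbation of the identity, with determinant
  \<open>1 + n \<bullet> (u - n) = n \<bullet> u\<close>.\<close>

lemma measure_prism_shear:
  fixes F :: "(real^'d) set"
  assumes F: "F \<subseteq> {x. n \<bullet> x = h}" "norm n = 1" "convex F" "bounded F"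
  shows "measure lebesgue (prism u F) = \<bar>n \<bullet> u\<bar> * measure lebesgue (prism n F)"
proof -
  have nn: "n \<bullet> n = 1" using F(2) by (simp add: norm_eq_1)
  let ?T = "\<lambda>x. x + (n \<bullet> x) *\<^sub>R (u - n) + (- h *\<^sub>R (u - n))"
  have T: "?T (x + t *\<^sub>R n) = x + t *\<^sub>R u" if "x \<in> F" for x t
    using that F(1) nn by (auto simp: inner_add_right algebra_simps)
  have "?T ` prism n F = prism u F"
  proof (intro equalityI subsetI)
    fix y assume "y \<in> ?T ` prism n F"
    then obtain x t where "y = ?T (x + t *\<^sub>R n)" "x \<in> F" "0 < t" "t < 1" unfolding prism_def by blast
    then show "y \<in> prism u F" unfolding prism_def T[OF \<open>x \<in> F\<close>] by blast
  next
    fix y assume "y \<in> prism u F"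
    then obtain x t where y: "y = x + t *\<^sub>R u" "x \<in> F" "0 < t" "t < 1" by (auto simp: prism_def)
    then show "y \<in> ?T ` prism n F"
      by (intro image_eqI[of _ _ "x + t *\<^sub>R n"]) (unfold T[OF y(2)] prism_def, blast+)
  qed
  then show ?thesis
    using measure_rank_one_image(1)[OF prism_lmeasurable[OF F(3,4), of n], of n "u - n" "- h *\<^sub>R (u - n)"]
    by (simp add: inner_diff_right nn)
qed


section \<open>Facets and their normals\<close>

text \<open>This is the support set of \<open>Q\<close> in direction \<open>n\<close>, an exposed
  face with outer normal \<open>n\<close>.\<close>

definition sface :: "'a::real_inner set \<Rightarrow> 'a \<Rightarrow> 'a set" where
  "sface Q n = {x \<in> Q. \<forall>y\<in>Q. n \<bullet> y \<le> n \<bullet> x}"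

text \<open>Facets are indexed by outer unit normals because the prisms are erected along them; a
  facet that fills a flat polytope has two such normals.\<close>

definition facet_normals :: "'a::euclidean_space set \<Rightarrow> 'a set" where
  "facet_normals Q = {n. norm n = 1 \<and> aff_dim (sface Q n) = int DIM('a) - 1}"

lemma sface_le: "x \<in> sface Q n \<Longrightarrow> y \<in> Q \<Longrightarrow> n \<bullet> y \<le> n \<bullet> x"
  by (simp add: sface_def)

lemma sface_in: "x \<in> sface Q n \<Longrightarrow> x \<in> Q"
  by (simp add: sface_def)

lemma sface_eqI: "x \<in> sface Q n \<Longrightarrow> y \<in> Q \<Longrightarrow> n \<bullet> y = n \<bullet> x \<Longrightarrow> y \<in> sface Q n"
  by (simp add: sface_def)

lemma sface_hyperplane: "x \<in> sface Q n \<Longrightarrow> sface Q n = Q \<inter> {y. n \<bullet> y = n \<bullet> x}"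
  by (auto simp: sface_def intro: antisym)

lemma sface_subset: "x \<in> sface Q n \<Longrightarrow> sface Q n \<subseteq> {y. n \<bullet> y = n \<bullet> x}"
  using sface_hyperplane by blast

lemma sface_support: "(\<And>y. y \<in> Q \<Longrightarrow> n \<bullet> y \<le> h) \<Longrightarrow> x \<in> Q \<Longrightarrow> n \<bullet> x = h \<Longrightarrow> sface Q n = Q \<inter> {y. n \<bullet> y = h}"
  by (subst sface_hyperplane[of x]) (auto simp: sface_def)

lemma sface_face: "convex Q \<Longrightarrow> sface Q n face_of Q"
proof (cases "sface Q n = {}")
  case False
  assume c: "convex Q"
  from False obtain x where x: "x \<in> sface Q n" by blast
  show ?thesis unfolding sface_hyperplane[OF x]
    by (rule face_of_Int_supporting_hyperplane_le[OF c]) (rule sface_le[OF x])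
qed simp

lemma sface_compact: "compact Q \<Longrightarrow> compact (sface Q (n::'a::euclidean_space))"
proof (cases "sface Q n = {}")
  case False
  assume c: "compact Q"
  from False obtain x where x: "x \<in> sface Q n" by blast
  show ?thesis unfolding sface_hyperplane[OF x]
    by (intro compact_Int_closed c closed_hyperplane)
qed simp

lemma sface_convex: "convex Q \<Longrightarrow> convex (sface Q (n::'a::euclidean_space))"
  using sface_face face_of_imp_convex by blast

lemma facets_eq_sface:
  fixes Q :: "'a::euclidean_space set"
  assumes Q: "polytope Q"
  shows "facets Q = sface Q ` facet_normals Q"
proof (intro equalityI subsetI)
  fix F assume "F \<in> sface Q ` facet_normals Q"
  then show "F \<in> facets Q"
    using sface_face[OF polytope_imp_convex[OF Q]] by (auto simp: facets_def facet_normals_def)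
next
  fix F assume F: "F \<in> facets Q"
  then have face: "F face_of Q" and dim: "aff_dim F = int DIM('a) - 1" by (auto simp: facets_def)
  have ne: "F \<noteq> {}" using dim by auto
  then obtain x where x: "x \<in> F" by blast
  have "\<exists>a b. a \<noteq> 0 \<and> Q \<subseteq> {x. a \<bullet> x \<le> b} \<and> F = Q \<inter> {x. a \<bullet> x = b}"
  proof (cases "F = Q")
    case True
    then have "aff_dim Q < DIM('a)" using dim by simp
    then obtain a b where "a \<noteq> 0" "Q \<subseteq> {x. a \<bullet> x = b}" using aff_lowdim_subset_hyperplane by blast
    then show ?thesis using True by (intro exI[of _ a] exI[of _ b]) auto
  next
    case False
    have "F exposed_face_of Q"
      using face exposed_face_of_polyhedron polytope_imp_polyhedron[OF Q] by blast
    then obtain a b where ab: "Q \<subseteq> {x. a \<bullet> x \<le> b}" "F = Q \<inter> {x. a \<bullet> x = b}"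
      by (auto simp: exposed_face_of_def)
    have "a \<noteq> 0"
    proof
      assume "a = 0" then have "F = Q" using ab x by auto
      then show False using False by simp
    qed
    then show ?thesis using ab by blast
  qed
  then obtain a b where ab: "a \<noteq> 0" "Q \<subseteq> {x. a \<bullet> x \<le> b}" "F = Q \<inter> {x. a \<bullet> x = b}" by blast
  define n where "n = a /\<^sub>R norm a"
  have na: "n \<bullet> y = (a \<bullet> y) / norm a" for y by (simp add: n_def divide_inverse)
  have "sface Q n = Q \<inter> {y. n \<bullet> y = b / norm a}"
    using ab x by (intro sface_support[of _ _ _ x]) (auto simp: na divide_right_mono)
  also have "\<dots> = F" using ab by (auto simp: na)
  finally have sF: "sface Q n = F" .
  moreover have "norm n = 1" using ab by (simp add: n_def)
  ultimately have "n \<in> facet_normals Q" using dim by (simp add: facet_normals_def)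
  then show "F \<in> sface Q ` facet_normals Q" using sF by blast
qed

text \<open>\<open>F\<close> spans its hyperplane. The part \<open>v\<close> of \<open>m\<close>
  orthogonal to \<open>n\<close> is a direction of that hyperplane, so it is orthogonal to
  \<open>m\<close> as well and must vanish.\<close>

lemma hyperplane_normal_unique:
  fixes F :: "'a::euclidean_space set"
  assumes dim: "aff_dim F = int DIM('a) - 1" and F: "F \<subseteq> {x. n \<bullet> x = h}" "F \<subseteq> {x. m \<bullet> x = k}"
    and nm: "norm n = 1" "norm m = 1"
  shows "m = n \<or> m = - n"
proof -
  have nn: "n \<bullet> n = 1" "m \<bullet> m = 1" using nm by (simp_all add: norm_eq_1)
  have n0: "n \<noteq> 0" using nm by auto
  have "affine hull F \<subseteq> {x. n \<bullet> x = h}"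
    using F(1) by (intro hull_minimal affine_hyperplane)
  moreover have "aff_dim (affine hull F) = aff_dim {x. n \<bullet> x = h}"
    using dim aff_dim_hyperplane[OF n0] by simp
  moreover have "affine hull F \<noteq> {}" using dim by auto
  ultimately have eq: "affine hull F = {x. n \<bullet> x = h}"
    by (intro affine_dim_equal affine_affine_hull affine_hyperplane)
  have sub: "{x. n \<bullet> x = h} \<subseteq> {x. m \<bullet> x = k}"
    unfolding eq[symmetric] using F(2) by (intro hull_minimal affine_hyperplane)
  obtain x where x: "x \<in> {x. n \<bullet> x = h}" using \<open>affine hull F \<noteq> {}\<close> eq by blast
  define v where "v = m - (m \<bullet> n) *\<^sub>R n"
  have "n \<bullet> v = 0" using nn by (simp add: v_def inner_diff_right inner_commute)
  then have "x + v \<in> {x. n \<bullet> x = h}" using x by (simp add: inner_add_right)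
  then have "m \<bullet> (x + v) = k" "m \<bullet> x = k" using sub x by blast+
  then have mv: "m \<bullet> v = 0" by (simp add: inner_add_right)
  have "v \<bullet> v = m \<bullet> v - (m \<bullet> n) * (n \<bullet> v)"
    unfolding v_def by (simp add: inner_diff_left)
  then have "v \<bullet> v = 0" using mv \<open>n \<bullet> v = 0\<close> by simp
  then have mn: "m = (m \<bullet> n) *\<^sub>R n" by (simp add: v_def)
  then have "norm m = \<bar>m \<bullet> n\<bar> * norm n" by (metis norm_scaleR)
  then have "m \<bullet> n = 1 \<or> m \<bullet> n = - 1" using nm by auto
  then show ?thesis
  proof
    assume "m \<bullet> n = 1" then show ?thesis using mn by simp
  next
    assume "m \<bullet> n = - 1" then show ?thesis using mn by simp
  qed
qed

lemma facet_normals_subset: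
  assumes n: "n \<in> facet_normals Q" and m: "m \<in> facet_normals Q" and eq: "sface Q n = sface Q m"
  shows "m = n \<or> m = - n"
proof -
  have "sface Q n \<noteq> {}" using n by (auto simp: facet_normals_def)
  then obtain x where x: "x \<in> sface Q n" by blast
  show ?thesis
    using n m eq sface_subset[OF x] sface_subset[of x Q m] x
    by (intro hyperplane_normal_unique[of "sface Q n" n "n \<bullet> x" m "m \<bullet> x"]) (auto simp: facet_normals_def)
qed

text \<open>With interior points each facet has a single outer normal. If \<open>Q\<close> is flat
  and has a facet at all, that facet is \<open>Q\<close> itself, reached from both sides; this
  explains the factor 2.\<close>

lemma facet_normals_sum:
  fixes Q :: "'a::euclidean_space set" and f :: "'a set \<Rightarrow> real"
  assumes Q: "polytope Q"
  shows "finite (facet_normals Q)"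
    and "(\<Sum>n\<in>facet_normals Q. f (sface Q n)) = (if interior Q = {} then 2 else 1) * (\<Sum>F\<in>facets Q. f F)"
proof -
  have fin: "finite (facets Q)"
    using finite_polytope_faces[OF Q] by (auto simp: facets_def intro: finite_subset[rotated])
  have "finite (facet_normals Q) \<and> (\<Sum>n\<in>facet_normals Q. f (sface Q n)) = (if interior Q = {} then 2 else 1) * (\<Sum>F\<in>facets Q. f F)"
  proof (cases "interior Q = {}")
    case False
    have "inj_on (sface Q) (facet_normals Q)"
    proof (rule inj_onI, rule ccontr)
      fix n m assume nm: "n \<in> facet_normals Q" "m \<in> facet_normals Q" "sface Q n = sface Q m" "n \<noteq> m"
      then have mn: "m = - n" using facet_normals_subset by blast
      have "sface Q n \<noteq> {}" using nm by (auto simp: facet_normals_def)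
      then obtain x where x: "x \<in> sface Q n" by blast
      \<comment> \<open>Two opposite outer normals of the same face confine \<open>Q\<close> from
        both sides to one hyperplane.\<close>
      have "Q \<subseteq> {y. n \<bullet> y = n \<bullet> x}"
        using sface_le[OF x] sface_le[of x Q m] x nm mn by (force intro: antisym)
      moreover have "n \<noteq> 0" using nm by (auto simp: facet_normals_def)
      ultimately have "interior Q \<subseteq> {}"
        using interior_mono interior_hyperplane by metis
      then show False using False by simp
    qed
    then show ?thesis
      using False fin facets_eq_sface[OF Q] by (simp add: sum.reindex finite_image_iff)
  next
    case True
    show ?thesis
    proof (cases "facet_normals Q = {}")
      case True then show ?thesis using facets_eq_sface[OF Q] by simp
    next
      case False
      then obtain n where n: "n \<in> facet_normals Q" by blast
      have "sface Q n \<noteq> {}" using n by (auto simp: facet_normals_def)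
      then obtain x where x: "x \<in> sface Q n" by blast
      obtain a b where ab: "a \<noteq> 0" "Q \<subseteq> {x. a \<bullet> x = b}"
        using empty_interior_subset_hyperplane[OF polytope_imp_convex[OF Q] True] by blast
      define m where "m = a /\<^sub>R norm a"
      have Qm: "Q \<subseteq> {x. m \<bullet> x = b / norm a}" using ab by (auto simp: m_def divide_inverse)
      have m1: "norm m = 1" using ab by (simp add: m_def)
      have "sface Q n \<subseteq> Q" by (auto simp: sface_def)
      then have "m = n \<or> m = - n"
        using n sface_subset[OF x] Qm m1
        by (intro hyperplane_normal_unique[of "sface Q n" n "n \<bullet> x" m "b / norm a"]) (auto simp: facet_normals_def)
      then obtain c where c: "Q \<subseteq> {x. n \<bullet> x = c}"
      proof
        assume "m = n" then show thesis using Qm that by blast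
      next
        assume "m = - n"
        then have "Q \<subseteq> {x. n \<bullet> x = - (b / norm a)}" using Qm by (auto simp: subset_iff)
        then show thesis by (rule that)
      qed
      have all: "sface Q n = Q" "sface Q (- n) = Q" using c by (auto simp: sface_def subset_iff)
      have "facet_normals Q = {n, - n}"
      proof (intro equalityI subsetI)
        fix k assume k: "k \<in> facet_normals Q"
        have "sface Q k \<noteq> {}" using k by (auto simp: facet_normals_def)
        then obtain y where y: "y \<in> sface Q k" by blast
        have "sface Q k \<subseteq> Q" by (auto simp: sface_def)
        then have "k = n \<or> k = - n"
          using k n sface_subset[OF y] c
          by (intro hyperplane_normal_unique[of "sface Q k" n c k "k \<bullet> y"]) (auto simp: facet_normals_def)
        then show "k \<in> {n, - n}" by simp
      next
        fix k assume "k \<in> {n, - n}" then show "k \<in> facet_normals Q"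
          using n all by (auto simp: facet_normals_def)
      qed
      moreover have "n \<noteq> - n"
      proof
        assume "n = - n"
        then have "n \<bullet> n = - (n \<bullet> n)" by (metis inner_minus_right)
        then show False using n by (simp add: facet_normals_def norm_eq_1)
      qed
      ultimately show ?thesis using facets_eq_sface[OF Q] all True by simp
    qed
  qed
  then show "finite (facet_normals Q)"
    "(\<Sum>n\<in>facet_normals Q. f (sface Q n)) = (if interior Q = {} then 2 else 1) * (\<Sum>F\<in>facets Q. f F)" by auto
qed


section \<open>The surface area as an integral\<close>

text \<open>A vanishing symmetric second difference expresses local affinity without a gradient, so
  that it can be tested on a countable dense set. The bounds on \<open>D x\<close> exclude the
  polytope itself and cut the prisms at height one.\<close>

definition flat_point :: "('a::real_normed_vector \<Rightarrow> real) \<Rightarrow> 'a \<Rightarrow> bool" where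
  "flat_point D x \<longleftrightarrow> 0 < D x \<and> D x < 1 \<and>
     (\<exists>e>0. \<forall>v. norm v < e \<longrightarrow> D (x + v) + D (x - v) = 2 * D x)"

lemma infdist_ge_support:
  fixes Q :: "'a::euclidean_space set"
  assumes "Q \<noteq> {}" "norm n = 1" "\<And>q. q \<in> Q \<Longrightarrow> n \<bullet> q \<le> h"
  shows "n \<bullet> x - h \<le> infdist x Q"
  unfolding infdist_notempty[OF assms(1)]
proof (rule cINF_greatest[OF assms(1)])
  fix q assume q: "q \<in> Q"
  have "n \<bullet> x - h \<le> n \<bullet> (x - q)" using assms(3)[OF q] by (simp add: inner_diff_right)
  also have "\<dots> \<le> norm n * norm (x - q)" by (rule norm_cauchy_schwarz)
  finally show "n \<bullet> x - h \<le> dist x q" by (simp add: assms(2) dist_norm)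
qed

lemma infdist_prism:
  fixes Q :: "'a::euclidean_space set"
  assumes z: "z \<in> sface Q n" and n: "norm n = 1" and t: "0 \<le> t"
  shows "infdist (z + t *\<^sub>R n) Q = t"
proof (rule antisym)
  have nn: "n \<bullet> n = 1" using n by (simp add: norm_eq_1)
  show "infdist (z + t *\<^sub>R n) Q \<le> t"
    using infdist_le[OF sface_in[OF z], of "z + t *\<^sub>R n"] t n by (simp add: dist_norm)
  show "t \<le> infdist (z + t *\<^sub>R n) Q"
    using infdist_ge_support[of Q n "n \<bullet> z" "z + t *\<^sub>R n"] sface_le[OF z] sface_in[OF z] n nn
    by (auto simp: inner_add_right)
qed

lemma infdist_prism_affine:
  fixes Q :: "'a::euclidean_space set"
  assumes x: "x \<in> prism n (sface Q n)" and n: "norm n = 1" and z: "z \<in> sface Q n"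
  shows "infdist x Q = n \<bullet> x - n \<bullet> z" "0 < infdist x Q" "infdist x Q < 1"
proof -
  from x obtain y t where y: "x = y + t *\<^sub>R n" "y \<in> sface Q n" "0 < t" "t < 1" by (auto simp: prism_def)
  have nn: "n \<bullet> n = 1" using n by (simp add: norm_eq_1)
  have "n \<bullet> y = n \<bullet> z" using sface_subset[OF z] y(2) by auto
  moreover have "infdist x Q = t" unfolding y(1) using infdist_prism[OF y(2) n] y(3) by simp
  ultimately show "infdist x Q = n \<bullet> x - n \<bullet> z" "0 < infdist x Q" "infdist x Q < 1"
    using y nn by (auto simp: inner_add_right)
qed

text \<open>The nearest point of a compact convex set is unique, and together with \<open>x\<close>
  it determines the normal.\<close>

lemma prism_normal_unique:
  fixes Q :: "'a::euclidean_space set"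
  assumes Q: "compact Q" "convex Q"
    and x: "x \<in> prism n (sface Q n)" "x \<in> prism m (sface Q m)" and nm: "norm n = 1" "norm m = 1"
  shows "n = m"
proof -
  from x obtain y t where y: "x = y + t *\<^sub>R n" "y \<in> sface Q n" "0 < t" "t < 1" by (auto simp: prism_def)
  from x obtain z s where z: "x = z + s *\<^sub>R m" "z \<in> sface Q m" "0 < s" "s < 1" by (auto simp: prism_def)
  have t: "infdist x Q = t" unfolding y(1) using infdist_prism[OF y(2) nm(1)] y(3) by simp
  have s: "infdist x Q = s" unfolding z(1) using infdist_prism[OF z(2) nm(2)] z(3) by simp
  have dy: "dist x y = infdist x Q" using y nm t by (simp add: dist_norm)
  have dz: "dist x z = infdist x Q" using z nm s by (simp add: dist_norm)
  have "y = z"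
    using Q sface_in[OF y(2)] sface_in[OF z(2)] dy dz infdist_le
    by (intro any_closest_point_unique[of Q y z x]) (auto intro: compact_imp_closed)
  then have "t *\<^sub>R n = t *\<^sub>R m" using y z t s by simp
  then show ?thesis using y by simp
qed

text \<open>The nearest point \<open>z\<close> of \<open>x\<close> gives an affine minorant of the
  distance that is exact at \<open>x\<close>. Flatness makes it exact near \<open>x\<close>, which
  places all nearby points above the same face; a face with an open set above it has dimension d -
  1.\<close>

lemma flat_point_prism:
  fixes Q :: "'a::euclidean_space set"
  assumes Q: "compact Q" "convex Q" "Q \<noteq> {}" and fl: "flat_point (\<lambda>y. infdist y Q) x"
  obtains n where "norm n = 1" "x \<in> interior (prism n (sface Q n))" "n \<in> facet_normals Q"
proof -
  let ?D = "\<lambda>y. infdist y Q"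
  have cl: "closed Q" using Q compact_imp_closed by blast
  from fl obtain e where e: "0 < ?D x" "e > 0" "\<And>v. norm v < e \<Longrightarrow> ?D (x + v) + ?D (x - v) = 2 * ?D x"
    and D1: "?D x < 1"
    unfolding flat_point_def by blast
  have "continuous (at x) ?D" by (intro continuous_intros)
  then have "\<forall>\<^sub>F y in at x. ?D y \<in> {0<..<1}"
    using e(1) D1 unfolding continuous_at
    by (intro topological_tendstoD) auto
  then obtain e' where e': "e' > 0" "\<And>y. dist y x < e' \<Longrightarrow> 0 < ?D y \<and> ?D y < 1"
    using e(1) D1 unfolding eventually_at by (metis UNIV_I greaterThanLessThan_iff)
  obtain z where z: "z \<in> Q" "?D x = dist x z"
    using infdist_attains_inf[OF cl Q(3)] by metis
  define n where "n = (x - z) /\<^sub>R ?D x"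
  have nx: "norm n = 1" using z(2) e(1) by (simp add: n_def dist_norm)
  have xz: "x = z + ?D x *\<^sub>R n" using e(1) by (simp add: n_def)
  have nn: "n \<bullet> n = 1" using nx by (simp add: norm_eq_1)
  have sup: "n \<bullet> q \<le> n \<bullet> z" if q: "q \<in> Q" for q
  proof -
    have "(x - z) \<bullet> (q - z) \<le> 0"
      using Q(2) cl z q infdist_le by (intro any_closest_point_dot[of Q]) (auto simp: z(2)[symmetric])
    then have "?D x * (n \<bullet> (q - z)) \<le> 0" by (subst (asm) xz) simp
    then show ?thesis using e(1) by (simp add: mult_le_0_iff inner_diff_right)
  qed
  have zs: "z \<in> sface Q n" using z sup by (simp add: sface_def)
  have lower: "n \<bullet> y - n \<bullet> z \<le> ?D y" for y
    using infdist_ge_support[OF Q(3) nx, of "n \<bullet> z" y] sup by blast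
  have Dx: "?D x = n \<bullet> x - n \<bullet> z" by (subst (2) xz) (simp add: inner_add_right nn)
  \<comment> \<open>The affine lower bounds at \<open>x + v\<close> and \<open>x - v\<close> add up
    to \<open>2 * infdist x Q\<close>, so neither of them can be strict.\<close>
  have aff: "?D (x + v) = n \<bullet> (x + v) - n \<bullet> z" if v: "norm v < e" for v
    using e(3)[OF v] lower[of "x + v"] lower[of "x - v"] Dx by (simp add: inner_add_right inner_diff_right)
  have "ball x (min e e') \<subseteq> prism n (sface Q n)"
  proof
    fix y assume "y \<in> ball x (min e e')"
    then have ye: "norm (y - x) < e" and ye': "dist y x < e'" by (auto simp: dist_norm norm_minus_commute)
    have Dy: "?D y = n \<bullet> y - n \<bullet> z" using aff[OF ye] by simp
    obtain w where w: "w \<in> Q" "?D y = dist y w"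
      using infdist_attains_inf[OF cl Q(3)] by metis
    have 1: "n \<bullet> (y - w) \<ge> ?D y" using sup[OF w(1)] Dy by (simp add: inner_diff_right)
    have 2: "n \<bullet> (y - w) \<le> norm n * norm (y - w)" by (rule norm_cauchy_schwarz)
    have 3: "norm (y - w) = ?D y" using w(2) by (simp add: dist_norm)
    \<comment> \<open>Equality in the Cauchy-Schwarz inequality: \<open>y - w\<close> is parallel to
      \<open>n\<close>.\<close>
    have eq: "n \<bullet> (y - w) = norm n * norm (y - w)" using 1 2 3 nx by simp
    then have "norm n *\<^sub>R (y - w) = norm (y - w) *\<^sub>R n" by (simp add: norm_cauchy_schwarz_eq)
    then have "y - w = ?D y *\<^sub>R n" using nx 3 by simp
    then have yw: "y = w + ?D y *\<^sub>R n" by (metis add.commute diff_add_cancel)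
    have "n \<bullet> w = n \<bullet> z" using eq 3 nx Dy by (simp add: inner_diff_right)
    then have "w \<in> sface Q n" using w(1) sup by (simp add: sface_def)
    then show "y \<in> prism n (sface Q n)" using yw e'(2)[OF ye'] unfolding prism_def by blast
  qed
  then have int: "x \<in> interior (prism n (sface Q n))"
    using e(2) e'(1) by (intro interiorI[of "ball x (min e e')"]) auto
  have "aff_dim (prism n (sface Q n)) = int DIM('a)"
  proof (rule antisym[OF aff_dim_le_DIM])
    have "int DIM('a) = aff_dim (interior (prism n (sface Q n)))"
      using aff_dim_open[OF open_interior] int by (metis empty_iff)
    also have "\<dots> \<le> aff_dim (prism n (sface Q n))" by (intro aff_dim_subset interior_subset)
    finally show "int DIM('a) \<le> aff_dim (prism n (sface Q n))" .
  qed
  \<comment> \<open>A single additional point generates the prism affinely, so the face loses at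
    most one dimension against it.\<close>
  moreover have "prism n (sface Q n) \<subseteq> affine hull (insert (z + n) (sface Q n))"
  proof
    fix y assume "y \<in> prism n (sface Q n)"
    then obtain w t where y: "y = w + t *\<^sub>R n" "w \<in> sface Q n" by (auto simp: prism_def)
    have "y = w + t *\<^sub>R ((z + n) - z)" using y by simp
    moreover have "w \<in> affine hull (insert (z + n) (sface Q n))" "z + n \<in> affine hull (insert (z + n) (sface Q n))"
       "z \<in> affine hull (insert (z + n) (sface Q n))"
      using y zs by (auto intro: hull_inc)
    ultimately show "y \<in> affine hull (insert (z + n) (sface Q n))"
      using mem_affine_3_minus[OF affine_affine_hull, of w _ "z + n" z t] by (simp only:)
  qed
  then have "aff_dim (prism n (sface Q n)) \<le> aff_dim (insert (z + n) (sface Q n))"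
    using aff_dim_subset by (metis aff_dim_affine_hull)
  moreover have "aff_dim (insert (z + n) (sface Q n)) \<le> aff_dim (sface Q n) + 1"
    by (simp add: aff_dim_insert)
  moreover have "aff_dim (sface Q n) \<le> int DIM('a) - 1"
  proof -
    have "n \<noteq> 0" using nx by auto
    then have "aff_dim (sface Q n) \<le> int (DIM('a) - 1)"
      using aff_dim_subset[OF sface_subset[OF zs]] aff_dim_hyperplane[of n "n \<bullet> z"] by simp
    then show ?thesis using DIM_positive[where 'a='a] by (simp add: of_nat_diff)
  qed
  ultimately have "n \<in> facet_normals Q" using nx by (simp add: facet_normals_def)
  then show thesis using that nx int by blast
qed

lemma prism_flat_point:
  fixes Q :: "'a::euclidean_space set"
  assumes n: "norm n = 1" and x: "x \<in> interior (prism n (sface Q n))"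
  shows "flat_point (\<lambda>y. infdist y Q) x"
proof -
  from x obtain e where e: "e > 0" "ball x e \<subseteq> prism n (sface Q n)" by (auto simp: mem_interior)
  have xp: "x \<in> prism n (sface Q n)" using x interior_subset by blast
  then obtain z where z: "z \<in> sface Q n" by (auto simp: prism_def)
  have "infdist (x + v) Q + infdist (x - v) Q = 2 * infdist x Q" if "norm v < e" for v
  proof -
    have "x + v \<in> prism n (sface Q n)" "x - v \<in> prism n (sface Q n)"
      using that e(2) by (auto simp: subset_iff dist_norm)
    then show ?thesis
      using infdist_prism_affine(1)[OF _ n z] xp by (simp add: inner_add_right inner_diff_right)
  qed
  then show ?thesis unfolding flat_point_def
    using infdist_prism_affine(2,3)[OF xp n z] e(1) by blast
qed

text \<open>The flat points are the disjoint union of the interiors of the prisms over the facets,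
  and the frontier of a convex set is a null set.\<close>

lemma integral_flat_points:
  fixes Q :: "'a::euclidean_space set"
  assumes Q: "polytope Q" "Q \<noteq> {}"
    and g: "\<And>n x. n \<in> facet_normals Q \<Longrightarrow> x \<in> interior (prism n (sface Q n)) \<Longrightarrow> g x = c n"
  shows "(\<integral>x. (if flat_point (\<lambda>y. infdist y Q) x then g x else 0) \<partial>lborel)
    = (\<Sum>n\<in>facet_normals Q. c n * measure lebesgue (prism n (sface Q n)))"
proof -
  note cp = polytope_imp_compact[OF Q(1)] polytope_imp_convex[OF Q(1)]
  have eq: "(if flat_point (\<lambda>y. infdist y Q) x then g x else 0)
     = (\<Sum>n\<in>facet_normals Q. c n * indicator (interior (prism n (sface Q n))) x)" (is "?l = ?r") for x
  proof (cases "flat_point (\<lambda>y. infdist y Q) x")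
    case True
    then obtain n where n: "norm n = 1" "x \<in> interior (prism n (sface Q n))" "n \<in> facet_normals Q"
      using flat_point_prism[OF cp Q(2)] by blast
    have "c m * indicator (interior (prism m (sface Q m))) x = 0" if m: "m \<in> facet_normals Q - {n}" for m
    proof -
      have "x \<notin> interior (prism m (sface Q m))"
        using prism_normal_unique[OF cp, of x n m] n m interior_subset by (fastforce simp: facet_normals_def)
      then show ?thesis by simp
    qed
    then have "?r = c n * indicator (interior (prism n (sface Q n))) x"
      using n(3) facet_normals_sum(1)[OF Q(1)]
      by (subst sum.remove[of _ n], simp, simp, subst sum.neutral[of "facet_normals Q - {n}"], blast, simp)
    then show ?thesis using True g[OF n(3,2)] n by simp
  next
    case False
    then have "x \<notin> interior (prism n (sface Q n))" if "n \<in> facet_normals Q" for n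
      using prism_flat_point that by (auto simp: facet_normals_def)
    then show ?thesis using False by simp
  qed
  have fm: "interior (prism n (sface Q n)) \<in> fmeasurable lborel"
    and mi: "measure lborel (interior (prism n (sface Q n))) = measure lebesgue (prism n (sface Q n))" for n
  proof -
    have b: "bounded (prism n (sface Q n))"
      by (intro prism_bounded compact_imp_bounded sface_compact cp)
    have "measure lebesgue (interior (prism n (sface Q n))) = measure lebesgue (prism n (sface Q n))"
      by (intro measure_interior b negligible_convex_frontier prism_convex sface_convex cp)
    then show "measure lborel (interior (prism n (sface Q n))) = measure lebesgue (prism n (sface Q n))"
      by (simp add: measure_completion)
    have "bounded (interior (prism n (sface Q n)))" using b by (rule bounded_interior)
    then show "interior (prism n (sface Q n)) \<in> fmeasurable lborel"
      using emeasure_bounded_finite by (auto intro!: fmeasurableI)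
  qed
  show ?thesis unfolding eq
    by (subst Bochner_Integration.integral_sum)
       (use fm mi in \<open>auto simp: fmeasurable_def intro!: integrable_real_indicator sum.cong\<close>)
qed

section \<open>Recovering a facet from the distance function\<close>

text \<open>First-order extrapolation of \<open>D\<close> from \<open>x\<close> to \<open>y\<close>.
  The derivative is taken along the sequence \<open>1 / Suc m\<close>, so that measurability in
  further parameters is inherited; near a flat point of a distance function the sequence is
  eventually constant.\<close>

definition tangent :: "('a::real_normed_vector \<Rightarrow> real) \<Rightarrow> 'a \<Rightarrow> 'a \<Rightarrow> real" where
  "tangent D x y = D x + lim (\<lambda>m. real (Suc m) * (D (x + (y - x) /\<^sub>R real (Suc m)) - D x))"

text \<open>For the distance from a polytope this is the facet below the flat point
  \<open>x\<close>, expressed through \<open>D\<close> alone.\<close>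

definition contact :: "('a::real_normed_vector \<Rightarrow> real) \<Rightarrow> 'a \<Rightarrow> 'a set" where
  "contact D x = {y. D y = 0 \<and> tangent D x y = 0}"

lemma tangent_infdist:
  fixes Q :: "'a::euclidean_space set"
  assumes n: "norm n = 1" and x: "x \<in> interior (prism n (sface Q n))" and z: "z \<in> sface Q n"
  shows "tangent (\<lambda>y. infdist y Q) x y = n \<bullet> y - n \<bullet> z"
proof -
  from x obtain e where e: "e > 0" "ball x e \<subseteq> prism n (sface Q n)" by (auto simp: mem_interior)
  have D: "infdist w Q = n \<bullet> w - n \<bullet> z" if "w \<in> ball x e" for w
    using infdist_prism_affine(1)[OF _ n z] e that by blast
  have "(\<lambda>m. (y - x) /\<^sub>R real (Suc m)) \<longlonglongrightarrow> 0"
    using tendsto_scaleR[OF LIMSEQ_inverse_real_of_nat tendsto_const[of "y - x"]] by simp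
  then have "\<forall>\<^sub>F m in sequentially. dist ((y - x) /\<^sub>R real (Suc m)) 0 < e"
    using e(1) tendstoD by blast
  then have "\<forall>\<^sub>F m in sequentially.
    real (Suc m) * (infdist (x + (y - x) /\<^sub>R real (Suc m)) Q - infdist x Q) = n \<bullet> (y - x)"
  proof (rule eventually_mono)
    fix m assume m: "dist ((y - x) /\<^sub>R real (Suc m)) 0 < e"
    then have "x + (y - x) /\<^sub>R real (Suc m) \<in> ball x e" by (simp add: dist_norm)
    then have "infdist (x + (y - x) /\<^sub>R real (Suc m)) Q - infdist x Q = (n \<bullet> (y - x)) / real (Suc m)"
      using D e(1) by (simp add: inner_add_right divide_inverse)
    then show "real (Suc m) * (infdist (x + (y - x) /\<^sub>R real (Suc m)) Q - infdist x Q) = n \<bullet> (y - x)"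
      by simp
  qed
  then have L: "(\<lambda>m. real (Suc m) * (infdist (x + (y - x) /\<^sub>R real (Suc m)) Q - infdist x Q)) \<longlonglongrightarrow> n \<bullet> (y - x)"
    by (rule tendsto_eventually)
  show ?thesis unfolding tangent_def limI[OF L] using D[of x] e(1)
    by (simp add: inner_diff_right)
qed

lemma contact_infdist:
  fixes Q :: "'a::euclidean_space set"
  assumes Q: "closed Q" and n: "norm n = 1" and x: "x \<in> interior (prism n (sface Q n))"
  shows "contact (\<lambda>y. infdist y Q) x = sface Q n"
proof -
  have "x \<in> prism n (sface Q n)" using x interior_subset by blast
  then obtain z where z: "z \<in> sface Q n" by (auto simp: prism_def)
  have "Q \<noteq> {}" using sface_in[OF z] by blast
  then show ?thesis
    unfolding contact_def tangent_infdist[OF n x z] sface_hyperplane[OF z]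
    using in_closed_iff_infdist_zero[OF Q] by auto
qed

text \<open>The facet is null and may miss the dense set \<open>S\<close>, so points of
  \<open>S\<close> are only asked to lie on it up to \<open>1 / Suc k\<close>. Compactness yields a
  limit on the facet, and the margin \<open>1 / Suc j\<close> keeps the inequality for the norm
  strict in the limit.\<close>

lemma infdist_contact_less_iff:
  fixes Q :: "'a::euclidean_space set"
  assumes Q: "compact Q" and n: "norm n = 1" and x: "x \<in> interior (prism n (sface Q n))"
    and S: "\<And>U. open U \<Longrightarrow> U \<noteq> {} \<Longrightarrow> \<exists>y\<in>S. y \<in> U"
  shows "infdist 0 (contact (\<lambda>y. infdist y Q) x) < t \<longleftrightarrow>
    (\<exists>j::nat. \<forall>k::nat. \<exists>y\<in>S. norm y < t - 1 / Suc j \<and> infdist y Q < 1 / Suc k \<and>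
       - 1 / Suc k < tangent (\<lambda>y. infdist y Q) x y)"
proof -
  have cl: "closed Q" using Q compact_imp_closed by blast
  have "x \<in> prism n (sface Q n)" using x interior_subset by blast
  then obtain z where z: "z \<in> sface Q n" by (auto simp: prism_def)
  have Qne: "Q \<noteq> {}" using sface_in[OF z] by blast
  note T = tangent_infdist[OF n x z]
  have F: "contact (\<lambda>y. infdist y Q) x = sface Q n" by (rule contact_infdist[OF cl n x])
  show ?thesis unfolding F T
  proof
    assume lt: "infdist 0 (sface Q n) < t"
    obtain y0 where y0: "y0 \<in> sface Q n" "infdist 0 (sface Q n) = dist 0 y0"
      using infdist_attains_inf[OF compact_imp_closed[OF sface_compact[OF Q]]] z by (metis empty_iff)
    then have "0 < t - norm y0" using lt by simp
    then obtain j where j: "inverse (real (Suc j)) < t - norm y0" using reals_Archimedean by blast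
    show "\<exists>j::nat. \<forall>k::nat. \<exists>y\<in>S. norm y < t - 1 / Suc j \<and> infdist y Q < 1 / Suc k \<and> - 1 / Suc k < n \<bullet> y - n \<bullet> z"
    proof (intro exI[of _ j] allI)
      fix k :: nat
      let ?U = "{y. norm y < t - 1 / Suc j} \<inter> {y. infdist y Q < 1 / Suc k} \<inter> {y. - 1 / Suc k < n \<bullet> y - n \<bullet> z}"
      have "open ?U" by (intro open_Int open_Collect_less continuous_intros)
      moreover have "y0 \<in> ?U"
        using j y0(1) sface_subset[OF z] infdist_zero[OF sface_in[OF y0(1)]]
        by (auto simp: inverse_eq_divide)
      ultimately obtain y where "y \<in> S" "y \<in> ?U" using S[of ?U] by blast
      then show "\<exists>y\<in>S. norm y < t - 1 / Suc j \<and> infdist y Q < 1 / Suc k \<and> - 1 / Suc k < n \<bullet> y - n \<bullet> z"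
        by blast
    qed
  next
    assume "\<exists>j::nat. \<forall>k::nat. \<exists>y\<in>S. norm y < t - 1 / Suc j \<and> infdist y Q < 1 / Suc k \<and> - 1 / Suc k < n \<bullet> y - n \<bullet> z"
    then obtain j :: nat where
      "\<forall>k::nat. \<exists>y. norm y < t - 1 / Suc j \<and> infdist y Q < 1 / Suc k \<and> - 1 / Suc k < n \<bullet> y - n \<bullet> z"
      by blast
    then obtain y where
      "\<forall>k::nat. norm (y k) < t - 1 / Suc j \<and> infdist (y k) Q < 1 / Suc k \<and> - 1 / Suc k < n \<bullet> y k - n \<bullet> z"
      using choice[of "\<lambda>k y. norm y < t - 1 / Suc j \<and> infdist y Q < 1 / Suc k \<and> - 1 / Suc k < n \<bullet> y - n \<bullet> z"]
      by blast
    then have y: "\<And>k::nat. norm (y k) < t - 1 / Suc j" "\<And>k::nat. infdist (y k) Q < 1 / Suc k"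
      "\<And>k::nat. - 1 / Suc k < n \<bullet> y k - n \<bullet> z"
      by blast+
    have "\<forall>k. y k \<in> cball 0 (t - 1 / Suc j)" using y(1) by (auto intro: less_imp_le)
    then obtain l r where l: "l \<in> cball 0 (t - 1 / Suc j)" "strict_mono r" "(y \<circ> r) \<longlonglongrightarrow> l"
      using compact_cball[of 0 "t - 1 / Suc j"] unfolding compact_def by metis
    have r: "(\<lambda>k. 1 / real (Suc (r k))) \<longlonglongrightarrow> 0"
      using LIMSEQ_subseq_LIMSEQ[OF LIMSEQ_inverse_real_of_nat l(2)] by (simp add: o_def inverse_eq_divide)
    have D: "(\<lambda>k. infdist (y (r k)) Q) \<longlonglongrightarrow> infdist l Q"
      using l(3) by (intro tendsto_infdist) (simp add: o_def)
    have "infdist l Q \<le> 0"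
      using y(2) by (intro LIMSEQ_le[OF D r] exI[of _ 0]) (auto intro: less_imp_le)
    then have "infdist l Q = 0" using infdist_nonneg[of l Q] by linarith
    then have lQ: "l \<in> Q" using in_closed_iff_infdist_zero[OF cl Qne] by blast
    have N: "(\<lambda>k. n \<bullet> y (r k) - n \<bullet> z) \<longlonglongrightarrow> n \<bullet> l - n \<bullet> z"
      using l(3) by (intro tendsto_intros) (simp add: o_def)
    have r': "(\<lambda>k. - 1 / real (Suc (r k))) \<longlonglongrightarrow> 0"
      using tendsto_minus[OF r] by simp
    have "0 \<le> n \<bullet> l - n \<bullet> z"
      using y(3) by (intro LIMSEQ_le[OF r' N] exI[of _ 0]) (auto intro: less_imp_le)
    \<comment> \<open>On \<open>Q\<close> the tangent is nonpositive, which is why a lower bound on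
      it suffices to reach the facet.\<close>
    then have "n \<bullet> l = n \<bullet> z" using sface_le[OF z lQ] by linarith
    then have "l \<in> sface Q n" using sface_eqI[OF z lQ] by simp
    then have "infdist 0 (sface Q n) \<le> norm l" using infdist_le[of l "sface Q n" 0] by simp
    moreover have "norm l < t"
    proof -
      have "0 < 1 / real (Suc j)" by simp
      then show ?thesis using l(1) unfolding mem_cball_0 by linarith
    qed
    ultimately show "infdist 0 (sface Q n) < t" by linarith
  qed
qed

lemma flat_point_countable:
  fixes D :: "'a::euclidean_space \<Rightarrow> real"
  assumes D: "continuous_on UNIV D" and S: "\<And>U. open U \<Longrightarrow> U \<noteq> {} \<Longrightarrow> \<exists>y\<in>S. y \<in> U"
  shows "flat_point D x \<longleftrightarrow> 0 < D x \<and> D x < 1 \<and>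
     (\<exists>k::nat. \<forall>v\<in>S. norm v < 1 / Suc k \<longrightarrow> D (x + v) + D (x - v) = 2 * D x)"
proof -
  have "(\<exists>e>0. \<forall>v. norm v < e \<longrightarrow> D (x + v) + D (x - v) = 2 * D x) \<longleftrightarrow>
     (\<exists>k::nat. \<forall>v\<in>S. norm v < 1 / Suc k \<longrightarrow> D (x + v) + D (x - v) = 2 * D x)"
  proof
    assume "\<exists>e>0. \<forall>v. norm v < e \<longrightarrow> D (x + v) + D (x - v) = 2 * D x"
    then obtain e where e: "e > 0" "\<And>v. norm v < e \<Longrightarrow> D (x + v) + D (x - v) = 2 * D x" by blast
    obtain k where "inverse (real (Suc k)) < e" using e(1) reals_Archimedean by blast
    then show "\<exists>k::nat. \<forall>v\<in>S. norm v < 1 / Suc k \<longrightarrow> D (x + v) + D (x - v) = 2 * D x"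
      using e(2) by (intro exI[of _ k]) (auto simp: inverse_eq_divide)
  next
    assume "\<exists>k::nat. \<forall>v\<in>S. norm v < 1 / Suc k \<longrightarrow> D (x + v) + D (x - v) = 2 * D x"
    then obtain k :: nat where k: "\<And>v. v \<in> S \<Longrightarrow> norm v < 1 / Suc k \<Longrightarrow> D (x + v) + D (x - v) = 2 * D x" by blast
    show "\<exists>e>0. \<forall>v. norm v < e \<longrightarrow> D (x + v) + D (x - v) = 2 * D x"
    proof (intro exI[of _ "1 / Suc k"] conjI allI impI; (rule ccontr)?)
      fix v assume v: "norm v < 1 / Suc k" "D (x + v) + D (x - v) \<noteq> 2 * D x"
      have c: "continuous_on UNIV (\<lambda>v. D (x + v) + D (x - v) - 2 * D x)"
        by (intro continuous_intros continuous_on_compose2[OF D]) auto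
      let ?U = "ball 0 (1 / Suc k) \<inter> (\<lambda>v. D (x + v) + D (x - v) - 2 * D x) -` (- {0})"
      have "open ?U" by (intro open_Int open_ball open_vimage c) auto
      moreover have "v \<in> ?U" using v by simp
      ultimately obtain w where "w \<in> S" "w \<in> ?U" using S[of ?U] by blast
      then show False using k[of w] by simp
    qed auto
  qed
  then show ?thesis unfolding flat_point_def by simp
qed

definition Lp_weight :: "real \<Rightarrow> real \<Rightarrow> real" where
  "Lp_weight p r = (if p = 1 then 1 else r powr (1 - p))"

lemma Lp_surface_area_eq_sum:
  "polytope Q \<Longrightarrow> Lp_surface_area p Q = (\<Sum>F\<in>facets Q. Lp_weight p (infdist 0 F) * affine_lebesgue F)"
  by (simp add: Lp_surface_area_def Lp_weight_def)

text \<open>Summing over normals counts the facet of a flat polytope from both sides; the factor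
  \<open>1 / 2\<close> corrects this.\<close>

lemma Lp_surface_area_integral:
  fixes Q :: "(real^'d) set"
  assumes Q: "polytope Q" "Q \<noteq> {}"
  shows "Lp_surface_area p Q = (if interior Q = {} then 1 / 2 else 1) *
    (\<integral>x. (if flat_point (\<lambda>y. infdist y Q) x then Lp_weight p (infdist 0 (contact (\<lambda>y. infdist y Q) x)) else 0) \<partial>lborel)"
proof -
  note cp = polytope_imp_compact[OF Q(1)] polytope_imp_convex[OF Q(1)]
  note cl = compact_imp_closed[OF cp(1)]
  have "(\<integral>x. (if flat_point (\<lambda>y. infdist y Q) x then Lp_weight p (infdist 0 (contact (\<lambda>y. infdist y Q) x)) else 0) \<partial>lborel)
    = (\<Sum>n\<in>facet_normals Q. Lp_weight p (infdist 0 (sface Q n)) * measure lebesgue (prism n (sface Q n)))"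
    using contact_infdist[OF cl]
    by (intro integral_flat_points Q) (auto simp: facet_normals_def)
  also have "\<dots> = (\<Sum>n\<in>facet_normals Q. Lp_weight p (infdist 0 (sface Q n)) * affine_lebesgue (sface Q n))"
  proof (rule sum.cong[OF refl])
    fix n assume n: "n \<in> facet_normals Q"
    then have "sface Q n \<noteq> {}" by (auto simp: facet_normals_def)
    then obtain z where z: "z \<in> sface Q n" by blast
    have "affine_lebesgue (sface Q n) = measure lebesgue (prism n (sface Q n))"
      using n by (intro affine_lebesgue_eq_prism[OF sface_subset[OF z]] compact_imp_closed sface_compact cp)
        (auto simp: facet_normals_def)
    then show "Lp_weight p (infdist 0 (sface Q n)) * measure lebesgue (prism n (sface Q n))
      = Lp_weight p (infdist 0 (sface Q n)) * affine_lebesgue (sface Q n)" by simp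
  qed
  also have "\<dots> = (if interior Q = {} then 2 else 1) * Lp_surface_area p Q"
    unfolding Lp_surface_area_eq_sum[OF Q(1)]
    by (rule facet_normals_sum(2)[OF Q(1), of "\<lambda>F. Lp_weight p (infdist 0 F) * affine_lebesgue F"])
  finally show ?thesis by simp
qed

text \<open>Prisms of height below one over a subset of the unit ball stay inside the ball of radius
  2, and the weight is at most 1 because facets come within distance 1 of the origin.\<close>

lemma Lp_surface_area_bounded:
  fixes Q :: "(real^'d) set"
  assumes Q: "polytope Q" "Q \<noteq> {}" "Q \<subseteq> cball 0 1" and p: "p \<le> 1"
  shows "\<bar>Lp_surface_area p Q\<bar> \<le> measure lborel (ball 0 2 :: (real^'d) set)"
proof -
  note cp = polytope_imp_compact[OF Q(1)] polytope_imp_convex[OF Q(1)]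
  note cl = compact_imp_closed[OF cp(1)]
  let ?h = "\<lambda>x. (if flat_point (\<lambda>y. infdist y Q) x then Lp_weight p (infdist 0 (contact (\<lambda>y. infdist y Q) x)) else 0)"
  have h: "0 \<le> ?h x \<and> ?h x \<le> indicator (ball 0 2 :: (real^'d) set) x" for x :: "real^'d"
  proof (cases "flat_point (\<lambda>y. infdist y Q) x")
    case True
    then obtain n where n: "norm n = 1" "x \<in> interior (prism n (sface Q n))"
      using flat_point_prism[OF cp Q(2)] by blast
    have "x \<in> prism n (sface Q n)" using n(2) interior_subset by blast
    then obtain z t where z: "x = z + t *\<^sub>R n" "z \<in> sface Q n" "0 < t" "t < 1" by (auto simp: prism_def)
    have z1: "norm z \<le> 1" using sface_in[OF z(2)] Q(3) by auto
    have "norm x \<le> norm z + \<bar>t\<bar> * norm n" unfolding z(1) by (metis norm_scaleR norm_triangle_ineq)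
    then have "norm x < 2" using z1 z n(1) by simp
    moreover have "infdist 0 (contact (\<lambda>y. infdist y Q) x) \<le> 1"
      unfolding contact_infdist[OF cl n] using infdist_le[OF z(2), of 0] z1 by simp
    then have "Lp_weight p (infdist 0 (contact (\<lambda>y. infdist y Q) x)) \<le> 1"
      using p powr_mono2[of "1 - p" "infdist 0 (contact (\<lambda>y. infdist y Q) x)" 1]
        infdist_nonneg[of 0 "contact (\<lambda>y. infdist y Q) x"]
      by (simp add: Lp_weight_def)
    ultimately show ?thesis using True by (simp add: Lp_weight_def)
  qed (auto simp: indicator_def)
  have fm: "ball 0 2 \<in> fmeasurable (lborel :: (real^'d) measure)"
    using emeasure_bounded_finite[of "ball 0 2 :: (real^'d) set"] by (intro fmeasurableI) auto
  have "0 \<le> (\<integral>x. ?h x \<partial>lborel)" using h by (intro Bochner_Integration.integral_nonneg) auto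
  moreover have "(\<integral>x. ?h x \<partial>lborel) \<le> (\<integral>x. indicator (ball 0 2 :: (real^'d) set) x \<partial>lborel)"
    using fm h by (intro integral_mono') (auto simp: fmeasurable_def)
  ultimately show ?thesis unfolding Lp_surface_area_integral[OF Q(1,2)] by auto
qed


section \<open>Measurability of the surface area of a random polytope\<close>

text \<open>A point is separated from the hull along the normal at its nearest point. Strict
  separation is an open condition on that normal, so a dense set of directions and rational
  thresholds suffice, and the right-hand side then only asks whether a half-space contains points of
  \<open>P\<close>.\<close>

lemma less_infdist_hull_iff:
  fixes P :: "'a::euclidean_space set"
  assumes P: "finite P" "P \<noteq> {}" and S: "\<And>U. open U \<Longrightarrow> U \<noteq> {} \<Longrightarrow> \<exists>y\<in>S. y \<in> U" and t: "0 \<le> t"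
  shows "t < infdist x (convex hull P) \<longleftrightarrow>
    (\<exists>u\<in>S. norm u \<le> 1 \<and> (\<exists>q\<in>\<rat>. q < u \<bullet> x - t \<and> (\<forall>p\<in>P. u \<bullet> p < q)))"
proof
  let ?Q = "convex hull P"
  have cp: "compact ?Q" "convex ?Q" "?Q \<noteq> {}" using P by (auto intro: finite_imp_compact_convex_hull)
  note cl = compact_imp_closed[OF cp(1)]
  {
    assume lt: "t < infdist x ?Q"
    obtain z where z: "z \<in> ?Q" "infdist x ?Q = dist x z" using infdist_attains_inf[OF cl cp(3)] by metis
    have D: "0 < infdist x ?Q" using lt t by linarith
    define n where "n = (x - z) /\<^sub>R infdist x ?Q"
    have n1: "norm n = 1" using z(2) D by (simp add: n_def dist_norm)
    have xz: "x - z = infdist x ?Q *\<^sub>R n" using D by (simp add: n_def)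
    have nn: "n \<bullet> n = 1" using n1 by (simp add: norm_eq_1)
    have sup: "t < n \<bullet> (x - q)" if q: "q \<in> ?Q" for q
    proof -
      have "(x - z) \<bullet> (q - z) \<le> 0"
        using cp cl z q infdist_le by (intro any_closest_point_dot[of ?Q]) (auto simp: z(2)[symmetric])
      then have "infdist x ?Q * (n \<bullet> (q - z)) \<le> 0" unfolding xz by simp
      then have "n \<bullet> (q - z) \<le> 0" using D by (simp add: mult_le_0_iff)
      moreover have "n \<bullet> (x - z) = infdist x ?Q" unfolding xz using nn by simp
      ultimately show ?thesis using lt by (simp add: inner_diff_right)
    qed
    let ?U = "\<Inter>p\<in>P. {u. t < u \<bullet> (x - p)}"
    have oU: "open ?U" using P(1) by (intro open_INT ballI open_Collect_less continuous_intros) auto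
    have nU: "n \<in> ?U" using sup hull_inc[of _ P convex] by auto
    then obtain e where e: "e > 0" "ball n e \<subseteq> ?U" using oU open_contains_ball by blast
    define e' where "e' = min e 1"
    have e': "0 < e'" "e' \<le> 1" "e' \<le> e" using e by (auto simp: e'_def)
    \<comment> \<open>The unit normal is first shortened, to make room for an element of
      \<open>S\<close> that is close to it and still has norm at most 1.\<close>
    have "ball ((1 - e' / 2) *\<^sub>R n) (e' / 2) \<noteq> {}" using e' by simp
    then obtain u where u: "u \<in> S" "u \<in> ball ((1 - e' / 2) *\<^sub>R n) (e' / 2)"
      using S[OF open_ball] by blast
    have du: "norm ((1 - e' / 2) *\<^sub>R n - u) < e' / 2" using u(2) by (simp add: dist_norm)
    have nr: "norm ((1 - e' / 2) *\<^sub>R n) = 1 - e' / 2" using n1 e' by simp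
    have "norm u \<le> norm ((1 - e' / 2) *\<^sub>R n) + norm ((1 - e' / 2) *\<^sub>R n - u)"
      by (metis norm_minus_commute norm_triangle_sub)
    then have u1: "norm u \<le> 1" using du nr by linarith
    have "norm (n - u) \<le> norm (n - (1 - e' / 2) *\<^sub>R n) + norm ((1 - e' / 2) *\<^sub>R n - u)"
      using norm_triangle_ineq[of "n - (1 - e' / 2) *\<^sub>R n" "(1 - e' / 2) *\<^sub>R n - u"] by simp
    moreover have "n - (1 - e' / 2) *\<^sub>R n = (e' / 2) *\<^sub>R n" by (simp add: algebra_simps)
    ultimately have "norm (n - u) < e" using du n1 e' by simp
    then have "u \<in> ?U" using e(2) by (auto simp: dist_norm)
    then have "\<forall>p\<in>P. u \<bullet> p < u \<bullet> x - t" by (auto simp: inner_diff_right)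
    then have "Max ((\<bullet>) u ` P) < u \<bullet> x - t" using P by simp
    then obtain q where q: "q \<in> \<rat>" "Max ((\<bullet>) u ` P) < q" "q < u \<bullet> x - t"
      using Rats_dense_in_real by blast
    then have "\<forall>p\<in>P. u \<bullet> p < q" using P by simp
    then show "\<exists>u\<in>S. norm u \<le> 1 \<and> (\<exists>q\<in>\<rat>. q < u \<bullet> x - t \<and> (\<forall>p\<in>P. u \<bullet> p < q))"
      using u u1 q by blast
  }
  assume "\<exists>u\<in>S. norm u \<le> 1 \<and> (\<exists>q\<in>\<rat>. q < u \<bullet> x - t \<and> (\<forall>p\<in>P. u \<bullet> p < q))"
  then obtain u q where u: "norm u \<le> 1" "q < u \<bullet> x - t" "\<And>p. p \<in> P \<Longrightarrow> u \<bullet> p < q" by blast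
  obtain z where z: "z \<in> ?Q" "infdist x ?Q = dist x z" using infdist_attains_inf[OF cl cp(3)] by metis
  have "?Q \<subseteq> {p. u \<bullet> p < q}" using u(3) by (intro hull_minimal convex_halfspace_lt) auto
  then have "t < u \<bullet> (x - z)" using z u(2) by (auto simp: inner_diff_right)
  also have "\<dots> \<le> norm u * norm (x - z)" by (rule norm_cauchy_schwarz)
  also have "\<dots> \<le> 1 * norm (x - z)" using u(1) by (intro mult_right_mono) auto
  finally show "t < infdist x ?Q" by (simp add: z(2) dist_norm)
qed

text \<open>The event is a countable union of rectangles, each the product of a void event and an
  open half-space.\<close>

lemma infdist_hull_measurable:
  fixes X :: "'w \<Rightarrow> 'a::euclidean_space set"
  assumes fin: "\<And>\<omega>. \<omega> \<in> space N \<Longrightarrow> finite (X \<omega>)"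
    and void: "\<And>B. B \<in> sets borel \<Longrightarrow> {\<omega> \<in> space N. X \<omega> \<inter> B = {}} \<in> sets N"
  shows "(\<lambda>p. infdist (snd p) (convex hull (insert 0 (X (fst p))))) \<in> borel_measurable (N \<Otimes>\<^sub>M borel)"
  unfolding borel_measurable_iff_greater
proof
  fix t :: real
  obtain S :: "'a set" where S: "countable S" "\<And>U. open U \<Longrightarrow> U \<noteq> {} \<Longrightarrow> \<exists>y\<in>S. y \<in> U"
    using countable_dense_setE by metis
  let ?A = "{p \<in> space (N \<Otimes>\<^sub>M borel). t < infdist (snd p) (convex hull (insert 0 (X (fst p))))}"
  show "?A \<in> sets (N \<Otimes>\<^sub>M borel)"
  proof (cases "t < 0")
    case True
    then have "?A = space (N \<Otimes>\<^sub>M borel)" using infdist_nonneg by (force intro: less_le_trans)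
    then show ?thesis by simp
  next
    case False
    let ?B = "\<lambda>u q. {\<omega> \<in> space N. X \<omega> \<inter> {y. q \<le> u \<bullet> y} = {}} \<times> {x. q < u \<bullet> x - t}"
    \<comment> \<open>The condition \<open>0 < q\<close> is the one imposed by the origin as a
      generator of the hull.\<close>
    have eq: "?A = (\<Union>u\<in>{u\<in>S. norm u \<le> 1}. \<Union>q\<in>{q\<in>\<rat>. 0 < q}. ?B u q)"
    proof (intro set_eqI)
      fix p
      show "p \<in> ?A \<longleftrightarrow> p \<in> (\<Union>u\<in>{u\<in>S. norm u \<le> 1}. \<Union>q\<in>{q\<in>\<rat>. 0 < q}. ?B u q)"
      proof (cases "fst p \<in> space N")
        case True
        have "p \<in> ?A \<longleftrightarrow> t < infdist (snd p) (convex hull (insert 0 (X (fst p))))"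
          using True by (cases p) (auto simp: space_pair_measure)
        also have "\<dots> \<longleftrightarrow> (\<exists>u\<in>S. norm u \<le> 1 \<and> (\<exists>q\<in>\<rat>. q < u \<bullet> snd p - t \<and> (\<forall>y\<in>insert 0 (X (fst p)). u \<bullet> y < q)))"
          using False fin[OF True] by (intro less_infdist_hull_iff S(2)) auto
        also have "\<dots> \<longleftrightarrow> p \<in> (\<Union>u\<in>{u\<in>S. norm u \<le> 1}. \<Union>q\<in>{q\<in>\<rat>. 0 < q}. ?B u q)"
          using True by (cases p) (auto simp: disjoint_iff not_le; blast)
        finally show ?thesis .
      next
        case False
        then show ?thesis by (cases p) (auto simp: space_pair_measure)
      qed
    qed
    show ?thesis unfolding eq
    proof (intro sets.countable_UN'' pair_measureI void)
      show "countable {u \<in> S. norm u \<le> 1}" "countable {q \<in> \<rat>. 0 < (q::real)}"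
        using S(1) countable_rat by (auto intro: countable_subset[rotated])
    qed (auto intro: borel_closed borel_open closed_halfspace_ge open_Collect_less continuous_intros)
  qed
qed

text \<open>Nothing but void events enters, so \<open>N\<close> may later be the sigma-algebra of
  the points outside a region. The integrand of the prism formula is rebuilt from countably many
  values of the distance.\<close>

lemma Lp_surface_area_measurable:
  fixes X :: "'w \<Rightarrow> (real^'d) set"
  assumes fin: "\<And>\<omega>. \<omega> \<in> space N \<Longrightarrow> finite (X \<omega>)"
    and void: "\<And>B. B \<in> sets borel \<Longrightarrow> {\<omega> \<in> space N. X \<omega> \<inter> B = {}} \<in> sets N"
  shows "(\<lambda>\<omega>. Lp_surface_area p (convex hull (insert 0 (X \<omega>)))) \<in> borel_measurable N"
proof -
  obtain S :: "(real^'d) set" where S: "countable S" "\<And>U. open U \<Longrightarrow> U \<noteq> {} \<Longrightarrow> \<exists>y\<in>S. y \<in> U"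
    using countable_dense_setE by metis
  let ?Q = "\<lambda>\<omega>. convex hull (insert 0 (X \<omega>))"
  define D where "D \<omega> x = infdist x (?Q \<omega>)" for \<omega> x
  have DL: "D \<omega> = (\<lambda>y. infdist y (?Q \<omega>))" for \<omega> by (rule ext) (simp add: D_def)
  have D0: "(\<lambda>p. D (fst p) (snd p)) \<in> borel_measurable (N \<Otimes>\<^sub>M borel)"
    unfolding D_def by (rule infdist_hull_measurable[OF assms])
  have Dm: "(\<lambda>p. D (fst p) (g p)) \<in> borel_measurable (N \<Otimes>\<^sub>M borel)"
    if [measurable]: "g \<in> borel_measurable (N \<Otimes>\<^sub>M borel)" for g
  proof -
    have "(\<lambda>p. (fst p, g p)) \<in> (N \<Otimes>\<^sub>M borel) \<rightarrow>\<^sub>M (N \<Otimes>\<^sub>M borel)" by measurable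
    from measurable_compose[OF this D0] show ?thesis by simp
  qed
  have [measurable]: "(\<lambda>p. D (fst p) (snd p)) \<in> borel_measurable (N \<Otimes>\<^sub>M borel)" by (rule D0)
  have [measurable]: "(\<lambda>p. D (fst p) (snd p + v)) \<in> borel_measurable (N \<Otimes>\<^sub>M borel)" for v by (rule Dm) measurable
  have [measurable]: "(\<lambda>p. D (fst p) (snd p - v)) \<in> borel_measurable (N \<Otimes>\<^sub>M borel)" for v by (rule Dm) measurable
  have [measurable]: "(\<lambda>p. D (fst p) v) \<in> borel_measurable (N \<Otimes>\<^sub>M borel)" for v by (rule Dm) measurable
  have [measurable]: "(\<lambda>p. tangent (D (fst p)) (snd p) y) \<in> borel_measurable (N \<Otimes>\<^sub>M borel)" for y
    unfolding tangent_def
    by (intro borel_measurable_add borel_measurable_lim_metric borel_measurable_times borel_measurable_diff Dm) measurable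
  have cD: "continuous_on UNIV (D \<omega>)" for \<omega> unfolding D_def by (intro continuous_intros)
  have poly: "polytope (?Q \<omega>)" if "\<omega> \<in> space N" for \<omega>
    using fin[OF that] by (auto simp: polytope_def)
  let ?fl = "\<lambda>p. flat_point (D (fst p)) (snd p)"
  have fl_m: "{p \<in> space (N \<Otimes>\<^sub>M borel). ?fl p} \<in> sets (N \<Otimes>\<^sub>M borel)"
  proof -
    have fl: "flat_point (D \<omega>) x \<longleftrightarrow> 0 < D \<omega> x \<and> D \<omega> x < 1 \<and>
       (\<exists>k::nat. \<forall>v\<in>S. norm v < 1 / Suc k \<longrightarrow> D \<omega> (x + v) + D \<omega> (x - v) = 2 * D \<omega> x)" for \<omega> x
      by (rule flat_point_countable[OF cD]) (rule S(2))
    show ?thesis unfolding fl using S(1) by measurable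
  qed
  define near where "near t p \<longleftrightarrow> (\<exists>j::nat. \<forall>k::nat. \<exists>y\<in>S. norm y < t - 1 / Suc j \<and> D (fst p) y < 1 / Suc k \<and>
       - 1 / Suc k < tangent (D (fst p)) (snd p) y)" for t p
  have near_m: "{p \<in> space (N \<Otimes>\<^sub>M borel). near t p} \<in> sets (N \<Otimes>\<^sub>M borel)" for t
    unfolding near_def using S(1) by measurable
  define w where "w p = (if ?fl p then infdist 0 (contact (D (fst p)) (snd p)) else 0)" for p
  have w_m: "w \<in> borel_measurable (N \<Otimes>\<^sub>M borel)"
    unfolding borel_measurable_iff_less
  proof
    fix t :: real
    have "(w p < t) = (if ?fl p then near t p else 0 < t)" if p: "p \<in> space (N \<Otimes>\<^sub>M borel)" for p
    proof (cases "?fl p")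
      case True
      have \<omega>: "fst p \<in> space N" using p by (auto simp: space_pair_measure)
      note cp = polytope_imp_compact[OF poly[OF \<omega>]] polytope_imp_convex[OF poly[OF \<omega>]]
      have "?Q (fst p) \<noteq> {}" by simp
      then obtain n where n: "norm n = 1" "snd p \<in> interior (prism n (sface (?Q (fst p)) n))"
        using flat_point_prism[OF cp] True unfolding DL by metis
      then show ?thesis
        using True infdist_contact_less_iff[OF cp(1) n S(2), of t]
        by (simp add: w_def DL near_def)
    next
      case False then show ?thesis by (simp add: w_def)
    qed
    then have "{p \<in> space (N \<Otimes>\<^sub>M borel). w p < t} =
      ({p \<in> space (N \<Otimes>\<^sub>M borel). ?fl p} \<inter> {p \<in> space (N \<Otimes>\<^sub>M borel). near t p})
      \<union> ((space (N \<Otimes>\<^sub>M borel) - {p \<in> space (N \<Otimes>\<^sub>M borel). ?fl p}) \<inter> {p \<in> space (N \<Otimes>\<^sub>M borel). 0 < t})"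
      by (auto split: if_splits)
    also have "\<dots> \<in> sets (N \<Otimes>\<^sub>M borel)"
      by (intro sets.Un sets.Int sets.Diff fl_m near_m sets.top sets.sets_Collect_const)
    finally show "{p \<in> space (N \<Otimes>\<^sub>M borel). w p < t} \<in> sets (N \<Otimes>\<^sub>M borel)" .
  qed
  define h where "h z = (if ?fl z then Lp_weight p (w z) else 0)" for z
  have [measurable]: "Measurable.pred (N \<Otimes>\<^sub>M borel) ?fl" using fl_m by (simp add: pred_def)
  have "h \<in> borel_measurable (N \<Otimes>\<^sub>M borel)"
    unfolding h_def Lp_weight_def using w_m by measurable
  then have "case_prod (\<lambda>\<omega> x. h (\<omega>, x)) \<in> borel_measurable (N \<Otimes>\<^sub>M lborel)"
    by (simp cong: measurable_cong_sets add: measurable_cong_sets[OF sets_pair_measure_cong[OF refl sets_lborel] refl])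
  then have I: "(\<lambda>\<omega>. \<integral>x. h (\<omega>, x) \<partial>lborel) \<in> borel_measurable N"
    by (rule lborel.borel_measurable_lebesgue_integral)
  \<comment> \<open>The volume of the hull is the measure of the zero set of the distance; it
    decides between the factors \<open>1 / 2\<close> and 1.\<close>
  have "case_prod (\<lambda>\<omega> x. indicator {0} (D \<omega> x)) \<in> borel_measurable (N \<Otimes>\<^sub>M (lborel :: (real^'d) measure))"
  proof -
    have "(\<lambda>p. indicator {0} (D (fst p) (snd p)) :: ennreal) \<in> borel_measurable (N \<Otimes>\<^sub>M borel)" by measurable
    then show ?thesis
      by (simp add: case_prod_beta' measurable_cong_sets[OF sets_pair_measure_cong[OF refl sets_lborel] refl])
  qed
  then have V: "(\<lambda>\<omega>. \<integral>\<^sup>+x. indicator {0} (D \<omega> x) \<partial>(lborel :: (real^'d) measure)) \<in> borel_measurable N"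
    by (rule lborel.borel_measurable_nn_integral)
  have int: "interior (?Q \<omega>) = {} \<longleftrightarrow> (\<integral>\<^sup>+x. indicator {0} (D \<omega> x) \<partial>lborel) = 0" if \<omega>: "\<omega> \<in> space N" for \<omega>
  proof -
    have cl: "closed (?Q \<omega>)" using poly[OF \<omega>] polytope_imp_closed by blast
    have "(indicator {0} (D \<omega> x) :: ennreal) = indicator (?Q \<omega>) x" for x
      using in_closed_iff_infdist_zero[OF cl, of x] by (simp add: D_def indicator_def)
    then have "(\<integral>\<^sup>+x. indicator {0} (D \<omega> x) \<partial>lborel) = emeasure lborel (?Q \<omega>)" using cl by simp
    moreover have "interior (?Q \<omega>) = {} \<longleftrightarrow> negligible (?Q \<omega>)"
      using negligible_convex_interior[OF convex_convex_hull] by blast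
    moreover have "\<dots> \<longleftrightarrow> emeasure lborel (?Q \<omega>) = 0"
      using cl by (auto simp: negligible_iff_null_sets null_sets_def emeasure_completion)
    ultimately show ?thesis by simp
  qed
  have "Lp_surface_area p (?Q \<omega>) = (if (\<integral>\<^sup>+x. indicator {0} (D \<omega> x) \<partial>(lborel :: (real^'d) measure)) = 0 then 1 / 2 else 1)
     * (\<integral>x. h (\<omega>, x) \<partial>lborel)" if \<omega>: "\<omega> \<in> space N" for \<omega>
  proof -
    have "?Q \<omega> \<noteq> {}" by simp
    moreover have "h (\<omega>, x) = (if flat_point (\<lambda>y. infdist y (?Q \<omega>)) x
      then Lp_weight p (infdist 0 (contact (\<lambda>y. infdist y (?Q \<omega>)) x)) else 0)" for x
      by (simp add: h_def w_def DL)
    ultimately show ?thesis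
      using Lp_surface_area_integral[OF poly[OF \<omega>], of p] by (simp add: int[OF \<omega>, symmetric])
  qed
  then show ?thesis using I V by (simp cong: measurable_cong) 
qed


section \<open>Replacing a facet by the lateral facets of a pyramid\<close>

text \<open>Scaled suitably, the vectors \<open>c j\<close> are the rows of a left inverse of the
  matrix with columns \<open>y i\<close>, and a left inverse of a square matrix is also a right
  inverse.\<close>

lemma dual_basis_expansion:
  fixes c y :: "'d::finite \<Rightarrow> real^'d"
  assumes off: "\<And>i j. i \<noteq> j \<Longrightarrow> c j \<bullet> y i = 0" and diag: "\<And>j. c j \<bullet> y j \<noteq> 0"
  shows "v = (\<Sum>j\<in>UNIV. ((c j \<bullet> v) / (c j \<bullet> y j)) *\<^sub>R y j)"
proof -
  define s where "s j = c j \<bullet> y j" for j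
  define A :: "real^'d^'d" where "A = (\<chi> j. c j /\<^sub>R s j)"
  define B :: "real^'d^'d" where "B = (\<chi> m i. y i $ m)"
  have AB: "(A ** B) $ j $ i = (c j \<bullet> y i) / s j" for i j
    by (simp add: A_def B_def matrix_matrix_mult_def inner_vec_def divide_inverse
        sum_distrib_left mult_ac)
  have "A ** B = mat 1"
    unfolding vec_eq_iff AB mat_def using off diag by (auto simp: s_def)
  then have "B ** A = mat 1" by (simp add: matrix_left_right_inverse)
  then have "v = B *v (A *v v)" by (simp add: matrix_vector_mul_assoc)
  also have "\<dots> = (\<Sum>j\<in>UNIV. ((c j \<bullet> v) / s j) *\<^sub>R y j)"
    by (simp add: vec_eq_iff matrix_vector_mult_def A_def B_def inner_vec_def
        divide_inverse sum_distrib_left sum_distrib_right mult_ac)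
  finally show ?thesis by (simp add: s_def)
qed

text \<open>A face of the hull of a finite set is the hull of some of its points, and these must lie
  in the supporting hyperplane.\<close>

lemma sface_convex_hull:
  fixes P :: "'a::euclidean_space set"
  assumes P: "finite P" "\<And>p. p \<in> P \<Longrightarrow> n \<bullet> p \<le> h" and p0: "p0 \<in> P" "n \<bullet> p0 = h"
  shows "sface (convex hull P) n = convex hull {p\<in>P. n \<bullet> p = h}"
proof -
  let ?F = "sface (convex hull P) n"
  have sup: "n \<bullet> y \<le> h" if "y \<in> convex hull P" for y
    using that hull_minimal[of P "{y. n \<bullet> y \<le> h}" convex] P(2) convex_halfspace_le by blast
  have F: "?F = convex hull P \<inter> {y. n \<bullet> y = h}"
    using sup p0 by (intro sface_support[of _ _ _ p0]) (auto intro: hull_inc)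
  have "?F face_of convex hull P" by (intro sface_face convex_convex_hull)
  then obtain S' where S': "S' \<subseteq> P" "?F = convex hull S'"
    using face_of_convex_hull_subset[OF finite_imp_compact[OF P(1)]] by metis
  have "S' \<subseteq> {p\<in>P. n \<bullet> p = h}"
    using S' hull_subset[of S' convex] F by auto
  then have "?F \<subseteq> convex hull {p\<in>P. n \<bullet> p = h}" unfolding S'(2) by (rule hull_mono)
  moreover have "convex hull {p\<in>P. n \<bullet> p = h} \<subseteq> ?F"
    unfolding F
    by (intro Int_greatest hull_mono hull_minimal convex_hyperplane) auto
  ultimately show ?thesis by blast
qed

lemma facets_convex_hull_iff:
  fixes P :: "'a::euclidean_space set"
  assumes P: "finite P"
  shows "F \<in> facets (convex hull P) \<longleftrightarrow>
    (\<exists>n h. n \<noteq> 0 \<and> (\<forall>p\<in>P. n \<bullet> p \<le> h) \<and> F = convex hull {p\<in>P. n \<bullet> p = h} \<and> aff_dim F = int DIM('a) - 1)"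
proof -
  have poly: "polytope (convex hull P)" using P by (auto simp: polytope_def)
  show ?thesis
  proof
    assume "F \<in> facets (convex hull P)"
    then obtain n where n: "n \<in> facet_normals (convex hull P)" "F = sface (convex hull P) n"
      using facets_eq_sface[OF poly] by blast
    then have dim: "aff_dim F = int DIM('a) - 1" by (auto simp: facet_normals_def)
    then have "P \<noteq> {}" using n(2) by (auto simp: sface_def)
    then obtain p0 where p0: "p0 \<in> P" "n \<bullet> p0 = Max ((\<bullet>) n ` P)"
      using P by (metis (no_types, lifting) Max_in finite_imageI image_iff image_is_empty)
    have le: "n \<bullet> p \<le> Max ((\<bullet>) n ` P)" if "p \<in> P" for p using that P by simp
    have "F = convex hull {p\<in>P. n \<bullet> p = Max ((\<bullet>) n ` P)}"
      unfolding n(2) using P le p0 by (rule sface_convex_hull)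
    moreover have "n \<noteq> 0" using n by (auto simp: facet_normals_def)
    ultimately show "\<exists>n h. n \<noteq> 0 \<and> (\<forall>p\<in>P. n \<bullet> p \<le> h) \<and> F = convex hull {p\<in>P. n \<bullet> p = h} \<and> aff_dim F = int DIM('a) - 1"
      using le dim by blast
  next
    assume "\<exists>n h. n \<noteq> 0 \<and> (\<forall>p\<in>P. n \<bullet> p \<le> h) \<and> F = convex hull {p\<in>P. n \<bullet> p = h} \<and> aff_dim F = int DIM('a) - 1"
    then obtain n h where n: "n \<noteq> 0" "\<And>p. p \<in> P \<Longrightarrow> n \<bullet> p \<le> h" "F = convex hull {p\<in>P. n \<bullet> p = h}"
      and dim: "aff_dim F = int DIM('a) - 1" by blast
    have "F \<noteq> {}" using dim by auto
    then obtain p0 where p0: "p0 \<in> P" "n \<bullet> p0 = h" using n(3) by auto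
    have "F = sface (convex hull P) n" using sface_convex_hull[OF P n(2) p0] n(3) by simp
    then show "F \<in> facets (convex hull P)"
      using sface_face[OF convex_convex_hull] dim by (auto simp: facets_def)
  qed
qed

text \<open>The point \<open>w\<close> lies beyond exactly one facet of \<open>convex hull P\<close>, the simplex with vertices
  \<open>x j\<close>: the functionals \<open>c j\<close> bound the cone from \<open>w\<close> over that simplex.\<close>

locale facet_swap =
  fixes P :: "(real^'d) set" and x :: "'d \<Rightarrow> real^'d" and w :: "real^'d"
    and c :: "'d \<Rightarrow> real^'d" and k :: "'d \<Rightarrow> real" and c0 :: "real^'d" and k0 :: real
  assumes fin: "finite P" and xP: "range x \<subseteq> P"
    and cx: "\<And>i j. i \<noteq> j \<Longrightarrow> c j \<bullet> x i = k j" and cw: "\<And>j. c j \<bullet> w = k j"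
    and cxj: "\<And>j. c j \<bullet> x j < k j" and cp: "\<And>j p. p \<in> P - range x \<Longrightarrow> c j \<bullet> p < k j"
    and c0x: "\<And>i. c0 \<bullet> x i = k0" and c0w: "c0 \<bullet> w > k0" and c0p: "\<And>p. p \<in> P - range x \<Longrightarrow> c0 \<bullet> p < k0"
    and far: "P - range x \<noteq> {}"
begin

text \<open>The coordinates of \<open>v - w\<close> in the basis of the vectors
  \<open>x j - w\<close>, see \<open>expansion\<close>; they are nonnegative exactly in the cone
  with apex \<open>w\<close> over the simplex.\<close>

definition lam :: "'d \<Rightarrow> real^'d \<Rightarrow> real" where
  "lam j v = (k j - c j \<bullet> v) / (k j - c j \<bullet> x j)"

lemma expansion: "v - w = (\<Sum>j\<in>UNIV. lam j v *\<^sub>R (x j - w))"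
proof -
  have lam: "(c j \<bullet> (v - w)) / (c j \<bullet> (x j - w)) = lam j v" for j
    unfolding lam_def inner_diff_right cw
    using minus_divide_divide[of "k j - c j \<bullet> v" "k j - c j \<bullet> x j"] by simp
  have "v - w = (\<Sum>j\<in>UNIV. ((c j \<bullet> (v - w)) / (c j \<bullet> (x j - w))) *\<^sub>R (x j - w))"
    using cx cw cxj
    by (intro dual_basis_expansion) (auto simp: inner_diff_right less_imp_neq)
  then show ?thesis unfolding lam .
qed

lemma inner_expansion: "n \<bullet> v - n \<bullet> w = (\<Sum>j\<in>UNIV. lam j v * (n \<bullet> x j - n \<bullet> w))"
  using arg_cong[OF expansion[of v], of "(\<bullet>) n"] by (simp add: inner_diff_right inner_sum_right)

lemma sum_lam: "(\<Sum>j\<in>UNIV. lam j v) = (c0 \<bullet> w - c0 \<bullet> v) / (c0 \<bullet> w - k0)"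
proof -
  have "c0 \<bullet> v - c0 \<bullet> w = (\<Sum>j\<in>UNIV. lam j v) * (k0 - c0 \<bullet> w)"
    unfolding inner_expansion[of c0 v] c0x by (simp add: sum_distrib_right)
  then show ?thesis using c0w by (simp add: field_simps)
qed

lemma lam_pos: "p \<in> P - range x \<Longrightarrow> 0 < lam j p"
  using cp cxj[of j] by (simp add: lam_def)

lemma sum_lam_gt: "p \<in> P - range x \<Longrightarrow> 1 < (\<Sum>j\<in>UNIV. lam j p)"
  unfolding sum_lam using c0p c0w by (simp add: field_simps)

lemma normal_zero: "(\<And>j. n \<bullet> x j = n \<bullet> w) \<Longrightarrow> n = 0"
  using inner_expansion[of n "n + w"] by (simp add: inner_add_right)

text \<open>The combinatorial core of the swap. For an old point \<open>p\<close> away from the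
  simplex, \<open>p - w\<close> combines the vectors \<open>x j - w\<close> with positive
  coefficients of sum greater than 1; a supporting hyperplane through \<open>p\<close> that does not
  leave \<open>w\<close> strictly below would have to contain all \<open>x j\<close> and
  \<open>w\<close>, and these span the space.\<close>

lemma tight_all:
  assumes p: "p \<in> P - range x" and le: "\<And>q. q \<in> P \<Longrightarrow> n \<bullet> q \<le> h" and w: "n \<bullet> w \<ge> h" and ph: "n \<bullet> p = h"
  shows "n = 0"
proof -
  let ?s = "\<Sum>j\<in>UNIV. lam j p"
  have xl: "n \<bullet> x j \<le> h" for j using le xP by blast
  have "h - n \<bullet> w = (\<Sum>j\<in>UNIV. lam j p * (n \<bullet> x j - h)) + ?s * (h - n \<bullet> w)"
    using inner_expansion[of n p] unfolding ph
    by (simp add: sum_distrib_right sum.distrib[symmetric] algebra_simps)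
  \<comment> \<open>Both summands are nonnegative, so both vanish.\<close>
  then have eq: "(\<Sum>j\<in>UNIV. lam j p * (h - n \<bullet> x j)) + (?s - 1) * (n \<bullet> w - h) = 0"
    by (simp add: algebra_simps sum_subtractf sum_distrib_left sum_distrib_right)
  have nn: "0 \<le> lam j p * (h - n \<bullet> x j)" for j using lam_pos[OF p, of j] xl[of j] by simp
  have "0 \<le> (\<Sum>j\<in>UNIV. lam j p * (h - n \<bullet> x j))" using nn by (intro sum_nonneg) auto
  moreover have "0 \<le> (?s - 1) * (n \<bullet> w - h)" using sum_lam_gt[OF p] w by simp
  ultimately have z1: "(\<Sum>j\<in>UNIV. lam j p * (h - n \<bullet> x j)) = 0" and z2: "(?s - 1) * (n \<bullet> w - h) = 0"
    using eq by linarith+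
  have "lam j p * (h - n \<bullet> x j) = 0" for j
    using z1 nn by (simp add: sum_nonneg_eq_0_iff)
  then have "n \<bullet> x j = h" for j using lam_pos[OF p, of j]
    by (metis eq_iff_diff_eq_0 less_irrefl mult_eq_0_iff)
  moreover have "n \<bullet> w = h" using z2 sum_lam_gt[OF p] by simp
  ultimately show ?thesis using normal_zero by simp
qed

abbreviation "F0 \<equiv> convex hull (range x)"
abbreviation "G j \<equiv> convex hull (insert w (x ` (- {j})))"

lemma c0_nz: "c0 \<noteq> 0" using c0w c0x[of undefined] by auto

lemma c_nz: "c j \<noteq> 0" using cw[of j] cxj[of j] by auto

lemma aff_dim_all: "aff_dim (insert w (range x)) = int CARD('d)"
proof -
  have "v \<in> affine hull (insert w (range x))" for v
  proof -
    have v: "v = w + (\<Sum>j\<in>UNIV. lam j v *\<^sub>R (x j - w))" using expansion[of v] by (simp add: algebra_simps)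
    have "\<And>J. w + (\<Sum>j\<in>J. lam j v *\<^sub>R (x j - w)) \<in> affine hull (insert w (range x))"
    proof -
      fix J :: "'d set"
      have "finite J" by simp
      then show "w + (\<Sum>j\<in>J. lam j v *\<^sub>R (x j - w)) \<in> affine hull (insert w (range x))"
      proof (induction J)
        case empty then show ?case by (simp add: hull_inc)
      next
        case (insert j J)
        have "w + (\<Sum>j\<in>insert j J. lam j v *\<^sub>R (x j - w)) = (w + (\<Sum>j\<in>J. lam j v *\<^sub>R (x j - w))) + lam j v *\<^sub>R (x j - w)"
          using insert by (simp add: algebra_simps)
        then show ?case
          using mem_affine_3_minus[OF affine_affine_hull insert.IH, of "x j" w "lam j v"]
          by (simp only: hull_inc insertI1 insertI2 rangeI simp_thms)
      qed
    qed
    then show ?thesis using v by metis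
  qed
  then have "affine hull (insert w (range x)) = UNIV" by blast
  then have "aff_dim (insert w (range x)) = aff_dim (UNIV :: (real^'d) set)"
    by (metis aff_dim_affine_hull)
  then show ?thesis by simp
qed

lemma hyperplane_dim: "n \<noteq> 0 \<Longrightarrow> S \<subseteq> {y. n \<bullet> y = h} \<Longrightarrow> aff_dim (S :: (real^'d) set) \<le> int CARD('d) - 1"
  using aff_dim_subset[of S "{y. n \<bullet> y = h}"] aff_dim_hyperplane[of n h]
  by (simp add: of_nat_diff Suc_leI)

lemma aff_dim_F0: "aff_dim F0 = int CARD('d) - 1"
proof (rule antisym)
  show "aff_dim F0 \<le> int CARD('d) - 1"
    unfolding aff_dim_convex_hull by (rule hyperplane_dim[OF c0_nz, of _ k0]) (auto simp: c0x)
  show "int CARD('d) - 1 \<le> aff_dim F0"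
    using aff_dim_all unfolding aff_dim_convex_hull by (auto simp: aff_dim_insert split: if_splits)
qed

lemma aff_dim_G: "aff_dim (G j) = int CARD('d) - 1"
proof (rule antisym)
  show "aff_dim (G j) \<le> int CARD('d) - 1"
    unfolding aff_dim_convex_hull by (rule hyperplane_dim[OF c_nz[of j], of _ "k j"]) (auto simp: cx cw)
  have "insert w (range x) = insert (x j) (insert w (x ` (- {j})))" by auto
  then show "int CARD('d) - 1 \<le> aff_dim (G j)"
    using aff_dim_all unfolding aff_dim_convex_hull by (auto simp: aff_dim_insert split: if_splits)
qed

lemma F0_facet: "F0 \<in> facets (convex hull P)"
proof -
  have "{p\<in>P. c0 \<bullet> p = k0} = range x" using xP c0x c0p by force
  moreover have "\<forall>p\<in>P. c0 \<bullet> p \<le> k0" using c0x c0p by (force intro: less_imp_le)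
  ultimately show ?thesis
    unfolding facets_convex_hull_iff[OF fin] using c0_nz aff_dim_F0
    by (intro exI[of _ c0] exI[of _ k0]) auto
qed

lemma G_facet: "G j \<in> facets (convex hull (insert w P))"
proof -
  have "{p\<in>insert w P. c j \<bullet> p = k j} = insert w (x ` (- {j}))"
  proof (intro equalityI subsetI)
    fix p assume p: "p \<in> {p\<in>insert w P. c j \<bullet> p = k j}"
    then consider "p = w" | i where "p = x i" | "p \<in> P - range x" by blast
    then show "p \<in> insert w (x ` (- {j}))"
    proof cases
      case 2 then show ?thesis using p cxj[of j] by (cases "i = j") auto
    next
      case 3 then show ?thesis using p cp[of p j] by auto
    qed auto
  qed (use xP cx cw in auto)
  moreover have "c j \<bullet> p \<le> k j" if p: "p \<in> insert w P" for p
  proof -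
    consider "p = w" | i where "p = x i" | "p \<in> P - range x" using p by blast
    then show ?thesis
    proof cases
      case 1 then show ?thesis by (simp add: cw)
    next
      case 2 then show ?thesis using cxj[of j] cx[of i j] by (cases "i = j") auto
    next
      case 3 then show ?thesis using cp[of p j] by simp
    qed
  qed
  ultimately show ?thesis
    using fin c_nz[of j] aff_dim_G[of j]
    by (subst facets_convex_hull_iff) (auto intro!: exI[of _ "c j"] exI[of _ "k j"])
qed

lemma facet_eqI:
  assumes "F \<in> facets Q" "H \<in> facets (Q :: (real^'d) set)" "F \<subseteq> H"
  shows "F = H"
proof (rule ccontr)
  assume "F \<noteq> H"
  have F: "F face_of Q" and H: "H face_of Q" and eq: "aff_dim F = aff_dim H" using assms(1,2) by (auto simp: facets_def)
  have "F face_of H" using face_of_subset[OF F assms(3)] H face_of_imp_subset by blast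
  then have "aff_dim F < aff_dim H"
    using face_of_aff_dim_lt[of H F] \<open>F \<noteq> H\<close> face_of_imp_convex[OF H] by blast
  then show False using eq by simp
qed

text \<open>A new facet without \<open>w\<close> is an old one; a new facet through \<open>w\<close>
  contains, by \<open>tight_all\<close>, no old point other than anchors and omits at least one
  anchor. Conversely an old facet other than \<open>F0\<close> has a vertex away from the simplex,
  so \<open>tight_all\<close> puts \<open>w\<close> strictly below it.\<close>

lemma facets_insert: "facets (convex hull (insert w P)) = (facets (convex hull P) - {F0}) \<union> range G"
proof (intro equalityI subsetI)
  have finw: "finite (insert w P)" using fin by simp
  fix F assume F: "F \<in> facets (convex hull (insert w P))"
  then obtain n h where n: "n \<noteq> 0" "\<And>p. p \<in> insert w P \<Longrightarrow> n \<bullet> p \<le> h" "F = convex hull {p\<in>insert w P. n \<bullet> p = h}"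
    and dim: "aff_dim F = int DIM(real^'d) - 1"
    unfolding facets_convex_hull_iff[OF finw] by blast
  show "F \<in> (facets (convex hull P) - {F0}) \<union> range G"
  proof (cases "n \<bullet> w = h")
    case False
    then have wl: "n \<bullet> w < h" using n(2)[of w] by simp
    then have "{p\<in>insert w P. n \<bullet> p = h} = {p\<in>P. n \<bullet> p = h}" by auto
    then have Ff: "F \<in> facets (convex hull P)"
      unfolding facets_convex_hull_iff[OF fin] using n dim by (intro exI[of _ n] exI[of _ h]) auto
    have "F \<noteq> F0"
    proof
      assume eq: "F = F0"
      have "convex hull {p\<in>insert w P. n \<bullet> p = h} \<subseteq> {p. n \<bullet> p = h}"
        by (intro hull_minimal convex_hyperplane) auto
      then have xh: "n \<bullet> x j = h" for j
        using eq n(3) hull_inc[of "x j" "range x" convex] by auto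
      obtain p where p: "p \<in> P - range x" using far by blast
      \<comment> \<open>If the hyperplane contained all anchors with \<open>w\<close> strictly
        below, the old point \<open>p\<close> would lie strictly above it, since its coordinates sum
        to more than 1.\<close>
      have "n \<bullet> p - n \<bullet> w = (\<Sum>j\<in>UNIV. lam j p) * (h - n \<bullet> w)"
        unfolding inner_expansion[of n p] xh by (simp add: sum_distrib_right)
      also have "\<dots> > 1 * (h - n \<bullet> w)"
        using wl sum_lam_gt[OF p] by (intro mult_strict_right_mono) auto
      finally show False using n(2)[of p] p by auto
    qed
    then show ?thesis using Ff by blast
  next
    case True
    have np: "n \<bullet> p \<noteq> h" if p: "p \<in> P - range x" for p
      using tight_all[OF p, of n h] n(1,2) True by fastforce
    obtain j where j: "n \<bullet> x j \<noteq> h" using normal_zero[of n] n(1) True by auto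
    have "{p\<in>insert w P. n \<bullet> p = h} \<subseteq> insert w (x ` (- {j}))"
      using np j by auto
    then have "F \<subseteq> G j" unfolding n(3) by (rule hull_mono)
    then have "F = G j" using facet_eqI[OF F G_facet] by blast
    then show ?thesis by blast
  qed
next
  have finw: "finite (insert w P)" using fin by simp
  fix F assume "F \<in> (facets (convex hull P) - {F0}) \<union> range G"
  then consider j where "F = G j" | "F \<in> facets (convex hull P)" "F \<noteq> F0" by blast
  then show "F \<in> facets (convex hull (insert w P))"
  proof cases
    case 1 then show ?thesis using G_facet by simp
  next
    case 2
    then obtain n h where n: "n \<noteq> 0" "\<And>p. p \<in> P \<Longrightarrow> n \<bullet> p \<le> h" "F = convex hull {p\<in>P. n \<bullet> p = h}"
      and dim: "aff_dim F = int DIM(real^'d) - 1"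
      unfolding facets_convex_hull_iff[OF fin] by blast
    have "\<not> {p\<in>P. n \<bullet> p = h} \<subseteq> range x"
    proof
      assume "{p\<in>P. n \<bullet> p = h} \<subseteq> range x"
      then have "F \<subseteq> F0" unfolding n(3) by (rule hull_mono)
      then show False using facet_eqI[OF 2(1) F0_facet] 2(2) by blast
    qed
    then obtain p where p: "p \<in> P - range x" "n \<bullet> p = h" by blast
    have wl: "n \<bullet> w < h"
      using tight_all[OF p(1) n(2)] p(2) n(1) by (meson not_le)
    then have "{p\<in>insert w P. n \<bullet> p = h} = {p\<in>P. n \<bullet> p = h}" by auto
    then show ?thesis
      unfolding facets_convex_hull_iff[OF finw] using n dim wl
      by (intro exI[of _ n] exI[of _ h]) (auto intro: less_imp_le)
  qed
qed

lemma facets_sum_insert: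
  fixes \<phi> :: "(real^'d) set \<Rightarrow> real"
  shows "(\<Sum>F\<in>facets (convex hull (insert w P)). \<phi> F)
    = (\<Sum>F\<in>facets (convex hull P). \<phi> F) - \<phi> F0 + (\<Sum>j\<in>UNIV. \<phi> (G j))"
proof -
  have finf: "finite (facets (convex hull P))"
    using finite_polytope_faces[of "convex hull P"] fin
    by (auto simp: facets_def polytope_def intro: finite_subset[rotated])
  have "convex hull P \<subseteq> {p. c0 \<bullet> p \<le> k0}"
  proof (intro hull_minimal convex_halfspace_le subsetI CollectI)
    fix p assume "p \<in> P" then show "c0 \<bullet> p \<le> k0" using c0x c0p by (cases "p \<in> range x") (auto intro: less_imp_le)
  qed
  then have wn: "w \<notin> convex hull P" using c0w by auto
  have wG: "w \<in> G j" for j by (simp add: hull_inc)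
  have disj: "(facets (convex hull P) - {F0}) \<inter> range G = {}"
    using wn wG face_of_imp_subset by (fastforce simp: facets_def)
  have inj: "inj G"
  proof (rule injI, rule ccontr)
    fix i j assume eq: "G i = G j" and ne: "i \<noteq> j"
    have "x i \<in> G j" using ne by (intro hull_inc) auto
    moreover have "G i \<subseteq> {p. c i \<bullet> p = k i}"
      by (intro hull_minimal convex_hyperplane) (auto simp: cx cw)
    ultimately show False using eq cxj[of i] by auto
  qed
  have "(\<Sum>F\<in>facets (convex hull (insert w P)). \<phi> F)
     = (\<Sum>F\<in>facets (convex hull P) - {F0}. \<phi> F) + (\<Sum>F\<in>range G. \<phi> F)"
    unfolding facets_insert using finf disj by (intro sum.union_disjoint) auto
  also have "(\<Sum>F\<in>range G. \<phi> F) = (\<Sum>j\<in>UNIV. \<phi> (G j))" using inj by (simp add: sum.reindex)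
  also have "(\<Sum>F\<in>facets (convex hull P) - {F0}. \<phi> F) = (\<Sum>F\<in>facets (convex hull P). \<phi> F) - \<phi> F0"
    using finf F0_facet by (simp add: sum_diff1)
  finally show ?thesis by simp
qed

end

section \<open>Change of the surface area when a facet is replaced\<close>

text \<open>The contribution of a facet in the hyperplane \<open>c \<bullet> x = k\<close> per unit
  volume of its prism along a direction \<open>u\<close> with \<open>c \<bullet> u = 1\<close>:
  \<open>k / norm c\<close> is the distance of the hyperplane from 0, and \<open>norm c\<close> is
  the ratio of area to that volume.\<close>

definition facet_density :: "real \<Rightarrow> 'a::real_normed_vector \<Rightarrow> real \<Rightarrow> real" where
  "facet_density p c k = Lp_weight p (k / norm c) * norm c"

text \<open>The foot of the perpendicular from the origin lies in \<open>F\<close>, so the distance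
  of \<open>F\<close> is that of its hyperplane.\<close>

lemma infdist_foot:
  fixes F :: "'a::euclidean_space set"
  assumes F: "F \<subseteq> {x. c \<bullet> x = k}" and k: "0 < k" and foot: "(k / (c \<bullet> c)) *\<^sub>R c \<in> F"
  shows "infdist 0 F = k / norm c"
proof (rule antisym)
  have c0: "c \<noteq> 0" using F foot k by auto
  have nf: "norm ((k / (c \<bullet> c)) *\<^sub>R c) = k / norm c"
    using k c0 by (simp add: dot_square_norm power2_eq_square)
  show "infdist 0 F \<le> k / norm c" using infdist_le[OF foot, of 0] nf by simp
  have "k / norm c \<le> dist 0 x" if x: "x \<in> F" for x
  proof -
    have "k = c \<bullet> x" using F x by auto
    also have "\<dots> \<le> norm c * norm x" by (rule norm_cauchy_schwarz)
    finally show ?thesis using c0 by (simp add: field_simps)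
  qed
  then show "k / norm c \<le> infdist 0 F"
    using foot by (subst infdist_notempty) (auto intro!: cINF_greatest)
qed

lemma affine_lebesgue_graph:
  fixes F :: "(real^'d) set"
  assumes F: "F \<subseteq> {x. c \<bullet> x = k}" "compact F" "convex F" and u: "c \<bullet> u = 1"
    and dim: "aff_dim F = int CARD('d) - 1"
  shows "affine_lebesgue F = norm c * measure lebesgue (prism u F)"
proof -
  have c0: "c \<noteq> 0" using u by auto
  define n where "n = c /\<^sub>R norm c"
  have n1: "norm n = 1" using c0 by (simp add: n_def)
  have Fn: "F \<subseteq> {x. n \<bullet> x = k / norm c}" using F(1) by (auto simp: n_def divide_inverse)
  have nu: "n \<bullet> u = 1 / norm c" using u by (simp add: n_def divide_inverse)
  have "affine_lebesgue F = measure lebesgue (prism n F)"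
    by (intro affine_lebesgue_eq_prism[OF Fn n1] compact_imp_closed F dim)
  moreover have "measure lebesgue (prism u F) = \<bar>n \<bullet> u\<bar> * measure lebesgue (prism n F)"
    by (intro measure_prism_shear[OF Fn n1] F compact_imp_bounded)
  ultimately show ?thesis using c0 by (simp add: nu)
qed

lemma prism_affine_image:
  assumes T: "\<And>x y a b. a + b = 1 \<Longrightarrow> T (a *\<^sub>R x + b *\<^sub>R y) = a *\<^sub>R T x + b *\<^sub>R T y"
    and u: "\<And>x t. T (x + t *\<^sub>R u) = T x + t *\<^sub>R (u :: 'a::real_vector)"
  shows "T ` prism u (convex hull S) = prism u (convex hull (T ` S))"
proof -
  have lin: "linear (\<lambda>x. T x - T 0)"
  proof (rule linearI)
    fix a x
    have "T (a *\<^sub>R x) = a *\<^sub>R T x + (1 - a) *\<^sub>R T 0" using T[of a "1 - a" x 0] by simp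
    then show sc: "T (a *\<^sub>R x) - T 0 = a *\<^sub>R (T x - T 0)" by (simp add: algebra_simps)
  next
    fix x y
    have 1: "T ((1/2) *\<^sub>R x + (1/2) *\<^sub>R y) = (1/2) *\<^sub>R T x + (1/2) *\<^sub>R T y" by (rule T) simp
    have "T (x + y) = T (2 *\<^sub>R ((1/2) *\<^sub>R x + (1/2) *\<^sub>R y) + (-1) *\<^sub>R 0)" by (simp add: scaleR_add_right)
    also have "\<dots> = 2 *\<^sub>R T ((1/2) *\<^sub>R x + (1/2) *\<^sub>R y) + (-1) *\<^sub>R T 0" by (rule T) simp
    also have "\<dots> = T x + T y - T 0" unfolding 1 by (simp add: scaleR_add_right)
    finally show "T (x + y) - T 0 = T x - T 0 + (T y - T 0)" by simp
  qed
  have "T ` (convex hull S) = (\<lambda>x. T 0 + x) ` (\<lambda>x. T x - T 0) ` (convex hull S)" by (simp add: image_image)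
  also have "\<dots> = convex hull ((\<lambda>x. T 0 + x) ` (\<lambda>x. T x - T 0) ` S)"
    unfolding convex_hull_linear_image[OF lin, symmetric] convex_hull_translation ..
  also have "\<dots> = convex hull (T ` S)" by (simp add: image_image)
  finally have "T ` (convex hull S) = convex hull (T ` S)" .
  moreover have "T ` prism u X = prism u (T ` X)" for X
    unfolding prism_def using u by (auto simp: image_iff) metis+
  ultimately show ?thesis by simp
qed

context facet_swap
begin

lemma mem_F0: assumes "c0 \<bullet> v = k0" "\<And>i. c i \<bullet> v \<le> k i" shows "v \<in> F0"
proof -
  have s: "(\<Sum>j\<in>UNIV. lam j v) = 1" unfolding sum_lam using assms(1) c0w by simp
  have nn: "0 \<le> lam j v" for j using assms(2)[of j] cxj[of j] by (simp add: lam_def)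
  have "v = w + (\<Sum>j\<in>UNIV. lam j v *\<^sub>R (x j - w))" using expansion[of v] by (simp add: algebra_simps)
  also have "\<dots> = (\<Sum>j\<in>UNIV. lam j v *\<^sub>R x j)"
    using s by (simp add: scaleR_diff_right sum_subtractf flip: scaleR_left.sum)
  also have "\<dots> \<in> F0" using s nn by (intro convex_sum) (auto intro: hull_inc)
  finally show ?thesis .
qed

lemma mem_G: assumes "c j \<bullet> v = k j" "\<And>i. c i \<bullet> v \<le> k i" "k0 \<le> c0 \<bullet> v" shows "v \<in> G j"
proof -
  let ?s = "\<Sum>j\<in>UNIV. lam j v"
  have s: "?s \<le> 1" unfolding sum_lam using assms(3) c0w by (simp add: field_simps)
  have nn: "0 \<le> lam j v" for j using assms(2)[of j] cxj[of j] by (simp add: lam_def)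
  have j0: "lam j v = 0" using assms(1) by (simp add: lam_def)
  have "v = w + (\<Sum>j\<in>UNIV. lam j v *\<^sub>R (x j - w))" using expansion[of v] by (simp add: algebra_simps)
  also have "\<dots> = (1 - ?s) *\<^sub>R w + (\<Sum>i\<in>UNIV. lam i v *\<^sub>R x i)"
    by (simp add: scaleR_diff_right scaleR_diff_left sum_subtractf flip: scaleR_left.sum)
  also have "\<dots> = (1 - ?s) *\<^sub>R w + (\<Sum>i\<in>UNIV. lam i v *\<^sub>R (if i = j then w else x i))"
    using j0 by (intro arg_cong2[of _ _ _ _ "(+)"] sum.cong) auto
  \<comment> \<open>\<open>None\<close> indexes the apex, which takes the weight left over by the
    anchors; the vertex \<open>x j\<close> has weight zero and may be replaced by
    \<open>w\<close>.\<close>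
  also have "\<dots> = (\<Sum>i\<in>insert None (range Some). (case i of None \<Rightarrow> 1 - ?s | Some i \<Rightarrow> lam i v) *\<^sub>R
      (case i of None \<Rightarrow> w | Some i \<Rightarrow> (if i = j then w else x i)))"
    by (subst sum.insert) (auto simp: sum.reindex)
  also have "\<dots> \<in> G j"
  proof (rule convex_sum)
    show "(\<Sum>i\<in>insert None (range Some). case i of None \<Rightarrow> 1 - ?s | Some i \<Rightarrow> lam i v) = 1"
      by (subst sum.insert) (auto simp: sum.reindex)
  qed (use s nn in \<open>auto intro: hull_inc split: option.splits\<close>)
  finally show ?thesis .
qed

lemma F0_hyperplane: "F0 \<subseteq> {y. c0 \<bullet> y = k0}"
  by (intro hull_minimal convex_hyperplane) (auto simp: c0x)

lemma G_hyperplane: "G j \<subseteq> {y. c j \<bullet> y = k j}"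
  by (intro hull_minimal convex_hyperplane) (auto simp: cx cw)

text \<open>The barycentric coordinates in \<open>F0\<close> of the projection of \<open>w\<close>
  along \<open>u\<close>; hence also the share of \<open>F0\<close> that lies under the lateral
  facet \<open>G j\<close>.\<close>

definition bw :: "'d \<Rightarrow> real" where
  "bw j = (c0 \<bullet> w - k0) / (k j - c j \<bullet> x j)"

lemma bw_pos: "0 < bw j" using c0w cxj[of j] by (simp add: bw_def)

context
  fixes u assumes cu: "\<And>j. c j \<bullet> u = 1" and c0u: "c0 \<bullet> u = 1"
begin

lemma sum_bw: "(\<Sum>j\<in>UNIV. bw j) = 1"
proof -
  have l: "lam j (w - u) = 1 / (k j - c j \<bullet> x j)" for j
    by (simp add: lam_def inner_diff_right cu cw)
  have "(\<Sum>j\<in>UNIV. lam j (w - u)) = 1 / (c0 \<bullet> w - k0)"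
    unfolding sum_lam by (simp add: inner_diff_right c0u)
  then have "(c0 \<bullet> w - k0) * (\<Sum>j\<in>UNIV. 1 / (k j - c j \<bullet> x j)) = 1"
    using c0w unfolding l by simp
  then show ?thesis by (simp add: bw_def sum_distrib_left)
qed

text \<open>The affine map that moves \<open>x j\<close> to \<open>w\<close> and fixes the other
  anchors and the direction \<open>u\<close> carries one prism to the other; it is a rank-one
  perturbation of the identity with determinant \<open>bw j\<close>.\<close>

lemma measure_prism_G: "measure lebesgue (prism u (G j)) = bw j * measure lebesgue (prism u F0)"
proof -
  define \<delta> where "\<delta> = k j - c j \<bullet> x j"
  have \<delta>: "0 < \<delta>" using cxj[of j] by (simp add: \<delta>_def)
  \<comment> \<open>\<open>l \<bullet> v - m\<close> is the barycentric coordinate belonging to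
    \<open>x j\<close>, extended to be constant along \<open>u\<close>.\<close>
  define l where "l = (c0 - c j) /\<^sub>R \<delta>"
  define m where "m = (k0 - k j) / \<delta>"
  have lm: "l \<bullet> v - m = ((c0 \<bullet> v - k0) - (c j \<bullet> v - k j)) / \<delta>" for v
    by (simp add: l_def m_def inner_diff_left divide_inverse algebra_simps)
  have lx: "l \<bullet> x i - m = (if i = j then 1 else 0)" for i
    unfolding lm c0x using cx[of i j] \<delta> by (auto simp: \<delta>_def)
  have lu: "l \<bullet> u = 0" by (simp add: l_def inner_diff_left cu c0u)
  have lw: "l \<bullet> w - m = bw j" unfolding lm cw by (simp add: bw_def \<delta>_def)
  let ?T = "\<lambda>v. v + (l \<bullet> v) *\<^sub>R (w - x j) + (- m *\<^sub>R (w - x j))"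
  have T: "?T v = v + (l \<bullet> v - m) *\<^sub>R (w - x j)" for v by (simp add: algebra_simps)
  have Tx: "?T (x i) = (if i = j then w else x i)" for i unfolding T lx by simp
  have "?T ` prism u F0 = prism u (convex hull (?T ` range x))"
  proof (rule prism_affine_image)
    fix y z :: "real^'d" and a b :: real assume ab: "a + b = 1"
    have b: "b = 1 - a" using ab by simp
    show "?T (a *\<^sub>R y + b *\<^sub>R z) = a *\<^sub>R ?T y + b *\<^sub>R ?T z"
      unfolding b by (simp add: inner_add_right algebra_simps)
  qed (simp add: inner_add_right lu)
  also have "?T ` range x = insert w (x ` (- {j}))"
    unfolding image_image Tx by auto
  finally have im: "?T ` prism u F0 = prism u (G j)" .
  have m0: "prism u F0 \<in> lmeasurable"
    by (intro prism_lmeasurable convex_convex_hull compact_imp_bounded finite_imp_compact_convex_hull) simp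
  have "measure lebesgue (?T ` prism u F0) = \<bar>1 + l \<bullet> (w - x j)\<bar> * measure lebesgue (prism u F0)"
    by (rule measure_rank_one_image(1)[OF m0])
  also have "1 + l \<bullet> (w - x j) = bw j" using lw lx[of j] by (simp add: inner_diff_right)
  finally show ?thesis using bw_pos[of j] unfolding im by simp
qed

lemma mem_prism_F0:
  assumes "0 < c0 \<bullet> v - k0" "c0 \<bullet> v - k0 < 1" "\<And>j. c j \<bullet> v - k j \<le> c0 \<bullet> v - k0"
  shows "v \<in> prism u F0"
proof -
  let ?s = "c0 \<bullet> v - k0"
  have "v - ?s *\<^sub>R u \<in> F0"
  proof (rule mem_F0)
    show "c0 \<bullet> (v - ?s *\<^sub>R u) = k0" by (simp add: inner_diff_right c0u)
    show "c i \<bullet> (v - ?s *\<^sub>R u) \<le> k i" for i using assms(3)[of i] by (simp add: inner_diff_right cu)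
  qed
  then show ?thesis unfolding prism_def using assms(1,2)
    by (intro CollectI exI[of _ "v - ?s *\<^sub>R u"] exI[of _ ?s]) auto
qed

text \<open>The foot conditions place the foot of each perpendicular from the origin inside its
  facet, so that all distances are those of hyperplanes. The lateral facets share the prism volume
  of \<open>F0\<close> according to \<open>bw\<close>, which leaves a weighted mean of density
  differences.\<close>

lemma Lp_surface_area_insert:
  assumes foot0: "0 < k0" "\<And>i. (k0 / (c0 \<bullet> c0)) * (c i \<bullet> c0) \<le> k i"
    and foot: "\<And>j. 0 < k j" "\<And>i j. i \<noteq> j \<Longrightarrow> (k j / (c j \<bullet> c j)) * (c i \<bullet> c j) \<le> k i" "\<And>j. k0 \<le> (k j / (c j \<bullet> c j)) * (c0 \<bullet> c j)"
  shows "Lp_surface_area p (convex hull (insert w P)) - Lp_surface_area p (convex hull P)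
    = measure lebesgue (prism u F0) * (\<Sum>j\<in>UNIV. bw j * (facet_density p (c j) (k j) - facet_density p c0 k0))"
proof -
  define \<phi> where "\<phi> F = Lp_weight p (infdist 0 F) * affine_lebesgue F" for F :: "(real^'d) set"
  have poly: "polytope (convex hull P)" "polytope (convex hull (insert w P))" using fin by (auto simp: polytope_def)
  have comp: "compact F0" "compact (G j)" for j by (auto intro: finite_imp_compact_convex_hull)
  have cc: "c j \<bullet> c j \<noteq> 0" "c0 \<bullet> c0 \<noteq> 0" for j using c_nz c0_nz by auto
  have f0: "\<phi> F0 = measure lebesgue (prism u F0) * facet_density p c0 k0"
  proof -
    have "(k0 / (c0 \<bullet> c0)) *\<^sub>R c0 \<in> F0" using foot0 cc by (intro mem_F0) auto
    from infdist_foot[OF F0_hyperplane foot0(1) this]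
    show ?thesis
      using affine_lebesgue_graph[OF F0_hyperplane comp(1) convex_convex_hull c0u aff_dim_F0]
      by (simp add: \<phi>_def facet_density_def)
  qed
  have fj: "\<phi> (G j) = bw j * measure lebesgue (prism u F0) * facet_density p (c j) (k j)" for j
  proof -
    have "c i \<bullet> ((k j / (c j \<bullet> c j)) *\<^sub>R c j) \<le> k i" for i using foot(2)[of i j] cc(1)[of j] by (cases "i = j") auto
    then have "(k j / (c j \<bullet> c j)) *\<^sub>R c j \<in> G j" using foot(3)[of j] cc(1)[of j] by (intro mem_G) auto
    from infdist_foot[OF G_hyperplane foot(1) this]
    show ?thesis
      using affine_lebesgue_graph[OF G_hyperplane comp(2) convex_convex_hull cu aff_dim_G]
        measure_prism_G[of j]
      by (simp add: \<phi>_def facet_density_def)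
  qed
  have "Lp_surface_area p (convex hull (insert w P)) - Lp_surface_area p (convex hull P) = (\<Sum>j\<in>UNIV. \<phi> (G j)) - \<phi> F0"
    unfolding Lp_surface_area_eq_sum[OF poly(1)] Lp_surface_area_eq_sum[OF poly(2)] \<phi>_def[symmetric]
      facets_sum_insert by simp
  also have "\<dots> = measure lebesgue (prism u F0) * (\<Sum>j\<in>UNIV. bw j * facet_density p (c j) (k j))
     - measure lebesgue (prism u F0) * facet_density p c0 k0 * (\<Sum>j\<in>UNIV. bw j)"
    unfolding f0 fj sum_bw by (simp add: sum_distrib_left mult_ac)
  also have "\<dots> = measure lebesgue (prism u F0) * (\<Sum>j\<in>UNIV. bw j * (facet_density p (c j) (k j) - facet_density p c0 k0))"
  proof -
    have "(\<Sum>j\<in>UNIV. bw j * (facet_density p (c j) (k j) - facet_density p c0 k0))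
      = (\<Sum>j\<in>UNIV. bw j * facet_density p (c j) (k j)) - (\<Sum>j\<in>UNIV. bw j) * facet_density p c0 k0"
      by (simp add: right_diff_distrib sum_subtractf sum_distrib_right)
    then show ?thesis by (simp add: right_diff_distrib mult_ac)
  qed
  finally show ?thesis .
qed

end

end


section \<open>Pyramids in a small cap\<close>

text \<open>Convexity of the exponential function between 0 and \<open>ln y\<close>.\<close>

lemma powr_le_tangent:
  fixes y a :: real
  assumes "0 < y" "0 \<le> a" "a \<le> 1"
  shows "y powr a \<le> 1 + a * (y - 1)"
proof -
  have "exp ((1 - a) *\<^sub>R 0 + a *\<^sub>R ln y) \<le> (1 - a) * exp 0 + a * exp (ln y)"
    by (rule convex_onD[OF exp_convex]) (use assms in auto)
  then show ?thesis using assms by (simp add: powr_def algebra_simps)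
qed

text \<open>The upper bound is the tangent. For the lower bound the tangent bound is applied to the
  complementary exponent \<open>1 - a\<close>, because the two powers multiply to
  \<open>1 + x\<close>.\<close>

lemma powr_second_order:
  fixes x a :: real
  assumes "\<bar>x\<bar> \<le> 1 / 2" "0 \<le> a" "a \<le> 1"
  shows "\<bar>(1 + x) powr a - (1 + a * x)\<bar> \<le> 2 * x\<^sup>2"
proof -
  have pos: "0 < 1 + x" using assms(1) by linarith
  have up: "(1 + x) powr a \<le> 1 + a * x" using powr_le_tangent[OF pos assms(2,3)] by simp
  let ?b = "1 - a"
  have B: "(1 + x) powr ?b \<le> 1 + ?b * x" using powr_le_tangent[OF pos, of ?b] assms by simp
  have Bp: "0 < (1 + x) powr ?b" using pos by simp
  have b2: "?b * x \<ge> - (1 / 2)"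
  proof -
    have "\<bar>?b * x\<bar> \<le> 1 * (1 / 2)" unfolding abs_mult using assms by (intro mult_mono) auto
    then show ?thesis by linarith
  qed
  have ab: "a * ?b \<le> 1" using assms mult_mono[of a 1 ?b 1] by simp
  have "(1 + a * x - 2 * x\<^sup>2) * (1 + ?b * x) = 1 + x + x\<^sup>2 * (a * ?b - 2 - 2 * (?b * x))"
    by (simp add: power2_eq_square algebra_simps)
  also have "\<dots> \<le> 1 + x" using ab b2 by (simp add: mult_nonneg_nonpos)
  also have "\<dots> = (1 + x) powr a * (1 + x) powr ?b" using pos by (simp add: powr_add[symmetric])
  also have "\<dots> \<le> (1 + x) powr a * (1 + ?b * x)" using B by (intro mult_left_mono) auto
  finally have "(1 + a * x - 2 * x\<^sup>2) * (1 + ?b * x) \<le> (1 + x) powr a * (1 + ?b * x)" .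
  then have "1 + a * x - 2 * x\<^sup>2 \<le> (1 + x) powr a"
    using B Bp by (simp add: mult_le_cancel_right)
  then show ?thesis using up by (simp add: abs_le_iff)
qed

text \<open>\<open>facet_density\<close> for squared normal length \<open>1 + e * q\<close> and
  level \<open>1 + e * \<alpha>\<close>. In use \<open>e\<close> is the square of \<open>r\<close>,
  \<open>q\<close> the squared slope of the rescaled facet and \<open>\<alpha>\<close> its
  height.\<close>

definition density_model :: "real \<Rightarrow> real \<Rightarrow> real \<Rightarrow> real \<Rightarrow> real" where
  "density_model p e q \<alpha> = (1 + e * q) powr (p / 2) * (1 + e * \<alpha>) powr (1 - p)"

text \<open>The two factors are expanded separately. Their errors and the product of their
  first-order parts contribute at most 2, 5 and 2 times the square of \<open>e\<close>; 20 is a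
  generous round bound.\<close>

lemma density_model_second_order:
  assumes p: "0 \<le> p" "p \<le> 1" and e: "0 \<le> e" "e \<le> 1 / 100" and q: "0 \<le> q" "q \<le> 1" and \<alpha>: "\<bar>\<alpha>\<bar> \<le> 3 / 2"
  shows "\<bar>density_model p e q \<alpha> - (1 + e * (p * q / 2 + (1 - p) * \<alpha>))\<bar> \<le> 20 * e\<^sup>2"
proof -
  define E1 where "E1 = (1 + e * q) powr (p / 2) - (1 + (p / 2) * (e * q))"
  define E2 where "E2 = (1 + e * \<alpha>) powr (1 - p) - (1 + (1 - p) * (e * \<alpha>))"
  have eq1: "\<bar>e * q\<bar> \<le> e * 1" unfolding abs_mult using e q by (intro mult_mono) auto
  have eq2: "\<bar>e * \<alpha>\<bar> \<le> e * (3 / 2)" unfolding abs_mult using e \<alpha> by (intro mult_mono) auto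
  have "\<bar>E1\<bar> \<le> 2 * (e * q)\<^sup>2" unfolding E1_def using eq1 e p by (intro powr_second_order) auto
  moreover have "(e * q)\<^sup>2 \<le> (e * 1)\<^sup>2" using eq1 by (rule power2_le_iff_abs_le[THEN iffD2, rotated]) (use e in auto)
  ultimately have E1: "\<bar>E1\<bar> \<le> 2 * e\<^sup>2" by simp
  have "\<bar>E2\<bar> \<le> 2 * (e * \<alpha>)\<^sup>2" unfolding E2_def using eq2 e p by (intro powr_second_order) auto
  moreover have "(e * \<alpha>)\<^sup>2 \<le> (e * (3 / 2))\<^sup>2" using eq2 by (rule power2_le_iff_abs_le[THEN iffD2, rotated]) (use e in auto)
  ultimately have E2: "\<bar>E2\<bar> \<le> 5 * e\<^sup>2" by (simp add: power_mult_distrib power2_eq_square)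
  define X where "X = (p / 2) * (e * q) + E1"
  define Y where "Y = (1 - p) * (e * \<alpha>) + E2"
  have ee: "e\<^sup>2 \<le> e / 100" using e mult_left_mono[of e "1/100" e] by (simp add: power2_eq_square)
  have "\<bar>(p / 2) * (e * q)\<bar> \<le> (1 / 2) * (e * 1)" unfolding abs_mult[of "p / 2"] using p eq1 by (intro mult_mono) auto
  then have X: "\<bar>X\<bar> \<le> e" unfolding X_def using E1 ee by linarith
  have "\<bar>(1 - p) * (e * \<alpha>)\<bar> \<le> 1 * (e * (3 / 2))" unfolding abs_mult[of "1 - p"] using p eq2 by (intro mult_mono) auto
  then have Y: "\<bar>Y\<bar> \<le> 2 * e" unfolding Y_def using E2 ee by linarith
  have XY: "\<bar>X * Y\<bar> \<le> e * (2 * e)" unfolding abs_mult using X Y e by (intro mult_mono) auto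
  have "density_model p e q \<alpha> = (1 + X) * (1 + Y)"
    by (simp add: density_model_def X_def Y_def E1_def E2_def)
  then have "density_model p e q \<alpha> - (1 + e * (p * q / 2 + (1 - p) * \<alpha>)) = E1 + E2 + X * Y"
    by (simp add: X_def Y_def algebra_simps)
  then show ?thesis using E1 E2 XY by (simp add: power2_eq_square)
qed

lemma facet_density_eq_model:
  assumes "norm c = sqrt (1 + e * q)" "0 < 1 + e * q" "0 < 1 + e * \<alpha>"
  shows "facet_density p c (1 + e * \<alpha>) = density_model p e q \<alpha>"
proof -
  let ?N = "1 + e * q" and ?K = "1 + e * \<alpha>"
  have N: "sqrt ?N = ?N powr (1 / 2)" using assms(2) by (simp add: powr_half_sqrt)
  show ?thesis
  proof (cases "p = 1")
    case True
    then show ?thesis using assms by (simp add: facet_density_def Lp_weight_def density_model_def N)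
  next
    case False
    have "facet_density p c ?K = (?K / sqrt ?N) powr (1 - p) * sqrt ?N"
      using False assms(1) by (simp add: facet_density_def Lp_weight_def)
    also have "\<dots> = ?K powr (1 - p) / (?N powr (1 / 2)) powr (1 - p) * ?N powr (1 / 2)"
      unfolding N using assms by (simp add: powr_divide)
    also have "\<dots> = ?K powr (1 - p) * (?N powr (1 / 2) / ?N powr ((1 / 2) * (1 - p)))"
      by (simp add: powr_powr)
    also have "?N powr (1 / 2) / ?N powr ((1 / 2) * (1 - p)) = ?N powr (p / 2)"
    proof -
      have "1 / 2 - 1 / 2 * (1 - p) = p / 2" by (simp add: field_simps)
      then show ?thesis by (simp only: powr_diff[symmetric])
    qed
    finally show ?thesis by (simp add: density_model_def mult.commute)
  qed
qed

section \<open>Regular simplices and hyperplanes through nearby points\<close>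

text \<open>The \<open>v i\<close> are the vertices of a regular simplex centred at 0 in the
  orthogonal complement of \<open>u\<close>: projections of an orthonormal basis whose diagonal
  points along \<open>u\<close>. The last conjunct is Parseval's identity for that basis.\<close>

definition simplex_frame :: "(real^'d) \<Rightarrow> ('d \<Rightarrow> real^'d) \<Rightarrow> bool" where
  "simplex_frame u v \<longleftrightarrow> norm u = 1 \<and> (\<forall>i. u \<bullet> v i = 0) \<and>
     (\<forall>i j. v i \<bullet> v j = (if i = j then 1 else 0) - 1 / real CARD('d)) \<and> (\<Sum>i\<in>UNIV. v i) = 0 \<and>
     (\<forall>\<Delta>. u \<bullet> \<Delta> = 0 \<longrightarrow> (\<Sum>i\<in>UNIV. (\<Delta> \<bullet> v i)\<^sup>2) = (norm \<Delta>)\<^sup>2)"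

text \<open>A rotation takes the diagonal \<open>o1\<close> of the standard basis to
  \<open>u\<close>; the component along \<open>u\<close> is then removed from the rotated basis
  vectors.\<close>

lemma simplex_frame_exists:
  fixes u :: "real^'d"
  assumes u: "norm u = 1"
  obtains v where "simplex_frame u v"
proof -
  let ?d = "real CARD('d)"
  define o1 :: "real^'d" where "o1 = (\<chi> i. 1 / sqrt ?d)"
  have d0: "0 < ?d" by simp
  have "o1 \<bullet> o1 = 1" using d0 by (simp add: o1_def inner_vec_def)
  then have "norm o1 = 1" unfolding norm_eq_1 .
  then have no: "norm o1 = norm u" using u by simp
  obtain R where R: "orthogonal_transformation R" "R o1 = u"
    by (rule orthogonal_transformation_exists[OF no])
  have lR: "linear R" and iR: "R x \<bullet> R y = x \<bullet> y" for x y using R by (auto simp: orthogonal_transformation_def)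
  define s where "s i = R (axis i 1)" for i
  define v where "v i = s i - (1 / sqrt ?d) *\<^sub>R u" for i
  have ss: "s i \<bullet> s j = (if i = j then 1 else 0)" for i j by (simp add: s_def iR inner_axis_axis)
  have us: "u \<bullet> s i = 1 / sqrt ?d" for i
    unfolding s_def R(2)[symmetric] iR by (simp add: o1_def inner_axis)
  have uu: "u \<bullet> u = 1" using u by (simp add: norm_eq_1)
  have dd: "(1 / sqrt ?d) * (1 / sqrt ?d) = 1 / ?d" using d0 by simp
  have uv: "u \<bullet> v i = 0" for i by (simp add: v_def inner_diff_right us uu)
  have vv: "v i \<bullet> v j = (if i = j then 1 else 0) - 1 / ?d" for i j
  proof -
    have "v i \<bullet> v j = s i \<bullet> v j"
      unfolding v_def[of i] inner_diff_left using uv by simp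
    also have "\<dots> = s i \<bullet> s j - (1 / sqrt ?d) * (u \<bullet> s i)"
      by (simp add: v_def inner_diff_right inner_commute)
    finally show ?thesis unfolding ss us dd .
  qed
  have "(\<Sum>i\<in>UNIV. s i) = R (\<Sum>i\<in>UNIV. axis i 1)" unfolding s_def by (simp add: linear_sum[OF lR])
  also have "(\<Sum>i\<in>UNIV. axis i 1) = sqrt ?d *\<^sub>R o1"
    by (simp add: vec_eq_iff o1_def axis_def if_distrib cong: if_cong)
  finally have sums: "(\<Sum>i\<in>UNIV. s i) = sqrt ?d *\<^sub>R u" by (simp add: linear_cmul[OF lR] R(2))
  have "?d / sqrt ?d = sqrt ?d" by (simp add: real_div_sqrt)
  then have sumv: "(\<Sum>i\<in>UNIV. v i) = 0"
    unfolding v_def sum_subtractf sums sum_constant_scaleR by simp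
  have "(\<Sum>i\<in>UNIV. (\<Delta> \<bullet> v i)\<^sup>2) = (norm \<Delta>)\<^sup>2" if \<Delta>: "u \<bullet> \<Delta> = 0" for \<Delta>
  proof -
    obtain \<Delta>' where D': "\<Delta> = R \<Delta>'" using orthogonal_transformation_surj[OF R(1)] by (metis surjD)
    have "\<Delta> \<bullet> v i = \<Delta>' $ i" for i
      using \<Delta> by (simp add: v_def inner_diff_right inner_commute[of \<Delta> u]) (simp add: D' s_def iR inner_axis)
    then have "(\<Sum>i\<in>UNIV. (\<Delta> \<bullet> v i)\<^sup>2) = \<Delta>' \<bullet> \<Delta>'" by (simp add: inner_vec_def power2_eq_square)
    also have "\<dots> = \<Delta> \<bullet> \<Delta>" by (simp add: D' iR)
    finally show ?thesis by (simp add: power2_norm_eq_inner)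
  qed
  then have "simplex_frame u v" unfolding simplex_frame_def using u uv vv sumv by blast
  then show thesis by (rule that)
qed

text \<open>As the \<open>v i\<close> sum to zero, the inner product with the omitted
  \<open>v j\<close> is controlled by the others, and Parseval's identity bounds the norm.\<close>

lemma simplex_frame_coercive:
  fixes u :: "real^'d"
  assumes fr: "simplex_frame u v" and \<Delta>: "u \<bullet> \<Delta> = 0" and M: "0 \<le> M" "\<And>i. i \<noteq> j \<Longrightarrow> \<bar>\<Delta> \<bullet> v i\<bar> \<le> M"
  shows "norm \<Delta> \<le> real CARD('d) * M"
proof -
  let ?d = "real CARD('d)"
  have d1: "1 \<le> ?d" by (simp add: Suc_leI)
  have c1: "real (card (UNIV - {j})) = ?d - 1" using d1 by (simp add: card_Diff_singleton of_nat_diff)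
  have "0 = (\<Sum>i\<in>UNIV. \<Delta> \<bullet> v i)"
    using fr by (simp add: simplex_frame_def flip: inner_sum_right)
  also have "\<dots> = \<Delta> \<bullet> v j + (\<Sum>i\<in>UNIV - {j}. \<Delta> \<bullet> v i)" by (simp add: sum.remove)
  finally have "\<bar>\<Delta> \<bullet> v j\<bar> = \<bar>\<Sum>i\<in>UNIV - {j}. \<Delta> \<bullet> v i\<bar>" by linarith
  also have "\<dots> \<le> (\<Sum>i\<in>UNIV - {j}. \<bar>\<Delta> \<bullet> v i\<bar>)" by (rule sum_abs)
  also have "\<dots> \<le> real (card (UNIV - {j})) * M" using M(2) by (intro sum_bounded_above) auto
  finally have vj: "\<bar>\<Delta> \<bullet> v j\<bar> \<le> (?d - 1) * M" unfolding c1 .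
  have sq: "(\<Delta> \<bullet> v i)\<^sup>2 \<le> M\<^sup>2" if "i \<noteq> j" for i
    using M(2)[OF that] M(1) by (simp add: power2_le_iff_abs_le)
  have "(norm \<Delta>)\<^sup>2 = (\<Sum>i\<in>UNIV. (\<Delta> \<bullet> v i)\<^sup>2)" using fr \<Delta> by (simp add: simplex_frame_def)
  also have "\<dots> = (\<Delta> \<bullet> v j)\<^sup>2 + (\<Sum>i\<in>UNIV - {j}. (\<Delta> \<bullet> v i)\<^sup>2)" by (simp add: sum.remove)
  also have "\<dots> \<le> ((?d - 1) * M)\<^sup>2 + real (card (UNIV - {j})) * M\<^sup>2"
  proof (intro add_mono sum_bounded_above)
    have "0 \<le> (?d - 1) * M" using M(1) d1 by simp
    then show "(\<Delta> \<bullet> v j)\<^sup>2 \<le> ((?d - 1) * M)\<^sup>2" using vj power2_le_iff_abs_le by blast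
  qed (use sq in auto)
  also have "\<dots> = (?d - 1) * ?d * M\<^sup>2" unfolding c1 by (simp add: power2_eq_square algebra_simps)
  also have "\<dots> \<le> ?d * ?d * M\<^sup>2" using d1 by (intro mult_right_mono) auto
  also have "\<dots> = (?d * M)\<^sup>2" by (simp add: power2_eq_square)
  finally have "(norm \<Delta>)\<^sup>2 \<le> (?d * M)\<^sup>2" .
  then show ?thesis by (rule power2_le_imp_le) (use M(1) in simp)
qed

text \<open>Averaging the differences over \<open>l\<close> recovers
  \<open>\<Delta> \<bullet> v i\<close>, because the \<open>v l\<close> sum to zero.\<close>

lemma simplex_frame_coercive_diff:
  fixes u :: "real^'d"
  assumes fr: "simplex_frame u v" and \<Delta>: "u \<bullet> \<Delta> = 0" and M: "0 \<le> M" "\<And>i l. \<bar>\<Delta> \<bullet> (v i - v l)\<bar> \<le> M"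
  shows "norm \<Delta> \<le> real CARD('d) * M"
proof (rule simplex_frame_coercive[OF fr \<Delta> M(1), of undefined])
  fix i
  let ?d = "real CARD('d)"
  have "?d * (\<Delta> \<bullet> v i) = (\<Sum>l\<in>UNIV. \<Delta> \<bullet> (v i - v l)) + \<Delta> \<bullet> (\<Sum>l\<in>UNIV. v l)"
    by (simp add: inner_diff_right sum_subtractf inner_sum_right)
  also have "\<dots> = (\<Sum>l\<in>UNIV. \<Delta> \<bullet> (v i - v l))" using fr by (simp add: simplex_frame_def)
  finally have "?d * \<bar>\<Delta> \<bullet> v i\<bar> = \<bar>\<Sum>l\<in>UNIV. \<Delta> \<bullet> (v i - v l)\<bar>" by (metis abs_mult abs_of_nat)
  also have "\<dots> \<le> (\<Sum>l\<in>UNIV. \<bar>\<Delta> \<bullet> (v i - v l)\<bar>)" by (rule sum_abs)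
  also have "\<dots> \<le> ?d * M" using M(2) by (intro sum_bounded_above) auto
  finally show "\<bar>\<Delta> \<bullet> v i\<bar> \<le> M" by simp
qed

text \<open>Any d points lie in some hyperplane. Coercivity of the ideal points rules out that it is
  parallel to \<open>u\<close>, and it bounds the deviation of the slope, without inverting a
  matrix.\<close>

lemma hyperplane_fit:
  fixes u :: "real^'d" and q q0 :: "'d \<Rightarrow> real^'d"
  assumes u: "norm u = 1" and \<beta>0: "u \<bullet> \<beta>0 = 0" and on: "\<And>i. (u - \<beta>0) \<bullet> q0 i = \<alpha>0"
    and coer: "\<And>\<Delta> M. u \<bullet> \<Delta> = 0 \<Longrightarrow> 0 \<le> M \<Longrightarrow> (\<And>i l. \<bar>\<Delta> \<bullet> (q0 i - q0 l)\<bar> \<le> M) \<Longrightarrow> norm \<Delta> \<le> real CARD('d) * M"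
    and close: "\<And>i. norm (q i - q0 i) \<le> \<epsilon>" and \<epsilon>: "4 * real CARD('d) * \<epsilon> \<le> 1"
  obtains \<beta> \<alpha> where "u \<bullet> \<beta> = 0" "\<And>i. (u - \<beta>) \<bullet> q i = \<alpha>"
    "norm (\<beta> - \<beta>0) \<le> 4 * real CARD('d) * \<epsilon> * (1 + norm \<beta>0)"
    "\<And>i. \<bar>\<alpha> - \<alpha>0\<bar> \<le> (1 + norm \<beta>) * \<epsilon> + norm (\<beta> - \<beta>0) * norm (q0 i)"
proof -
  let ?d = "real CARD('d)"
  have uu: "u \<bullet> u = 1" using u by (simp add: norm_eq_1)
  have \<epsilon>0: "0 \<le> \<epsilon>" using close[of undefined] norm_ge_zero order_trans by blast
  have diff: "\<bar>f \<bullet> (q0 i - q0 l)\<bar> \<le> norm f * (2 * \<epsilon>)" if f: "\<And>i l. f \<bullet> (q i - q l) = 0" for f i l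
  proof -
    have "f \<bullet> (q0 i - q0 l) = - (f \<bullet> ((q i - q0 i) - (q l - q0 l)))"
      using f[of i l] by (simp add: inner_diff_right)
    then have "\<bar>f \<bullet> (q0 i - q0 l)\<bar> \<le> norm f * norm ((q i - q0 i) - (q l - q0 l))"
      by (metis Cauchy_Schwarz_ineq2 abs_minus_cancel)
    also have "norm ((q i - q0 i) - (q l - q0 l)) \<le> 2 * \<epsilon>"
      using norm_triangle_ineq4[of "q i - q0 i" "q l - q0 l"] close[of i] close[of l] by linarith
    finally show ?thesis by (simp add: mult_left_mono)
  qed
  have "aff_dim (range q) < int DIM(real^'d)"
  proof -
    have "aff_dim (range q) \<le> int (card (range q)) - 1" by (rule aff_dim_le_card) simp
    moreover have "card (range q) \<le> CARD('d)" by (rule card_image_le) simp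
    ultimately show ?thesis by simp
  qed
  then obtain e \<kappa> where e: "e \<noteq> 0" "range q \<subseteq> {x. e \<bullet> x = \<kappa>}" using aff_lowdim_subset_hyperplane by blast
  have eq: "e \<bullet> q i = \<kappa>" for i using e(2) by auto
  have ue: "u \<bullet> e \<noteq> 0"
  proof
    assume z: "u \<bullet> e = 0"
    have "norm e \<le> ?d * (norm e * (2 * \<epsilon>))"
      using \<epsilon>0 by (intro coer[OF z] diff) (auto simp: inner_diff_right eq)
    also have "\<dots> = (4 * ?d * \<epsilon>) * (norm e / 2)" by simp
    also have "\<dots> \<le> 1 * (norm e / 2)" using \<epsilon> by (intro mult_right_mono) auto
    finally show False using e(1) by simp
  qed
  \<comment> \<open>The normal is scaled to the form \<open>u - \<beta>\<close> with
    \<open>\<beta>\<close> orthogonal to \<open>u\<close>.\<close>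
  define \<beta> where "\<beta> = u - e /\<^sub>R (u \<bullet> e)"
  define \<alpha> where "\<alpha> = \<kappa> / (u \<bullet> e)"
  have u\<beta>: "u \<bullet> \<beta> = 0" using ue by (simp add: \<beta>_def inner_diff_right uu)
  have on': "(u - \<beta>) \<bullet> q i = \<alpha>" for i by (simp add: \<beta>_def \<alpha>_def eq divide_inverse)
  have uD: "u \<bullet> (\<beta> - \<beta>0) = 0" using u\<beta> \<beta>0 by (simp add: inner_diff_right)
  have nub: "norm (u - \<beta>) \<le> 1 + norm \<beta>0 + norm (\<beta> - \<beta>0)"
    using norm_triangle_ineq4[of u \<beta>] norm_triangle_ineq[of \<beta>0 "\<beta> - \<beta>0"] u by simp
  \<comment> \<open>The deviation occurs on both sides; as
    \<open>4 * real CARD('d) * \<epsilon> \<le> 1\<close>, half of it absorbs the term on the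
    right.\<close>
  have "norm (\<beta> - \<beta>0) \<le> ?d * ((1 + norm \<beta>0 + norm (\<beta> - \<beta>0)) * (2 * \<epsilon>))"
  proof (rule coer[OF uD])
    fix i l
    have "(\<beta> - \<beta>0) \<bullet> (q0 i - q0 l) = - ((u - \<beta>) \<bullet> (q0 i - q0 l))"
      using on[of i] on[of l] by (simp add: inner_diff_left inner_diff_right)
    then have "\<bar>(\<beta> - \<beta>0) \<bullet> (q0 i - q0 l)\<bar> = \<bar>(u - \<beta>) \<bullet> (q0 i - q0 l)\<bar>" by simp
    also have "\<dots> \<le> norm (u - \<beta>) * (2 * \<epsilon>)" by (rule diff) (simp add: inner_diff_right on')
    also have "\<dots> \<le> (1 + norm \<beta>0 + norm (\<beta> - \<beta>0)) * (2 * \<epsilon>)" using nub \<epsilon>0 by (intro mult_right_mono) auto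
    finally show "\<bar>(\<beta> - \<beta>0) \<bullet> (q0 i - q0 l)\<bar> \<le> (1 + norm \<beta>0 + norm (\<beta> - \<beta>0)) * (2 * \<epsilon>)" .
  qed (use \<epsilon>0 in simp)
  also have "\<dots> = 2 * ?d * \<epsilon> * (1 + norm \<beta>0) + (4 * ?d * \<epsilon>) * (norm (\<beta> - \<beta>0) / 2)" by (simp add: algebra_simps)
  also have "\<dots> \<le> 2 * ?d * \<epsilon> * (1 + norm \<beta>0) + 1 * (norm (\<beta> - \<beta>0) / 2)"
    using \<epsilon> \<epsilon>0 by (intro add_mono mult_right_mono) auto
  finally have b: "norm (\<beta> - \<beta>0) \<le> 4 * ?d * \<epsilon> * (1 + norm \<beta>0)" by simp
  have "\<bar>\<alpha> - \<alpha>0\<bar> \<le> (1 + norm \<beta>) * \<epsilon> + norm (\<beta> - \<beta>0) * norm (q0 i)" for i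
  proof -
    have "\<alpha> - \<alpha>0 = (u - \<beta>) \<bullet> (q i - q0 i) - (\<beta> - \<beta>0) \<bullet> q0 i"
      using on'[of i] on[of i] by (simp add: inner_diff_left inner_diff_right)
    then have "\<bar>\<alpha> - \<alpha>0\<bar> \<le> \<bar>(u - \<beta>) \<bullet> (q i - q0 i)\<bar> + \<bar>(\<beta> - \<beta>0) \<bullet> q0 i\<bar>" by linarith
    also have "\<bar>(u - \<beta>) \<bullet> (q i - q0 i)\<bar> \<le> norm (u - \<beta>) * norm (q i - q0 i)" by (rule Cauchy_Schwarz_ineq2)
    also have "\<dots> \<le> (1 + norm \<beta>) * \<epsilon>"
      using close[of i] norm_triangle_ineq4[of u \<beta>] u by (intro mult_mono) auto
    also have "\<bar>(\<beta> - \<beta>0) \<bullet> q0 i\<bar> \<le> norm (\<beta> - \<beta>0) * norm (q0 i)" by (rule Cauchy_Schwarz_ineq2)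
    finally show ?thesis by simp
  qed
  then show thesis using that u\<beta> on' b by blast
qed

lemma abs_mult_le:
  fixes x y :: real
  assumes "\<bar>x\<bar> \<le> s" "\<bar>y\<bar> \<le> t"
  shows "\<bar>x * y\<bar> \<le> s * t"
  unfolding abs_mult using assms by (intro mult_mono) auto

section \<open>A flat pyramid in rescaled cap coordinates\<close>

definition cap_map :: "'a::real_inner \<Rightarrow> real \<Rightarrow> 'a \<Rightarrow> 'a" where
  "cap_map u r v = u + (r *\<^sub>R v + ((r\<^sup>2 - r) * (u \<bullet> v)) *\<^sub>R u)"

lemma inner_cap_map:
  assumes "norm u = 1" "u \<bullet> \<beta> = 0"
  shows "(u - r *\<^sub>R \<beta>) \<bullet> cap_map u r v = 1 + r\<^sup>2 * ((u - \<beta>) \<bullet> v)"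
proof -
  have uu: "u \<bullet> u = 1" and bu: "\<beta> \<bullet> u = 0" using assms by (simp_all add: norm_eq_1 inner_commute)
  show ?thesis
    by (simp add: cap_map_def inner_diff_left inner_add_right uu bu) (simp add: power2_eq_square algebra_simps)
qed

text \<open>The axial coordinate \<open>u \<bullet> v\<close> is scaled by \<open>r\<^sup>2\<close> and the tangential ones by \<open>r\<close>, so near \<open>u\<close>
  the unit ball looks like the paraboloid \<open>2 (u \<bullet> v) + norm (tangential part)\<^sup>2 \<le> 0\<close>, uniformly
  in \<open>r\<close>. The affine functional \<open>v \<mapsto> (u - \<beta>) \<bullet> v - \<alpha>\<close> becomes, up to the factor \<open>r\<^sup>2\<close>,
  the functional \<open>x \<mapsto> (u - r \<beta>) \<bullet> x - (1 + r\<^sup>2 \<alpha>)\<close>.\<close>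

locale cap_config =
  fixes u :: "real^'d" and v :: "'d \<Rightarrow> real^'d" and \<tau> \<delta> r :: real
    and \<beta> :: "'d \<Rightarrow> real^'d" and \<alpha> :: "'d \<Rightarrow> real" and \<beta>0 :: "real^'d" and \<alpha>0 :: real
    and a :: "'d \<Rightarrow> real^'d" and b :: "real^'d" and P :: "(real^'d) set"
  assumes dim: "2 \<le> CARD('d)" and fr: "simplex_frame u v"
    and \<tau>: "0 < \<tau>" "4 * (real CARD('d))\<^sup>2 * \<tau> \<le> 1" and \<delta>: "0 < \<delta>" "\<delta> \<le> \<tau>\<^sup>2 / 100" and r: "0 < r" "r\<^sup>2 \<le> \<delta>"
    and u\<beta>: "\<And>j. u \<bullet> \<beta> j = 0" and u\<beta>0: "u \<bullet> \<beta>0 = 0"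
    and \<beta>: "\<And>j. norm (\<beta> j - (\<tau> * real CARD('d)) *\<^sub>R v j) \<le> \<delta>" and \<alpha>: "\<And>j. \<bar>\<alpha> j - (\<tau> - 1)\<bar> \<le> \<delta>"
    and \<beta>0: "norm \<beta>0 \<le> \<delta>" and \<alpha>0: "\<bar>\<alpha>0 + 1\<bar> \<le> \<delta>"
    and a: "\<And>j. norm (a j - (v j - u)) \<le> \<delta>" and b: "norm (b - (\<tau> - 1) *\<^sub>R u) \<le> \<delta>"
    and on_a: "\<And>i j. i \<noteq> j \<Longrightarrow> (u - \<beta> j) \<bullet> a i = \<alpha> j" and on_b: "\<And>j. (u - \<beta> j) \<bullet> b = \<alpha> j"
    and on_0: "\<And>i. (u - \<beta>0) \<bullet> a i = \<alpha>0"
    and P: "finite P" "0 \<in> P" "P \<subseteq> cball 0 1" "range (\<lambda>j. cap_map u r (a j)) \<subseteq> P"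
    and empty: "\<And>p. p \<in> P \<Longrightarrow> 1 - 2 * r\<^sup>2 \<le> u \<bullet> p \<Longrightarrow> p \<in> range (\<lambda>j. cap_map u r (a j))"
begin

abbreviation "e \<equiv> r\<^sup>2"

lemma n2: "2 \<le> (real CARD('d))" using dim by simp

lemma u1: "norm u = 1" and uu: "u \<bullet> u = 1" and uv: "u \<bullet> v i = 0"
  and vv: "v i \<bullet> v j = (if i = j then 1 else 0) - 1 / (real CARD('d))"
  using fr by (simp_all add: simplex_frame_def norm_eq_1)

lemma perp_u: "v i \<bullet> u = 0" "\<beta> j \<bullet> u = 0" "\<beta>0 \<bullet> u = 0"
  using uv[of i] u\<beta>[of j] u\<beta>0 by (simp_all add: inner_commute)

lemma v1: "norm (v i) \<le> 1"
proof -
  have "(norm (v i))\<^sup>2 \<le> 1\<^sup>2" unfolding power2_norm_eq_inner vv by simp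
  then show ?thesis by (rule power2_le_imp_le) simp
qed

lemma e_pos: "0 < e" using r by simp

lemma tau_n: "\<tau> * (real CARD('d)) \<le> 1 / 8"
proof -
  have "(4 * (real CARD('d)) * \<tau>) * 2 \<le> (4 * (real CARD('d)) * \<tau>) * (real CARD('d))" using n2 \<tau>(1) by (intro mult_left_mono) auto
  also have "\<dots> \<le> 1" using \<tau>(2) by (simp add: power2_eq_square mult_ac)
  finally show ?thesis by (simp add: mult_ac)
qed

lemma tau_small: "\<tau> \<le> 1 / 16"
proof -
  have "\<tau> * 2 \<le> \<tau> * real CARD('d)" using n2 \<tau>(1) by (intro mult_left_mono) auto
  then show ?thesis using tau_n by linarith
qed

lemma tau2_n2: "\<tau>\<^sup>2 * (real CARD('d))\<^sup>2 \<le> \<tau> / 4"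
proof -
  have "\<tau> * (4 * (real CARD('d))\<^sup>2 * \<tau>) \<le> \<tau> * 1" using \<tau> by (intro mult_left_mono) auto
  then show ?thesis by (simp add: power2_eq_square mult_ac)
qed

lemma delta_small: "\<delta> \<le> \<tau> / 1600" "\<delta> \<le> 1 / 10000"
proof -
  have "\<tau>\<^sup>2 \<le> \<tau> * (1 / 16)" unfolding power2_eq_square using tau_small \<tau>(1) by (intro mult_left_mono) auto
  then show "\<delta> \<le> \<tau> / 1600" using \<delta> by simp
  then show "\<delta> \<le> 1 / 10000" using tau_small by simp
qed

lemma e_small: "e \<le> \<delta>" "e \<le> 1 / 10000" using r delta_small by auto

lemma beta_norm: "norm (\<beta> j) \<le> 1 / 4"
proof -
  have "norm (\<beta> j) \<le> norm ((\<tau> * (real CARD('d))) *\<^sub>R v j) + norm (\<beta> j - (\<tau> * (real CARD('d))) *\<^sub>R v j)" by (rule norm_triangle_sub)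
  also have "norm ((\<tau> * (real CARD('d))) *\<^sub>R v j) \<le> (\<tau> * (real CARD('d))) * 1" using v1[of j] \<tau>(1) by (simp add: mult_left_mono)
  finally show ?thesis using \<beta>[of j] tau_n delta_small by linarith
qed

lemma beta0_norm: "norm \<beta>0 \<le> 1 / 4" using \<beta>0 delta_small by linarith

lemma alpha_bounds: "\<bar>\<alpha> j\<bar> \<le> 3 / 2" "\<bar>\<alpha>0\<bar> \<le> 3 / 2" "- (3 / 2) \<le> \<alpha> j" "- (3 / 2) \<le> \<alpha>0"
  using \<alpha>[of j] \<alpha>0 delta_small tau_small \<tau>(1) by linarith+

lemma inner_beta_approx: "\<bar>\<beta> i \<bullet> \<beta> j - \<tau>\<^sup>2 * (real CARD('d))\<^sup>2 * (v i \<bullet> v j)\<bar> \<le> \<delta>"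
proof -
  define \<eta> where "\<eta> j = \<beta> j - (\<tau> * (real CARD('d))) *\<^sub>R v j" for j
  have \<eta>: "norm (\<eta> j) \<le> \<delta>" for j using \<beta> by (simp add: \<eta>_def)
  have eq: "\<beta> i \<bullet> \<beta> j = \<tau>\<^sup>2 * (real CARD('d))\<^sup>2 * (v i \<bullet> v j) + ((\<tau> * (real CARD('d))) * (v i \<bullet> \<eta> j) + (\<tau> * (real CARD('d))) * (\<eta> i \<bullet> v j)) + \<eta> i \<bullet> \<eta> j"
    by (simp add: \<eta>_def inner_diff_left inner_diff_right power2_eq_square algebra_simps)
  have 1: "\<bar>v i \<bullet> \<eta> j\<bar> \<le> \<delta>"
    using Cauchy_Schwarz_ineq2[of "v i" "\<eta> j"] mult_mono[OF v1[of i] \<eta>[of j]] by simp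
  have 2: "\<bar>\<eta> i \<bullet> v j\<bar> \<le> \<delta>"
    using Cauchy_Schwarz_ineq2[of "\<eta> i" "v j"] mult_mono[OF \<eta>[of i] v1[of j]] \<delta>(1) by simp
  have 3: "\<bar>\<eta> i \<bullet> \<eta> j\<bar> \<le> \<delta> * (1 / 2)"
    using Cauchy_Schwarz_ineq2[of "\<eta> i" "\<eta> j"] mult_mono[OF \<eta>[of i] order_trans[OF \<eta>[of j], of "1/2"]] \<delta>(1) delta_small by simp
  have t: "0 \<le> \<tau> * (real CARD('d))" using \<tau>(1) by simp
  have 4: "\<bar>(\<tau> * (real CARD('d))) * (v i \<bullet> \<eta> j)\<bar> \<le> 1 / 8 * \<delta>" "\<bar>(\<tau> * (real CARD('d))) * (\<eta> i \<bullet> v j)\<bar> \<le> 1 / 8 * \<delta>"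
    unfolding abs_mult abs_of_nonneg[OF t, unfolded abs_mult] using t tau_n 1 2 by (intro mult_mono; simp)+
  show ?thesis unfolding eq using 3 4 \<delta>(1) by linarith
qed

lemma inner_beta_ne: "i \<noteq> j \<Longrightarrow> \<beta> i \<bullet> \<beta> j \<le> - \<tau>\<^sup>2 * (real CARD('d)) + \<delta>"
proof -
  assume "i \<noteq> j"
  then have "\<tau>\<^sup>2 * (real CARD('d))\<^sup>2 * (v i \<bullet> v j) = - \<tau>\<^sup>2 * (real CARD('d))" using n2 by (simp add: vv power2_eq_square)
  then show ?thesis using inner_beta_approx[of i j] by linarith
qed

text \<open>The squared slope of the lateral facets, which produces the area part of the
  gain.\<close>

lemma inner_beta_eq: "\<bar>\<beta> j \<bullet> \<beta> j - \<tau>\<^sup>2 * (real CARD('d)) * ((real CARD('d)) - 1)\<bar> \<le> \<delta>"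
proof -
  have "\<tau>\<^sup>2 * (real CARD('d))\<^sup>2 * (v j \<bullet> v j) = \<tau>\<^sup>2 * (real CARD('d)) * ((real CARD('d)) - 1)" using n2 by (simp add: vv power2_eq_square field_simps)
  then show ?thesis using inner_beta_approx[of j j] by linarith
qed

lemma inner_beta_bound: "\<bar>\<beta> i \<bullet> \<beta> j\<bar> \<le> 1 / 16"
  using Cauchy_Schwarz_ineq2[of "\<beta> i" "\<beta> j"] mult_mono[OF beta_norm[of i] beta_norm[of j]] by simp

lemma inner_beta0: "\<bar>\<beta> j \<bullet> \<beta>0\<bar> \<le> \<delta>" "0 \<le> \<beta>0 \<bullet> \<beta>0" "\<beta>0 \<bullet> \<beta>0 \<le> \<delta>"
proof -
  show "\<bar>\<beta> j \<bullet> \<beta>0\<bar> \<le> \<delta>"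
    using Cauchy_Schwarz_ineq2[of "\<beta> j" "\<beta>0"] mult_mono[OF beta_norm[of j] \<beta>0] \<delta> by simp
  show "\<beta>0 \<bullet> \<beta>0 \<le> \<delta>"
    using norm_cauchy_schwarz[of \<beta>0 \<beta>0] mult_mono[OF beta0_norm \<beta>0] \<delta> by simp
qed simp

definition "c j = u - r *\<^sub>R \<beta> j"
definition "k j = 1 + e * \<alpha> j"
definition "c0 = u - r *\<^sub>R \<beta>0"
definition "k0 = 1 + e * \<alpha>0"
definition "x j = cap_map u r (a j)"
definition "w = cap_map u r b"

lemma cmap: "c j \<bullet> cap_map u r z - k j = e * ((u - \<beta> j) \<bullet> z - \<alpha> j)"
  unfolding c_def k_def inner_cap_map[OF u1 u\<beta>] by (simp add: algebra_simps)

lemma cmap0: "c0 \<bullet> cap_map u r z - k0 = e * ((u - \<beta>0) \<bullet> z - \<alpha>0)"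
  unfolding c0_def k0_def inner_cap_map[OF u1 u\<beta>0] by (simp add: algebra_simps)

lemma lin_error: "u \<bullet> f = 0 \<Longrightarrow> norm f \<le> 1 / 4 \<Longrightarrow> norm (y - y0) \<le> \<delta> \<Longrightarrow>
   \<bar>(u - f) \<bullet> y - (u - f) \<bullet> y0\<bar> \<le> 2 * \<delta>"
proof -
  assume f: "u \<bullet> f = 0" "norm f \<le> 1 / 4" and y: "norm (y - y0) \<le> \<delta>"
  have "\<bar>(u - f) \<bullet> (y - y0)\<bar> \<le> norm (u - f) * norm (y - y0)" by (rule Cauchy_Schwarz_ineq2)
  also have "\<dots> \<le> 2 * \<delta>" using norm_triangle_ineq4[of u f] f u1 y by (intro mult_mono) auto
  finally show ?thesis by (simp only: inner_diff_right)
qed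

text \<open>In the ideal configuration the value is \<open>- \<tau> * real CARD('d)\<close>; the
  errors are a few multiples of \<open>\<delta> \<le> \<tau> / 1600\<close>.\<close>

lemma level_xj: "(u - \<beta> j) \<bullet> a j - \<alpha> j < 0"
proof -
  have "(u - \<beta> j) \<bullet> (v j - u) = - 1 - \<beta> j \<bullet> v j"
    by (simp add: inner_diff_left inner_diff_right uv uu perp_u u\<beta>)
  moreover have "\<bar>(\<beta> j - (\<tau> * (real CARD('d))) *\<^sub>R v j) \<bullet> v j\<bar> \<le> \<delta>"
    using Cauchy_Schwarz_ineq2[of "\<beta> j - (\<tau> * (real CARD('d))) *\<^sub>R v j" "v j"] mult_mono[OF \<beta>[of j] v1[of j]] \<delta>(1) by simp
  then have "\<bar>\<beta> j \<bullet> v j - (\<tau> * (real CARD('d))) * (v j \<bullet> v j)\<bar> \<le> \<delta>" by (simp add: inner_diff_left)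
  moreover have "(\<tau> * (real CARD('d))) * (v j \<bullet> v j) = \<tau> * (real CARD('d)) - \<tau>" using n2 by (simp add: vv field_simps)
  moreover have "\<tau> * 2 \<le> \<tau> * (real CARD('d))" using n2 \<tau>(1) by (intro mult_left_mono) auto
  ultimately show ?thesis
    using lin_error[OF u\<beta> beta_norm a, of j j] \<alpha>[of j] delta_small \<tau>(1) by linarith
qed

text \<open>The ideal value is \<open>\<tau>\<close>, the height of the pyramid.\<close>

lemma level_w: "(u - \<beta>0) \<bullet> b - \<alpha>0 > 0"
proof -
  have "(u - \<beta>0) \<bullet> ((\<tau> - 1) *\<^sub>R u) = \<tau> - 1"
    by (simp add: inner_diff_left inner_diff_right uu perp_u u\<beta>0)
  then show ?thesis
    using lin_error[OF u\<beta>0 beta0_norm b] \<alpha>0 delta_small \<tau>(1) by linarith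
qed

text \<open>This is why the cap has height \<open>2 * e\<close>. At depth \<open>s > 2 * e\<close>
  below the tangent hyperplane the squared tangential part is at most \<open>2 * s\<close>, so a
  slope of norm \<open>1 / 4\<close> gains at most \<open>s / 4\<close>, and
  \<open>1 - (3 / 4) * s\<close> is below the least admissible level
  \<open>1 - (3 / 2) * e\<close>.\<close>

lemma far_below:
  assumes p: "norm p \<le> 1" "u \<bullet> p < 1 - 2 * e" and f: "u \<bullet> f = 0" "norm f \<le> 1 / 4" and \<gamma>: "- (3 / 2) \<le> \<gamma>"
  shows "(u - r *\<^sub>R f) \<bullet> p < 1 + e * \<gamma>"
proof -
  define s where "s = 1 - u \<bullet> p"
  have s: "2 * e < s" using p by (simp add: s_def)
  have s0: "0 < s" using s e_pos by linarith
  define y where "y = p - (u \<bullet> p) *\<^sub>R u"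
  have "norm y ^ 2 = p \<bullet> p - (u \<bullet> p)\<^sup>2"
    unfolding power2_norm_eq_inner by (simp add: y_def inner_diff_left inner_diff_right uu inner_commute[of p u] power2_eq_square)
  also have "p \<bullet> p \<le> 1" using p(1) power_mono[of "norm p" 1 2] by (simp add: power2_norm_eq_inner)
  also have "1 - (u \<bullet> p)\<^sup>2 = s * (2 - s)" by (simp add: s_def power2_eq_square algebra_simps)
  also have "\<dots> \<le> s * 2" using s0 by (intro mult_left_mono) auto
  finally have y2: "norm y ^ 2 \<le> 2 * s" by simp
  have "(r * norm y)\<^sup>2 \<le> e * (2 * s)" unfolding power_mult_distrib using y2 by (intro mult_left_mono) auto
  also have "\<dots> \<le> s * s" using mult_right_mono[of "2 * e" s s] s s0 by simp
  also have "\<dots> = s\<^sup>2" by (rule power2_eq_square[symmetric])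
  finally have "(r * norm y)\<^sup>2 \<le> s\<^sup>2" .
  then have ry: "r * norm y \<le> s" by (rule power2_le_imp_le) (use s0 in simp)
  have fy: "f \<bullet> p = f \<bullet> y" by (simp add: y_def inner_diff_right inner_commute[of f u] f(1))
  have "\<bar>f \<bullet> y\<bar> \<le> (1 / 4) * norm y"
    using Cauchy_Schwarz_ineq2[of f y] mult_right_mono[OF f(2) norm_ge_zero[of y]] by linarith
  then have "r * \<bar>f \<bullet> y\<bar> \<le> r * ((1 / 4) * norm y)" using r by (intro mult_left_mono) auto
  also have "\<dots> = (1 / 4) * (r * norm y)" by simp
  also have "\<dots> \<le> (1 / 4) * s" using ry by simp
  finally have rf: "\<bar>r * (f \<bullet> y)\<bar> \<le> (1 / 4) * s" using r by (simp only: abs_mult abs_of_pos)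
  then have "(u - r *\<^sub>R f) \<bullet> p \<le> 1 - s + (1 / 4) * s" using rf by (simp add: inner_diff_left fy s_def)
  moreover have "- (3 / 2) * e \<le> \<gamma> * e" using \<gamma> e_pos by (intro mult_right_mono) auto
  ultimately show ?thesis using s by (simp add: mult.commute)
qed

lemma far_point: "p \<in> P - range x \<Longrightarrow> norm p \<le> 1 \<and> u \<bullet> p < 1 - 2 * e"
  using P(3) empty[of p] by (force simp: x_def[abs_def])

sublocale facet_swap P x w c k c0 k0
proof
  show "finite P" by (rule P)
  show "range x \<subseteq> P" using P(4) by (simp add: x_def[abs_def])
  show "i \<noteq> j \<Longrightarrow> c j \<bullet> x i = k j" for i j using cmap[of j "a i"] on_a[of i j] by (simp add: x_def)
  show "c j \<bullet> w = k j" for j using cmap[of j b] on_b[of j] by (simp add: w_def)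
  show "c j \<bullet> x j < k j" for j
  proof -
    have "e * ((u - \<beta> j) \<bullet> a j - \<alpha> j) < 0" using level_xj[of j] e_pos by (simp add: mult_pos_neg)
    then show ?thesis using cmap[of j "a j"] by (simp add: x_def)
  qed
  show "p \<in> P - range x \<Longrightarrow> c j \<bullet> p < k j" for j p
    using far_below[OF _ _ u\<beta>[of j] beta_norm, of p "\<alpha> j"] far_point[of p] alpha_bounds(3)[of j] by (simp add: c_def k_def)
  show "c0 \<bullet> x i = k0" for i using cmap0[of "a i"] on_0[of i] by (simp add: x_def)
  show "k0 < c0 \<bullet> w"
  proof -
    have "0 < e * ((u - \<beta>0) \<bullet> b - \<alpha>0)" using level_w e_pos by simp
    then show ?thesis using cmap0[of b] by (simp add: w_def)
  qed
  show "p \<in> P - range x \<Longrightarrow> c0 \<bullet> p < k0" for p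
    using far_below[OF _ _ u\<beta>0 beta0_norm, of p "\<alpha>0"] far_point[of p] alpha_bounds(4) by (simp add: c0_def k0_def)
  have "0 \<noteq> x j" for j
  proof
    assume "0 = x j"
    then have z: "0 = (u - r *\<^sub>R \<beta>0) \<bullet> cap_map u r (a j)" by (simp add: x_def)
    have "1 + e * \<alpha>0 = 0" using z unfolding inner_cap_map[OF u1 u\<beta>0] on_0 by simp
    moreover have "\<bar>e * \<alpha>0\<bar> \<le> (1 / 10000) * (3 / 2)"
      unfolding abs_mult using e_small(2) alpha_bounds(2) by (intro mult_mono) auto
    ultimately show False by linarith
  qed
  then show "P - range x \<noteq> {}" using P(2) by blast
qed

lemma cu: "c j \<bullet> u = 1" and c0u: "c0 \<bullet> u = 1"
  by (simp_all add: c_def c0_def inner_diff_left inner_diff_right uu perp_u u\<beta> u\<beta>0)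

lemma inner_c: "c i \<bullet> c j = 1 + e * (\<beta> i \<bullet> \<beta> j)" "c i \<bullet> c0 = 1 + e * (\<beta> i \<bullet> \<beta>0)"
  "c0 \<bullet> c j = 1 + e * (\<beta> j \<bullet> \<beta>0)" "c0 \<bullet> c0 = 1 + e * (\<beta>0 \<bullet> \<beta>0)"
proof -
  show 1: "c i \<bullet> c0 = 1 + e * (\<beta> i \<bullet> \<beta>0)" for i
    by (simp add: c_def c0_def inner_diff_left inner_diff_right uu u\<beta>0 perp_u power2_eq_square)
  show "c0 \<bullet> c j = 1 + e * (\<beta> j \<bullet> \<beta>0)" using 1[of j] by (simp only: inner_commute[of c0])
qed (simp_all add: c_def c0_def inner_diff_left inner_diff_right uu u\<beta> u\<beta>0 perp_u power2_eq_square)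

text \<open>After clearing the denominator and dividing by \<open>e\<close>, the products of heights
  and slopes carry a factor \<open>e \<le> \<delta>\<close>; the summand \<open>\<delta>\<close> in
  the last hypothesis pays for them.\<close>

lemma foot_ineq:
  assumes A: "\<bar>\<alpha>1\<bar> \<le> 3 / 2" "\<bar>\<alpha>2\<bar> \<le> 3 / 2" and s: "\<bar>s\<bar> \<le> 1 / 16" and q: "0 \<le> q" "q \<le> 1 / 16"
    and le: "\<alpha>1 - \<alpha>2 + s - q + \<delta> \<le> 0"
  shows "((1 + e * \<alpha>1) / (1 + e * q)) * (1 + e * s) \<le> 1 + e * \<alpha>2"
proof -
  have "\<bar>\<alpha>1 * s\<bar> \<le> 3 / 2 * (1 / 16)" "\<bar>\<alpha>2 * q\<bar> \<le> 3 / 2 * (1 / 16)"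
    using A s q by (intro abs_mult_le; simp)+
  then have "\<alpha>1 * s - \<alpha>2 * q \<le> 1" by linarith
  then have "e * (\<alpha>1 * s - \<alpha>2 * q) \<le> e * 1" using e_pos by (intro mult_left_mono) auto
  then have "\<alpha>1 - \<alpha>2 + s - q + e * (\<alpha>1 * s - \<alpha>2 * q) \<le> 0" using le e_small(1) by linarith
  then have "e * (\<alpha>1 - \<alpha>2 + s - q + e * (\<alpha>1 * s - \<alpha>2 * q)) \<le> 0"
    using e_pos by (simp add: mult_nonneg_nonpos)
  then have "(1 + e * \<alpha>1) * (1 + e * s) \<le> (1 + e * \<alpha>2) * (1 + e * q)" by (simp add: algebra_simps)
  moreover have "0 < 1 + e * q" using e_pos q by (simp add: add_pos_nonneg)
  ultimately show ?thesis by (simp add: pos_divide_le_eq)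
qed

lemma foot_ineq_rev:
  assumes A: "\<bar>\<alpha>1\<bar> \<le> 3 / 2" "\<bar>\<alpha>2\<bar> \<le> 3 / 2" and s: "\<bar>s\<bar> \<le> 1 / 16" and q: "0 \<le> q" "q \<le> 1 / 16"
    and le: "\<alpha>2 - \<alpha>1 + q - s + \<delta> \<le> 0"
  shows "1 + e * \<alpha>2 \<le> ((1 + e * \<alpha>1) / (1 + e * q)) * (1 + e * s)"
proof -
  have "\<bar>\<alpha>1 * s\<bar> \<le> 3 / 2 * (1 / 16)" "\<bar>\<alpha>2 * q\<bar> \<le> 3 / 2 * (1 / 16)"
    using A s q by (intro abs_mult_le; simp)+
  then have "\<alpha>2 * q - \<alpha>1 * s \<le> 1" by linarith
  then have "e * (\<alpha>2 * q - \<alpha>1 * s) \<le> e * 1" using e_pos by (intro mult_left_mono) auto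
  then have "\<alpha>2 - \<alpha>1 + q - s + e * (\<alpha>2 * q - \<alpha>1 * s) \<le> 0" using le e_small(1) by linarith
  then have "e * (\<alpha>2 - \<alpha>1 + q - s + e * (\<alpha>2 * q - \<alpha>1 * s)) \<le> 0"
    using e_pos by (simp add: mult_nonneg_nonpos)
  then have "(1 + e * \<alpha>2) * (1 + e * q) \<le> (1 + e * \<alpha>1) * (1 + e * s)" by (simp add: algebra_simps)
  moreover have "0 < 1 + e * q" using e_pos q by (simp add: add_pos_nonneg)
  ultimately show ?thesis by (simp add: pos_le_divide_eq)
qed

lemma q_bound: "0 \<le> \<beta> j \<bullet> \<beta> j" "\<beta> j \<bullet> \<beta> j \<le> 1 / 16" "\<beta> j \<bullet> \<beta> j \<le> \<tau> / 4 + \<delta>"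
proof -
  have "\<tau>\<^sup>2 * (real CARD('d)) * ((real CARD('d)) - 1) \<le> \<tau>\<^sup>2 * (real CARD('d)) * (real CARD('d))" using n2 by (intro mult_left_mono) auto
  also have "\<dots> = \<tau>\<^sup>2 * (real CARD('d))\<^sup>2" by (simp add: power2_eq_square)
  finally have "\<tau>\<^sup>2 * (real CARD('d)) * ((real CARD('d)) - 1) \<le> \<tau> / 4" using tau2_n2 by linarith
  then show "\<beta> j \<bullet> \<beta> j \<le> \<tau> / 4 + \<delta>" using inner_beta_eq[of j] by linarith
qed (use inner_beta_bound[of j j] in auto)

lemma k_pos: "0 < k j" "0 < k0"
proof -
  have "\<bar>e * \<alpha> j\<bar> \<le> (1 / 10000) * (3 / 2)" "\<bar>e * \<alpha>0\<bar> \<le> (1 / 10000) * (3 / 2)"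
    using e_small(2) alpha_bounds(1)[of j] alpha_bounds(2) by (intro abs_mult_le; simp)+
  then show "0 < k j" "0 < k0" by (auto simp: k_def k0_def)
qed

text \<open>What has to be checked is that the perpendiculars from the origin meet the base and all
  lateral facets; the bounds on \<open>\<tau>\<close> and \<open>\<delta>\<close> are tailored to
  this.\<close>

lemma surface_gain:
  "Lp_surface_area p (convex hull (insert w P)) - Lp_surface_area p (convex hull P)
    = measure lebesgue (prism u F0) * (\<Sum>j\<in>UNIV. bw j *
        (density_model p e (\<beta> j \<bullet> \<beta> j) (\<alpha> j) - density_model p e (\<beta>0 \<bullet> \<beta>0) \<alpha>0))"
proof -
  have t: "\<tau>\<^sup>2 * 2 \<le> \<tau>\<^sup>2 * (real CARD('d))" using n2 by (intro mult_left_mono) auto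
  have t2: "0 < \<tau>\<^sup>2" using \<tau>(1) by simp
  have f0: "(k0 / (c0 \<bullet> c0)) * (c i \<bullet> c0) \<le> k i" for i
    unfolding inner_c k_def k0_def
  proof (rule foot_ineq)
    show "\<bar>\<alpha>0\<bar> \<le> 3 / 2" "\<bar>\<alpha> i\<bar> \<le> 3 / 2" by (rule alpha_bounds)+
    show "\<bar>\<beta> i \<bullet> \<beta>0\<bar> \<le> 1 / 16" "0 \<le> \<beta>0 \<bullet> \<beta>0" "\<beta>0 \<bullet> \<beta>0 \<le> 1 / 16"
      using inner_beta0(1)[of i] inner_beta0(2,3) delta_small by linarith+
    show "\<alpha>0 - \<alpha> i + \<beta> i \<bullet> \<beta>0 - \<beta>0 \<bullet> \<beta>0 + \<delta> \<le> 0"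
      using inner_beta0(1)[of i] inner_beta0(2,3) \<alpha>[of i] \<alpha>0 delta_small \<tau>(1) by linarith
  qed
  have fj: "(k j / (c j \<bullet> c j)) * (c i \<bullet> c j) \<le> k i" if "i \<noteq> j" for i j
    unfolding inner_c k_def
  proof (rule foot_ineq)
    show "\<bar>\<alpha> j\<bar> \<le> 3 / 2" "\<bar>\<alpha> i\<bar> \<le> 3 / 2" by (rule alpha_bounds)+
    \<comment> \<open>The heights of two lateral hyperplanes differ only by errors, so the slack
      comes from the negative inner product of their slopes. This requires \<open>\<delta>\<close>
      to be small against the square of \<open>\<tau>\<close>.\<close>
    show "\<alpha> j - \<alpha> i + \<beta> i \<bullet> \<beta> j - \<beta> j \<bullet> \<beta> j + \<delta> \<le> 0"
      using inner_beta_ne[OF that] q_bound(1)[of j] \<alpha>[of i] \<alpha>[of j] t t2 \<delta> by linarith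
  qed (use inner_beta_bound q_bound in auto)
  have fj0: "k0 \<le> (k j / (c j \<bullet> c j)) * (c0 \<bullet> c j)" for j
    unfolding inner_c k_def k0_def
  proof (rule foot_ineq_rev)
    show "\<bar>\<alpha> j\<bar> \<le> 3 / 2" "\<bar>\<alpha>0\<bar> \<le> 3 / 2" by (rule alpha_bounds)+
    show "\<bar>\<beta> j \<bullet> \<beta>0\<bar> \<le> 1 / 16" using inner_beta0(1)[of j] inner_beta0(2,3) delta_small by linarith
    \<comment> \<open>The height difference is about \<open>\<tau>\<close> and must beat the squared
      slope; the condition \<open>4 * (real CARD('d))\<^sup>2 * \<tau> \<le> 1\<close> keeps the
      latter near or below \<open>\<tau> / 4\<close>.\<close>
    show "\<alpha>0 - \<alpha> j + \<beta> j \<bullet> \<beta> j - \<beta> j \<bullet> \<beta>0 + \<delta> \<le> 0"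
      using inner_beta0(1)[of j] inner_beta0(2,3) q_bound(3)[of j] \<alpha>[of j] \<alpha>0 delta_small \<tau>(1) by linarith
  qed (use q_bound in auto)
  have dens: "facet_density p (c j) (k j) = density_model p e (\<beta> j \<bullet> \<beta> j) (\<alpha> j)" for j
    unfolding k_def using k_pos(1)[of j] e_pos q_bound(1)[of j]
    by (intro facet_density_eq_model) (auto simp: norm_eq_sqrt_inner inner_c k_def add_pos_nonneg)
  have dens0: "facet_density p c0 k0 = density_model p e (\<beta>0 \<bullet> \<beta>0) \<alpha>0"
    unfolding k0_def using k_pos(2) e_pos inner_beta0(2)
    by (intro facet_density_eq_model) (auto simp: norm_eq_sqrt_inner inner_c k0_def add_pos_nonneg)
  show ?thesis
    unfolding dens[symmetric] dens0[symmetric]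
    by (rule Lp_surface_area_insert[OF cu c0u k_pos(2) f0 k_pos(1) fj fj0])
qed

end

section \<open>Size of the change of the surface area\<close>

text \<open>The map is a homothety by \<open>r\<close> followed by a rank-one stretch by
  \<open>s / r\<close> along \<open>u\<close> and a translation.\<close>

lemma measure_stretch_ball:
  fixes u :: "real^'d"
  assumes u: "norm u = 1" and r: "0 < r" and s: "0 < s" and \<rho>: "0 \<le> \<rho>"
  shows "measure lebesgue ((\<lambda>y. e + (r *\<^sub>R y + ((s - r) * (u \<bullet> y)) *\<^sub>R u)) ` ball c \<rho>)
      = s * r ^ (CARD('d) - 1) * (\<rho> ^ CARD('d) * measure lborel (ball 0 1 :: (real^'d) set))"
proof -
  have uu: "u \<bullet> u = 1" using u by (simp add: norm_eq_1)
  have sc: "(\<lambda>y. r *\<^sub>R y) ` ball c \<rho> = ball (r *\<^sub>R c) (r * \<rho>)"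
  proof (intro equalityI subsetI)
    fix y assume "y \<in> (\<lambda>y. r *\<^sub>R y) ` ball c \<rho>"
    then obtain z where "y = r *\<^sub>R z" "z \<in> ball c \<rho>" by (rule imageE)
    then have z: "y = r *\<^sub>R z" "dist c z < \<rho>" by simp_all
    have "dist (r *\<^sub>R c) y = r * dist c z" using r z by (simp add: dist_norm flip: scaleR_diff_right)
    then show "y \<in> ball (r *\<^sub>R c) (r * \<rho>)" using z r by simp
  next
    fix y assume y: "y \<in> ball (r *\<^sub>R c) (r * \<rho>)"
    have "r *\<^sub>R c - y = r *\<^sub>R (c - y /\<^sub>R r)" using r by (simp add: scaleR_diff_right)
    then have "dist (r *\<^sub>R c) y = r * dist c (y /\<^sub>R r)" using r by (simp add: dist_norm)
    then have "dist c (y /\<^sub>R r) < \<rho>" using y r by simp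
    then show "y \<in> (\<lambda>y. r *\<^sub>R y) ` ball c \<rho>" using r by (intro image_eqI[of _ _ "y /\<^sub>R r"]) auto
  qed
  let ?T = "\<lambda>z. z + (u \<bullet> z) *\<^sub>R ((s / r - 1) *\<^sub>R u) + e"
  have "(\<lambda>y. e + (r *\<^sub>R y + ((s - r) * (u \<bullet> y)) *\<^sub>R u)) ` ball c \<rho> = ?T ` (\<lambda>y. r *\<^sub>R y) ` ball c \<rho>"
    unfolding image_image using r by (intro image_cong) (auto simp: algebra_simps)
  also have "measure lebesgue \<dots> = \<bar>1 + u \<bullet> ((s / r - 1) *\<^sub>R u)\<bar> * measure lebesgue (ball (r *\<^sub>R c) (r * \<rho>))"
    unfolding sc by (rule measure_rank_one_image(1)) simp
  also have "\<bar>1 + u \<bullet> ((s / r - 1) *\<^sub>R u)\<bar> = s / r" using r s by (simp add: uu)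
  also have "measure lebesgue (ball (r *\<^sub>R c) (r * \<rho>)) = (r * \<rho>) ^ CARD('d) * measure lborel (ball 0 1 :: (real^'d) set)"
    using content_ball_conv_unit_ball[of "r * \<rho>" "r *\<^sub>R c"] r \<rho> by (simp add: measure_completion)
  also have "s / r * ((r * \<rho>) ^ CARD('d) * measure lborel (ball 0 1 :: (real^'d) set))
    = s * r ^ (CARD('d) - 1) * (\<rho> ^ CARD('d) * measure lborel (ball 0 1 :: (real^'d) set))"
  proof -
    have "r ^ CARD('d) = r * r ^ (CARD('d) - 1)" by (metis Suc_diff_1 power_Suc zero_less_card_finite)
    then show ?thesis using r by (simp add: power_mult_distrib)
  qed
  finally show ?thesis .
qed

lemma abs_diff_triangle4:
  fixes x x' y y' z :: real
  assumes "\<bar>x - y\<bar> \<le> s" "\<bar>x' - y'\<bar> \<le> s'" "\<bar>y - y' - z\<bar> \<le> t"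
  shows "\<bar>(x - x') - z\<bar> \<le> s + s' + t"
  using assms by linarith

context cap_config
begin

text \<open>The prism contains an ellipsoid of tangential size \<open>r\<close> and axial size of
  order 1. Its centre \<open>(3 / 2) *\<^sub>R u\<close> is about half-way up, as \<open>k0\<close>
  is close to 1; the radius \<open>1 / (4 * real CARD('d))\<close> makes the lateral slopes
  contribute at most about \<open>\<tau> / 4\<close>, less than the height
  \<open>\<tau>\<close>.\<close>

lemma prism_volume:
  "measure lebesgue (prism u F0) \<ge> r ^ (CARD('d) - 1) * ((1 / (4 * real CARD('d))) ^ CARD('d) * measure lborel (ball 0 1 :: (real^'d) set))"
proof -
  let ?\<rho> = "1 / (4 * real CARD('d))"
  have \<rho>: "0 < ?\<rho>" "?\<rho> \<le> 1 / 8" using n2 by (auto simp: field_simps)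
  let ?f = "\<lambda>y. (3 / 2) *\<^sub>R u + (r *\<^sub>R y + ((1 - r) * (u \<bullet> y)) *\<^sub>R u)"
  have sub: "?f ` ball 0 ?\<rho> \<subseteq> prism u F0"
  proof (rule image_subsetI)
    fix y :: "real^'d" assume "y \<in> ball 0 ?\<rho>"
    then have y: "norm y \<le> ?\<rho>" by simp
    have y8: "norm y \<le> 1 / 8" using y \<rho>(2) by linarith
    have fu: "(u - r *\<^sub>R f) \<bullet> ?f y = 3 / 2 + u \<bullet> y - e * (f \<bullet> y)" if "f \<bullet> u = 0" for f
      using that by (simp add: inner_diff_left inner_add_right uu) (simp add: power2_eq_square algebra_simps)
    have uy: "\<bar>u \<bullet> y\<bar> \<le> 1 / 8" using Cauchy_Schwarz_ineq2[of u y] u1 y8 by simp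
    have "\<bar>\<beta>0 \<bullet> y\<bar> \<le> \<delta> * 1" using Cauchy_Schwarz_ineq2[of \<beta>0 y] mult_mono[OF \<beta>0, of "norm y" 1] y8 \<delta>(1) by simp
    then have "\<bar>\<beta>0 \<bullet> y + \<alpha>0\<bar> \<le> 2" using alpha_bounds(2) delta_small by linarith
    then have "\<bar>e * (\<beta>0 \<bullet> y + \<alpha>0)\<bar> \<le> (1 / 10000) * 2"
      by (intro abs_mult_le) (use e_small(2) in auto)
    then have b: "\<bar>e * (\<beta>0 \<bullet> y) + e * \<alpha>0\<bar> \<le> (1 / 10000) * 2" by (simp only: distrib_left)
    have L0: "c0 \<bullet> ?f y - k0 = 1 / 2 + u \<bullet> y - (e * (\<beta>0 \<bullet> y) + e * \<alpha>0)"
      unfolding c0_def k0_def fu[OF perp_u(3)] by simp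
    show "?f y \<in> prism u F0"
    proof (rule mem_prism_F0[OF cu c0u])
      show "0 < c0 \<bullet> ?f y - k0" "c0 \<bullet> ?f y - k0 < 1" unfolding L0 using b uy by linarith+
      fix j
      have "\<bar>(\<beta> j - (\<tau> * real CARD('d)) *\<^sub>R v j) \<bullet> y\<bar> \<le> \<delta> * 1"
        using Cauchy_Schwarz_ineq2[of "\<beta> j - (\<tau> * real CARD('d)) *\<^sub>R v j" y] mult_mono[OF \<beta>[of j], of "norm y" 1] y8 \<delta>(1) by simp
      moreover have "\<bar>(\<tau> * real CARD('d)) * (v j \<bullet> y)\<bar> \<le> (\<tau> * real CARD('d)) * ?\<rho>"
      proof (rule abs_mult_le)
        show "\<bar>v j \<bullet> y\<bar> \<le> ?\<rho>"
          using Cauchy_Schwarz_ineq2[of "v j" y] mult_mono[OF v1[of j] y] by simp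
      qed (use \<tau>(1) in simp)
      moreover have "(\<tau> * real CARD('d)) * ?\<rho> = \<tau> / 4" using n2 by (simp add: field_simps)
      ultimately have "- (\<beta> j \<bullet> y) \<le> \<tau> / 4 + \<delta>" by (simp add: inner_diff_left)
      then have "- (\<beta> j \<bullet> y) - \<alpha> j + \<beta>0 \<bullet> y + \<alpha>0 \<le> 0"
        using \<alpha>[of j] \<alpha>0 \<open>\<bar>\<beta>0 \<bullet> y\<bar> \<le> \<delta> * 1\<close> delta_small \<tau>(1) by linarith
      then have "e * (- (\<beta> j \<bullet> y) - \<alpha> j + \<beta>0 \<bullet> y + \<alpha>0) \<le> 0" using e_pos by (simp add: mult_nonneg_nonpos)
      then show "c j \<bullet> ?f y - k j \<le> c0 \<bullet> ?f y - k0"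
        unfolding c_def k_def c0_def k0_def fu[OF perp_u(2)] fu[OF perp_u(3)] by (simp add: algebra_simps)
    qed
  qed
  have m: "?f ` ball 0 ?\<rho> \<in> lmeasurable"
  proof -
    have lin: "linear (\<lambda>y. (r *\<^sub>R y + ((1 - r) * (u \<bullet> y)) *\<^sub>R u))"
      by (rule linearI) (auto simp: inner_add_right algebra_simps)
    have "bounded ((\<lambda>y. (r *\<^sub>R y + ((1 - r) * (u \<bullet> y)) *\<^sub>R u)) ` ball 0 ?\<rho>)"
      by (intro bounded_linear_image bounded_ball) (use lin linear_conv_bounded_linear in blast)
    moreover have "convex ((\<lambda>y. (r *\<^sub>R y + ((1 - r) * (u \<bullet> y)) *\<^sub>R u)) ` ball 0 ?\<rho>)"
      by (intro convex_linear_image lin convex_ball)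
    ultimately have "(+) ((3 / 2) *\<^sub>R u) ` ((\<lambda>y. (r *\<^sub>R y + ((1 - r) * (u \<bullet> y)) *\<^sub>R u)) ` ball 0 ?\<rho>) \<in> lmeasurable"
      by (intro measurable_translation measurable_convex)
    then show ?thesis by (simp add: image_image)
  qed
  have pm: "prism u F0 \<in> lmeasurable"
    by (intro prism_lmeasurable convex_convex_hull compact_imp_bounded finite_imp_compact_convex_hull) simp
  have "measure lebesgue (?f ` ball 0 ?\<rho>) \<le> measure lebesgue (prism u F0)"
    by (rule measure_mono_fmeasurable[OF sub _ pm]) (use m in auto)
  then show ?thesis
    using measure_stretch_ball[OF u1 r(1), of 1 ?\<rho> "(3 / 2) *\<^sub>R u" 0] \<rho>(1) by simp
qed

text \<open>Each of the two expansions costs 20, with the square of \<open>e\<close> bounded by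
  \<open>e * \<delta>\<close>; replacing slopes and heights by their ideal values costs 3.\<close>

lemma density_difference:
  assumes p: "0 \<le> p" "p \<le> 1"
  shows "\<bar>(density_model p e (\<beta> j \<bullet> \<beta> j) (\<alpha> j) - density_model p e (\<beta>0 \<bullet> \<beta>0) \<alpha>0)
     - e * (p * (\<tau>\<^sup>2 * real CARD('d) * (real CARD('d) - 1)) / 2 + (1 - p) * \<tau>)\<bar> \<le> e * (43 * \<delta>)"
proof -
  define Q where "Q = \<tau>\<^sup>2 * real CARD('d) * (real CARD('d) - 1)"
  have A: "\<bar>density_model p e (\<beta> j \<bullet> \<beta> j) (\<alpha> j) - (1 + e * (p * (\<beta> j \<bullet> \<beta> j) / 2 + (1 - p) * \<alpha> j))\<bar> \<le> 20 * e\<^sup>2"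
    using p e_pos e_small(2) q_bound(1,2)[of j] alpha_bounds(1)[of j] by (intro density_model_second_order) auto
  have B: "\<bar>density_model p e (\<beta>0 \<bullet> \<beta>0) \<alpha>0 - (1 + e * (p * (\<beta>0 \<bullet> \<beta>0) / 2 + (1 - p) * \<alpha>0))\<bar> \<le> 20 * e\<^sup>2"
    using p e_pos e_small(2) inner_beta0(2,3) delta_small alpha_bounds(2) by (intro density_model_second_order) auto
  have ee: "e\<^sup>2 \<le> e * \<delta>" unfolding power2_eq_square[of e] using e_small(1) e_pos by (intro mult_left_mono) auto
  have "\<bar>p / 2 * ((\<beta> j \<bullet> \<beta> j - Q) - \<beta>0 \<bullet> \<beta>0)\<bar> \<le> (1 / 2) * (2 * \<delta>)"
  proof (rule abs_mult_le)
    show "\<bar>(\<beta> j \<bullet> \<beta> j - Q) - \<beta>0 \<bullet> \<beta>0\<bar> \<le> 2 * \<delta>"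
      using inner_beta_eq[of j] inner_beta0(2,3) unfolding Q_def by linarith
  qed (use p in simp)
  moreover have "\<bar>(1 - p) * (\<alpha> j - \<alpha>0 - \<tau>)\<bar> \<le> 1 * (2 * \<delta>)"
    by (rule abs_mult_le) (use p \<alpha>[of j] \<alpha>0 in auto)
  ultimately have "\<bar>p / 2 * ((\<beta> j \<bullet> \<beta> j - Q) - \<beta>0 \<bullet> \<beta>0) + (1 - p) * (\<alpha> j - \<alpha>0 - \<tau>)\<bar> \<le> 3 * \<delta>" by linarith
  then have C: "\<bar>e * (p / 2 * ((\<beta> j \<bullet> \<beta> j - Q) - \<beta>0 \<bullet> \<beta>0) + (1 - p) * (\<alpha> j - \<alpha>0 - \<tau>))\<bar> \<le> e * (3 * \<delta>)"
    by (intro abs_mult_le) (use e_pos in auto)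
  have D: "e * (p / 2 * ((\<beta> j \<bullet> \<beta> j - Q) - \<beta>0 \<bullet> \<beta>0) + (1 - p) * (\<alpha> j - \<alpha>0 - \<tau>))
    = (1 + e * (p * (\<beta> j \<bullet> \<beta> j) / 2 + (1 - p) * \<alpha> j)) - (1 + e * (p * (\<beta>0 \<bullet> \<beta>0) / 2 + (1 - p) * \<alpha>0))
      - e * (p * Q / 2 + (1 - p) * \<tau>)"
    by (simp add: algebra_simps)
  have "e * (43 * \<delta>) = e * (3 * \<delta>) + 40 * (e * \<delta>)" by simp
  then show ?thesis unfolding Q_def[symmetric]
    using abs_diff_triangle4[OF A B C[unfolded D]] ee by linarith
qed

text \<open>Since 43 is less than half of 100, the hypothesis on \<open>\<delta>\<close> lets the
  errors consume at most half of the main term, for every lateral facet separately; the weights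
  \<open>bw j\<close> sum to 1.\<close>

lemma gain:
  fixes a1 a2 p1 p2 :: real
  assumes p: "0 \<le> p1" "p1 \<le> 1" "0 \<le> p2" "p2 \<le> 1"
  defines "L \<equiv> a1 * (p1 * (\<tau>\<^sup>2 * real CARD('d) * (real CARD('d) - 1)) / 2 + (1 - p1) * \<tau>)
     + a2 * (p2 * (\<tau>\<^sup>2 * real CARD('d) * (real CARD('d) - 1)) / 2 + (1 - p2) * \<tau>)"
  assumes \<delta>L: "100 * (\<bar>a1\<bar> + \<bar>a2\<bar>) * \<delta> \<le> \<bar>L\<bar>"
  shows "sgn L * ((a1 * Lp_surface_area p1 (convex hull (insert w P)) + a2 * Lp_surface_area p2 (convex hull (insert w P)))
     - (a1 * Lp_surface_area p1 (convex hull P) + a2 * Lp_surface_area p2 (convex hull P)))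
     \<ge> (\<bar>L\<bar> / 2 * ((1 / (4 * real CARD('d))) ^ CARD('d) * measure lborel (ball 0 1 :: (real^'d) set))) * r ^ (CARD('d) + 1)"
proof -
  let ?m = "measure lebesgue (prism u F0)"
  define T where "T p j = density_model p e (\<beta> j \<bullet> \<beta> j) (\<alpha> j) - density_model p e (\<beta>0 \<bullet> \<beta>0) \<alpha>0" for p j
  define l where "l p = p * (\<tau>\<^sup>2 * real CARD('d) * (real CARD('d) - 1)) / 2 + (1 - p) * \<tau>" for p
  have L: "L = a1 * l p1 + a2 * l p2" by (simp add: L_def l_def)
  have each: "sgn L * (a1 * T p1 j + a2 * T p2 j) \<ge> e * (\<bar>L\<bar> / 2)" for j
  proof -
    have 1: "\<bar>a1 * (T p1 j - e * l p1)\<bar> \<le> \<bar>a1\<bar> * (e * (43 * \<delta>))"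
      unfolding T_def l_def by (rule abs_mult_le[OF order_refl density_difference]) (use p in auto)
    have 2: "\<bar>a2 * (T p2 j - e * l p2)\<bar> \<le> \<bar>a2\<bar> * (e * (43 * \<delta>))"
      unfolding T_def l_def by (rule abs_mult_le[OF order_refl density_difference]) (use p in auto)
    have "\<bar>(a1 * T p1 j + a2 * T p2 j) - e * L\<bar> = \<bar>a1 * (T p1 j - e * l p1) + a2 * (T p2 j - e * l p2)\<bar>"
      by (simp add: L algebra_simps)
    also have "\<dots> \<le> \<bar>a1\<bar> * (e * (43 * \<delta>)) + \<bar>a2\<bar> * (e * (43 * \<delta>))" using 1 2 by linarith
    also have "\<dots> = e * (43 / 100 * (100 * (\<bar>a1\<bar> + \<bar>a2\<bar>) * \<delta>))" by (simp add: algebra_simps)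
    also have "\<dots> \<le> e * (\<bar>L\<bar> / 2)" proof (rule mult_left_mono)
      show "43 / 100 * (100 * (\<bar>a1\<bar> + \<bar>a2\<bar>) * \<delta>) \<le> \<bar>L\<bar> / 2" using \<delta>L abs_ge_zero[of L] by linarith
    qed (use e_pos in simp)
    finally have d: "\<bar>(a1 * T p1 j + a2 * T p2 j) - e * L\<bar> \<le> e * (\<bar>L\<bar> / 2)" .
    have s: "\<bar>sgn L\<bar> \<le> 1" by (simp add: sgn_if)
    have "\<bar>sgn L * ((a1 * T p1 j + a2 * T p2 j) - e * L)\<bar> \<le> 1 * (e * (\<bar>L\<bar> / 2))" by (rule abs_mult_le[OF s d])
    moreover have "sgn L * (e * L) = e * \<bar>L\<bar>" by (simp add: sgn_if)
    ultimately have "\<bar>sgn L * (a1 * T p1 j + a2 * T p2 j) - e * \<bar>L\<bar>\<bar> \<le> e * (\<bar>L\<bar> / 2)"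
      by (simp only: right_diff_distrib mult_1)
    moreover have "e * (\<bar>L\<bar> / 2) + e * (\<bar>L\<bar> / 2) = e * \<bar>L\<bar>" by simp
    ultimately show ?thesis by linarith
  qed
  have mr: "r ^ (CARD('d) + 1) = e * r ^ (CARD('d) - 1)"
  proof -
    have "CARD('d) + 1 = 2 + (CARD('d) - 1)" using dim by simp
    then show ?thesis by (simp only: power_add)
  qed
  have "sgn L * ((a1 * Lp_surface_area p1 (convex hull (insert w P)) + a2 * Lp_surface_area p2 (convex hull (insert w P)))
     - (a1 * Lp_surface_area p1 (convex hull P) + a2 * Lp_surface_area p2 (convex hull P)))
    = sgn L * (a1 * (Lp_surface_area p1 (convex hull (insert w P)) - Lp_surface_area p1 (convex hull P))
       + a2 * (Lp_surface_area p2 (convex hull (insert w P)) - Lp_surface_area p2 (convex hull P)))"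
    by (simp add: algebra_simps)
  also have "\<dots> = ?m * (\<Sum>j\<in>UNIV. bw j * (sgn L * (a1 * T p1 j + a2 * T p2 j)))"
    unfolding surface_gain T_def[symmetric]
    by (simp add: sum_distrib_left sum.distrib[symmetric] algebra_simps)
  also have "\<dots> \<ge> ?m * (\<Sum>j\<in>UNIV. bw j * (e * (\<bar>L\<bar> / 2)))"
    using each bw_pos by (intro mult_left_mono sum_mono) (auto intro: less_imp_le)
  also have "?m * (\<Sum>j\<in>UNIV. bw j * (e * (\<bar>L\<bar> / 2))) = (e * (\<bar>L\<bar> / 2)) * ?m"
    unfolding sum_distrib_right[symmetric] sum_bw[OF cu c0u] by simp
  also have "\<dots> \<ge> (e * (\<bar>L\<bar> / 2)) * (r ^ (CARD('d) - 1) * ((1 / (4 * real CARD('d))) ^ CARD('d) * measure lborel (ball 0 1 :: (real^'d) set)))"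
    using prism_volume e_pos by (intro mult_left_mono) auto
  finally show ?thesis unfolding mr by (simp add: mult_ac)
qed

end


section \<open>Caps of the ball and the regions inside them\<close>

definition cap :: "'a::real_inner \<Rightarrow> real \<Rightarrow> 'a set" where
  "cap u r = {p \<in> cball 0 1. 1 - 2 * r\<^sup>2 \<le> u \<bullet> p}"

definition cap_unmap :: "'a::real_inner \<Rightarrow> real \<Rightarrow> 'a \<Rightarrow> 'a" where
  "cap_unmap u r x = (1 / r) *\<^sub>R (x - u) + ((1 / r\<^sup>2 - 1 / r) * (u \<bullet> (x - u))) *\<^sub>R u"

lemma cap_unmap_map:
  assumes "norm u = 1" "0 < r"
  shows "cap_unmap u r (cap_map u r v) = v" "cap_map u r (cap_unmap u r x) = x"
proof -
  have uu: "u \<bullet> u = 1" using assms(1) by (simp add: norm_eq_1)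
  have 1: "u \<bullet> (cap_map u r v - u) = r\<^sup>2 * (u \<bullet> v)"
    by (simp add: cap_map_def inner_add_right uu algebra_simps)
  have "cap_unmap u r (cap_map u r v) = (1 / r) *\<^sub>R (r *\<^sub>R v + ((r\<^sup>2 - r) * (u \<bullet> v)) *\<^sub>R u)
    + ((1 / r\<^sup>2 - 1 / r) * (r\<^sup>2 * (u \<bullet> v))) *\<^sub>R u"
    unfolding cap_unmap_def 1 by (simp add: cap_map_def)
  also have "\<dots> = v + ((1 / r) * ((r\<^sup>2 - r) * (u \<bullet> v)) + (1 / r\<^sup>2 - 1 / r) * (r\<^sup>2 * (u \<bullet> v))) *\<^sub>R u"
    using assms(2) by (simp add: scaleR_add_right scaleR_add_left)
  also have "(1 / r) * ((r\<^sup>2 - r) * (u \<bullet> v)) + (1 / r\<^sup>2 - 1 / r) * (r\<^sup>2 * (u \<bullet> v)) = 0"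
    using assms(2) by (simp add: field_simps power2_eq_square)
  finally show "cap_unmap u r (cap_map u r v) = v" by simp
  let ?y = "x - u"
  have 2: "u \<bullet> cap_unmap u r x = (u \<bullet> ?y) / r\<^sup>2"
    unfolding cap_unmap_def inner_add_right inner_scaleR_right uu by (simp add: algebra_simps)
  have "cap_map u r (cap_unmap u r x) = u + (r *\<^sub>R ((1 / r) *\<^sub>R ?y + ((1 / r\<^sup>2 - 1 / r) * (u \<bullet> ?y)) *\<^sub>R u)
     + ((r\<^sup>2 - r) * ((u \<bullet> ?y) / r\<^sup>2)) *\<^sub>R u)"
    unfolding cap_map_def 2 unfolding cap_unmap_def ..
  also have "\<dots> = u + ?y + (r * ((1 / r\<^sup>2 - 1 / r) * (u \<bullet> ?y)) + (r\<^sup>2 - r) * ((u \<bullet> ?y) / r\<^sup>2)) *\<^sub>R u"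
    using assms(2) by (simp add: scaleR_add_right scaleR_add_left)
  also have "r * ((1 / r\<^sup>2 - 1 / r) * (u \<bullet> ?y)) + (r\<^sup>2 - r) * ((u \<bullet> ?y) / r\<^sup>2) = 0"
    using assms(2) by (simp add: field_simps power2_eq_square)
  finally show "cap_map u r (cap_unmap u r x) = x" by simp
qed

lemma cap_map_image_open:
  fixes u :: "'a::euclidean_space"
  assumes "norm u = 1" "0 < r" "open S"
  shows "open (cap_map u r ` S)"
proof -
  have "cap_map u r ` S = cap_unmap u r -` S"
    using cap_unmap_map[OF assms(1,2)] by (auto simp: image_iff) metis
  moreover have "continuous_on UNIV (cap_unmap u r)"
    unfolding cap_unmap_def[abs_def] by (intro continuous_intros)
  ultimately show ?thesis using assms(3) by (simp add: open_vimage)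
qed

lemma measure_cap_map_ball:
  fixes u :: "real^'d"
  assumes "norm u = 1" "0 < r" "0 \<le> \<rho>"
  shows "measure lborel (cap_map u r ` ball c \<rho>) = \<rho> ^ CARD('d) * measure lborel (ball 0 1 :: (real^'d) set) * r ^ (CARD('d) + 1)"
proof -
  have "open (cap_map u r ` ball c \<rho>)" by (intro cap_map_image_open assms) simp
  then have "measure lborel (cap_map u r ` ball c \<rho>) = measure lebesgue (cap_map u r ` ball c \<rho>)"
    by (simp add: measure_completion)
  also have "\<dots> = r\<^sup>2 * r ^ (CARD('d) - 1) * (\<rho> ^ CARD('d) * measure lborel (ball 0 1 :: (real^'d) set))"
    unfolding cap_map_def[abs_def] using assms by (intro measure_stretch_ball) auto
  also have "r\<^sup>2 * r ^ (CARD('d) - 1) = r ^ (CARD('d) + 1)"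
  proof -
    have "CARD('d) + 1 = 2 + (CARD('d) - 1)" using zero_less_card_finite[where 'a='d] by linarith
    then show ?thesis by (simp only: power_add)
  qed
  finally show ?thesis by (simp add: mult_ac)
qed

text \<open>With \<open>t = u \<bullet> z\<close> and tangential part \<open>y\<close>, the squared
  norm of the image exceeds 1 by the square of \<open>r\<close> times a sum of three terms:
  \<open>2 * t\<close>, at most -1.75, a second-order term, at most 0.04, and the squared norm of
  \<open>y\<close>, at most 1.21.\<close>

lemma cap_map_in_cap:
  fixes u :: "'a::euclidean_space"
  assumes u: "norm u = 1" and r: "0 < r" "r\<^sup>2 \<le> 1 / 100" and z: "- 2 \<le> u \<bullet> z" "u \<bullet> z \<le> - (7 / 8)"
    and y: "norm (z - (u \<bullet> z) *\<^sub>R u) \<le> 11 / 10"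
  shows "cap_map u r z \<in> cap u r"
proof -
  have uu: "u \<bullet> u = 1" using u by (simp add: norm_eq_1)
  define t where "t = u \<bullet> z"
  define y where "y = z - t *\<^sub>R u"
  have uy: "u \<bullet> y = 0" "y \<bullet> u = 0" by (simp_all add: y_def t_def inner_diff_right inner_diff_left uu inner_commute)
  have zy: "z = y + t *\<^sub>R u" by (simp add: y_def)
  have cm: "cap_map u r z = (1 + r\<^sup>2 * t) *\<^sub>R u + r *\<^sub>R y"
    unfolding cap_map_def t_def[symmetric] by (subst zy) (simp add: algebra_simps)
  have "(norm (cap_map u r z))\<^sup>2 = (1 + r\<^sup>2 * t)\<^sup>2 + r\<^sup>2 * (norm y)\<^sup>2"
    unfolding power2_norm_eq_inner cm
    by (simp add: inner_add_left inner_add_right uy uu power2_eq_square)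
  also have "\<dots> = 1 + r\<^sup>2 * (2 * t + r\<^sup>2 * t\<^sup>2 + (norm y)\<^sup>2)" by (simp add: power2_eq_square algebra_simps)
  also have "\<dots> \<le> 1"
  proof -
    have t: "- 2 \<le> t" "t \<le> - (7 / 8)" using z by (auto simp: t_def)
    have "t\<^sup>2 \<le> 2\<^sup>2" using t by (intro power2_le_iff_abs_le[THEN iffD2]) auto
    then have 1: "r\<^sup>2 * t\<^sup>2 \<le> (1 / 100) * 4" using r(2) by (intro mult_mono) auto
    have "(norm y)\<^sup>2 \<le> (11 / 10)\<^sup>2" using assms(6) by (intro power_mono) (auto simp: y_def t_def)
    then have "2 * t + r\<^sup>2 * t\<^sup>2 + (norm y)\<^sup>2 \<le> 0" using 1 t by (simp add: power2_eq_square)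
    then show ?thesis by (simp add: mult_nonneg_nonpos)
  qed
  finally have "norm (cap_map u r z) \<le> 1" using power2_le_imp_le[of "norm (cap_map u r z)" 1] by simp
  moreover have "u \<bullet> cap_map u r z = 1 + r\<^sup>2 * t" unfolding cm by (simp add: inner_add_right uu uy)
  moreover have "r\<^sup>2 * (- 2) \<le> r\<^sup>2 * t" using z by (intro mult_left_mono) (auto simp: t_def)
  ultimately show ?thesis by (simp add: cap_def)
qed

lemma closed_cap: "closed (cap (u :: 'a::euclidean_space) r)"
proof -
  have "cap u r = cball 0 1 \<inter> {p. 1 - 2 * r\<^sup>2 \<le> u \<bullet> p}" by (auto simp: cap_def)
  then show ?thesis by (simp add: closed_Int closed_halfspace_ge)
qed

text \<open>In rescaled coordinates a point of the cap has axial part \<open>t\<close> in [-2, 0]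
  and squared tangential part at most \<open>- 2 * t\<close>, hence squared norm at most 8; the ball
  of radius 3 contains it.\<close>

lemma measure_cap_le:
  fixes u :: "real^'d"
  assumes u: "norm u = 1" and r: "0 < r"
  shows "measure lborel (cap u r) \<le> 3 ^ CARD('d) * measure lborel (ball 0 1 :: (real^'d) set) * r ^ (CARD('d) + 1)"
proof -
  have uu: "u \<bullet> u = 1" using u by (simp add: norm_eq_1)
  have sub: "cap u r \<subseteq> cap_map u r ` ball 0 3"
  proof
    fix p assume p: "p \<in> cap u r"
    define z where "z = cap_unmap u r p"
    have pz: "p = cap_map u r z" using cap_unmap_map(2)[OF u r] by (simp add: z_def)
    define t where "t = u \<bullet> z"
    define y where "y = z - t *\<^sub>R u"
    have uy: "u \<bullet> y = 0" "y \<bullet> u = 0" by (simp_all add: y_def t_def inner_diff_right inner_diff_left uu inner_commute)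
    have zy: "z = y + t *\<^sub>R u" by (simp add: y_def)
    have cm: "p = (1 + r\<^sup>2 * t) *\<^sub>R u + r *\<^sub>R y"
      unfolding pz cap_map_def t_def[symmetric] by (subst zy) (simp add: algebra_simps)
    have up: "u \<bullet> p = 1 + r\<^sup>2 * t" unfolding cm by (simp add: inner_add_right uu uy)
    then have "r\<^sup>2 * (- 2) \<le> r\<^sup>2 * t" using p by (simp add: cap_def)
    then have t2: "- 2 \<le> t" by (rule mult_left_le_imp_le) (use r in simp)
    have "(norm p)\<^sup>2 = (1 + r\<^sup>2 * t)\<^sup>2 + r\<^sup>2 * (norm y)\<^sup>2"
      unfolding power2_norm_eq_inner cm
      by (simp add: inner_add_left inner_add_right uy uu power2_eq_square)
    also have "\<dots> = 1 + r\<^sup>2 * (2 * t + r\<^sup>2 * t\<^sup>2 + (norm y)\<^sup>2)" by (simp add: power2_eq_square algebra_simps)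
    finally have "1 + r\<^sup>2 * (2 * t + r\<^sup>2 * t\<^sup>2 + (norm y)\<^sup>2) \<le> 1"
      using p power_mono[of "norm p" 1 2] by (simp add: cap_def)
    then have "2 * t + r\<^sup>2 * t\<^sup>2 + (norm y)\<^sup>2 \<le> 0" using r by (simp add: mult_le_0_iff)
    moreover have "0 \<le> r\<^sup>2 * t\<^sup>2" by simp
    ultimately have y2: "(norm y)\<^sup>2 \<le> - 2 * t" and t0: "t \<le> 0" using zero_le_power2[of "norm y"] by linarith+
    have "(norm z)\<^sup>2 = (norm y)\<^sup>2 + t\<^sup>2"
      unfolding power2_norm_eq_inner zy by (simp add: inner_add_left inner_add_right uy uu power2_eq_square)
    moreover have "t\<^sup>2 \<le> 2\<^sup>2" using t2 t0 by (intro power2_le_iff_abs_le[THEN iffD2]) auto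
    ultimately have "(norm z)\<^sup>2 < 3\<^sup>2" using y2 t2 by simp
    then have "norm z < 3" by (rule power2_less_imp_less) simp
    then show "p \<in> cap_map u r ` ball 0 3" unfolding pz by simp
  qed
  have fin: "cap_map u r ` ball 0 3 \<in> fmeasurable lborel"
  proof -
    have "cap_map u r ` ball 0 3 \<subseteq> cap_map u r ` cball 0 3" by (intro image_mono ball_subset_cball)
    moreover have "compact (cap_map u r ` cball 0 3)"
      unfolding cap_map_def[abs_def] by (intro compact_continuous_image continuous_intros compact_cball)
    ultimately have "bounded (cap_map u r ` ball 0 3)" using bounded_subset compact_imp_bounded by blast
    then show ?thesis
      using emeasure_bounded_finite[of "cap_map u r ` ball 0 3"] cap_map_image_open[OF u r open_ball]
      by (intro fmeasurableI) auto
  qed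
  have "closed (cap u r)" by (rule closed_cap)
  then have "measure lborel (cap u r) \<le> measure lborel (cap_map u r ` ball 0 3)"
    using sub fin by (intro measure_mono_fmeasurable) auto
  also have "\<dots> = 3 ^ CARD('d) * measure lborel (ball 0 1 :: (real^'d) set) * r ^ (CARD('d) + 1)"
    by (rule measure_cap_map_ball[OF u r]) simp
  finally show ?thesis .
qed

text \<open>The base hyperplane is fitted to the anchors, and the \<open>j\<close>-th lateral one to
  the same points with the \<open>j\<close>-th replaced by the apex.\<close>

lemma cap_config_exists:
  fixes u :: "real^'d"
  assumes dim: "2 \<le> CARD('d)" and fr: "simplex_frame u v"
    and \<tau>: "0 < \<tau>" "4 * (real CARD('d))\<^sup>2 * \<tau> \<le> 1" and \<delta>: "0 < \<delta>" "\<delta> \<le> \<tau>\<^sup>2 / 100" and r: "0 < r" "r\<^sup>2 \<le> \<delta>"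
    and a: "\<And>j. norm (a j - (v j - u)) \<le> \<delta> / (32 * real CARD('d))" and b: "norm (b - (\<tau> - 1) *\<^sub>R u) \<le> \<delta> / (32 * real CARD('d))"
    and P: "finite P" "0 \<in> P" "P \<subseteq> cball 0 1" "range (\<lambda>j. cap_map u r (a j)) \<subseteq> P"
    and empty: "\<And>p. p \<in> P \<Longrightarrow> 1 - 2 * r\<^sup>2 \<le> u \<bullet> p \<Longrightarrow> p \<in> range (\<lambda>j. cap_map u r (a j))"
  obtains \<beta> \<alpha> \<beta>0 \<alpha>0 where "cap_config u v \<tau> \<delta> r \<beta> \<alpha> \<beta>0 \<alpha>0 a b P"
proof -
  let ?d = "real CARD('d)"
  define \<epsilon> where "\<epsilon> = \<delta> / (32 * ?d)"
  have d2: "2 \<le> ?d" using dim by simp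
  have u1: "norm u = 1" and uu: "u \<bullet> u = 1" and uv: "\<And>i. u \<bullet> v i = 0" and vu: "\<And>i. v i \<bullet> u = 0"
    and vv: "\<And>i j. v i \<bullet> v j = (if i = j then 1 else 0) - 1 / ?d"
    using fr by (simp_all add: simplex_frame_def norm_eq_1 inner_commute)
  have v1: "norm (v i) \<le> 1" for i
  proof -
    have "(norm (v i))\<^sup>2 \<le> 1\<^sup>2" unfolding power2_norm_eq_inner vv by simp
    then show ?thesis by (rule power2_le_imp_le) simp
  qed
  have \<tau>d: "\<tau> * ?d \<le> 1 / 8"
  proof -
    have "(4 * ?d * \<tau>) * 2 \<le> (4 * ?d * \<tau>) * ?d" using d2 \<tau>(1) by (intro mult_left_mono) auto
    also have "\<dots> \<le> 1" using \<tau>(2) by (simp add: power2_eq_square mult_ac)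
    finally show ?thesis by (simp add: mult_ac)
  qed
  have \<tau>1: "\<tau> \<le> 1"
  proof -
    have "\<tau> * 2 \<le> \<tau> * ?d" using d2 \<tau>(1) by (intro mult_left_mono) auto
    then show ?thesis using \<tau>d \<tau>(1) by linarith
  qed
  have \<delta>1: "\<delta> \<le> 1"
  proof -
    have "\<tau>\<^sup>2 \<le> 1\<^sup>2" using \<tau>(1) \<tau>1 by (intro power_mono) auto
    then show ?thesis using \<delta>(2) by simp
  qed
  have d\<epsilon>: "32 * (?d * \<epsilon>) = \<delta>" using d2 by (simp add: \<epsilon>_def)
  have \<epsilon>: "0 \<le> \<epsilon>" using \<delta>(1) by (simp add: \<epsilon>_def)
  have \<epsilon>d: "\<epsilon> \<le> ?d * \<epsilon>" using mult_right_mono[of 1 ?d \<epsilon>] d2 \<epsilon> by simp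
  have fit: "4 * ?d * \<epsilon> \<le> 1" using d\<epsilon> \<delta>1 \<delta>(1) by simp
  \<comment> \<open>The factor 32 in \<open>\<epsilon>\<close> leaves room: the slope errs by at
    most 5 and the height by at most 13 times \<open>real CARD('d) * \<epsilon>\<close>.\<close>
  have bounds: "norm (\<beta> - \<beta>') \<le> \<delta> \<and> \<bar>\<alpha> - \<alpha>'\<bar> \<le> \<delta>"
    if \<beta>: "norm (\<beta> - \<beta>') \<le> 4 * ?d * \<epsilon> * (1 + norm \<beta>')" and \<beta>': "norm \<beta>' \<le> 1 / 8"
      and \<alpha>: "\<bar>\<alpha> - \<alpha>'\<bar> \<le> (1 + norm \<beta>) * \<epsilon> + norm (\<beta> - \<beta>') * norm q" and q: "norm q \<le> 2"
    for \<beta> \<beta>' q :: "real^'d" and \<alpha> \<alpha>' :: real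
  proof
    have "4 * ?d * \<epsilon> * (1 + norm \<beta>') \<le> 4 * ?d * \<epsilon> * (9 / 8)" using \<beta>' \<epsilon> by (intro mult_left_mono) auto
    also have "\<dots> = 9 / 2 * (?d * \<epsilon>)" by simp
    finally have b1: "norm (\<beta> - \<beta>') \<le> 5 * (?d * \<epsilon>)" using \<beta> \<epsilon> \<epsilon>d by linarith
    then show b2: "norm (\<beta> - \<beta>') \<le> \<delta>" using d\<epsilon> \<epsilon> \<epsilon>d by linarith
    have "norm \<beta> \<le> 2" using norm_triangle_sub[of \<beta> \<beta>'] \<beta>' b2 \<delta>1 by linarith
    then have "(1 + norm \<beta>) * \<epsilon> \<le> 3 * \<epsilon>" using \<epsilon> by (intro mult_right_mono) auto
    moreover have "norm (\<beta> - \<beta>') * norm q \<le> 5 * (?d * \<epsilon>) * 2" using b1 q \<epsilon> by (intro mult_mono) auto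
    ultimately show "\<bar>\<alpha> - \<alpha>'\<bar> \<le> \<delta>" using \<alpha> d\<epsilon> \<epsilon> \<epsilon>d by linarith
  qed
  have vmu: "norm (v i - u) \<le> 2" for i using norm_triangle_ineq4[of "v i" u] v1[of i] u1 by linarith
  have wu: "norm ((\<tau> - 1) *\<^sub>R u) \<le> 2" using u1 \<tau>(1) \<tau>1 by simp
  have "\<exists>\<beta>0 \<alpha>0. u \<bullet> \<beta>0 = 0 \<and> (\<forall>i. (u - \<beta>0) \<bullet> a i = \<alpha>0) \<and> norm (\<beta>0 - 0) \<le> \<delta> \<and> \<bar>\<alpha>0 - (- 1)\<bar> \<le> \<delta>"
  proof -
    obtain \<beta>0 \<alpha>0 where f: "u \<bullet> \<beta>0 = 0" "\<And>i. (u - \<beta>0) \<bullet> a i = \<alpha>0"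
      "norm (\<beta>0 - 0) \<le> 4 * ?d * \<epsilon> * (1 + norm (0 :: real^'d))"
      "\<And>i. \<bar>\<alpha>0 - (- 1)\<bar> \<le> (1 + norm \<beta>0) * \<epsilon> + norm (\<beta>0 - 0) * norm (v i - u)"
    proof (rule hyperplane_fit[OF u1, where ?\<beta>0.0 = 0 and ?q0.0 = "\<lambda>i. v i - u" and ?\<alpha>0.0 = "- 1" and q = a and \<epsilon> = \<epsilon>])
      show "(u - 0) \<bullet> (v i - u) = - 1" for i by (simp add: inner_diff_right uv uu)
      show "norm \<Delta> \<le> ?d * M"
        if "u \<bullet> \<Delta> = 0" "0 \<le> M" "\<And>i l. \<bar>\<Delta> \<bullet> ((v i - u) - (v l - u))\<bar> \<le> M" for \<Delta> M
        using simplex_frame_coercive_diff[OF fr that(1,2)] that(3) by simp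
    qed (use a fit that in \<open>auto simp: \<epsilon>_def\<close>)
    then show ?thesis using bounds[OF f(3) _ f(4)[of undefined] vmu] by auto
  qed
  then obtain \<beta>0 \<alpha>0 where f0: "u \<bullet> \<beta>0 = 0" "\<And>i. (u - \<beta>0) \<bullet> a i = \<alpha>0" "norm \<beta>0 \<le> \<delta>" "\<bar>\<alpha>0 + 1\<bar> \<le> \<delta>"
    by auto
  define R where "R j \<beta> \<alpha> \<longleftrightarrow> u \<bullet> \<beta> = 0 \<and> (\<forall>i. i \<noteq> j \<longrightarrow> (u - \<beta>) \<bullet> a i = \<alpha>) \<and> (u - \<beta>) \<bullet> b = \<alpha>
     \<and> norm (\<beta> - (\<tau> * ?d) *\<^sub>R v j) \<le> \<delta> \<and> \<bar>\<alpha> - (\<tau> - 1)\<bar> \<le> \<delta>" for j \<beta> \<alpha>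
  have "\<exists>\<beta> \<alpha>. u \<bullet> \<beta> = 0 \<and> (\<forall>i. i \<noteq> j \<longrightarrow> (u - \<beta>) \<bullet> a i = \<alpha>) \<and> (u - \<beta>) \<bullet> b = \<alpha>
     \<and> norm (\<beta> - (\<tau> * ?d) *\<^sub>R v j) \<le> \<delta> \<and> \<bar>\<alpha> - (\<tau> - 1)\<bar> \<le> \<delta>" for j
  proof -
    let ?ideal = "\<lambda>i. if i = j then (\<tau> - 1) *\<^sub>R u else v i - u" and ?pts = "\<lambda>i. if i = j then b else a i"
    obtain \<beta> \<alpha> where f: "u \<bullet> \<beta> = 0" "\<And>i. (u - \<beta>) \<bullet> ?pts i = \<alpha>"
      "norm (\<beta> - (\<tau> * ?d) *\<^sub>R v j) \<le> 4 * ?d * \<epsilon> * (1 + norm ((\<tau> * ?d) *\<^sub>R v j))"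
      "\<And>i. \<bar>\<alpha> - (\<tau> - 1)\<bar> \<le> (1 + norm \<beta>) * \<epsilon> + norm (\<beta> - (\<tau> * ?d) *\<^sub>R v j) * norm (?ideal i)"
    proof (rule hyperplane_fit[OF u1, where ?\<beta>0.0 = "(\<tau> * ?d) *\<^sub>R v j" and ?q0.0 = ?ideal and ?\<alpha>0.0 = "\<tau> - 1" and q = ?pts and \<epsilon> = \<epsilon>])
      show "u \<bullet> ((\<tau> * ?d) *\<^sub>R v j) = 0" by (simp add: uv)
      \<comment> \<open>The ideal slope is chosen for this:
        \<open>v j \<bullet> v i = - 1 / ?d\<close> for distinct indices, so all remaining anchors
        are lifted from -1 to \<open>\<tau> - 1\<close>, the level of the apex.\<close>
      show "(u - (\<tau> * ?d) *\<^sub>R v j) \<bullet> ?ideal i = \<tau> - 1" for i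
        using d2 by (auto simp: inner_diff_left inner_diff_right uv vu uu vv)
      show "norm \<Delta> \<le> ?d * M"
        if D: "u \<bullet> \<Delta> = 0" "0 \<le> M" "\<And>i l. \<bar>\<Delta> \<bullet> (?ideal i - ?ideal l)\<bar> \<le> M" for \<Delta> M
      proof (rule simplex_frame_coercive[OF fr D(1,2), of j])
        fix i assume "i \<noteq> j"
        then show "\<bar>\<Delta> \<bullet> v i\<bar> \<le> M"
          using D(3)[of i j] D(1) by (simp add: inner_diff_right inner_commute[of \<Delta> u])
      qed
      show "norm (?pts i - ?ideal i) \<le> \<epsilon>" for i using a[of i] b by (simp add: \<epsilon>_def)
    qed (use fit that in auto)
    have "norm ((\<tau> * ?d) *\<^sub>R v j) \<le> 1 / 8"
    proof -
      have "(\<tau> * ?d) * norm (v j) \<le> (\<tau> * ?d) * 1" using v1[of j] \<tau>(1) by (intro mult_left_mono) auto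
      moreover have "norm ((\<tau> * ?d) *\<^sub>R v j) = (\<tau> * ?d) * norm (v j)" using \<tau>(1) by simp
      ultimately show ?thesis using \<tau>d by linarith
    qed
    moreover have "norm (?ideal j) \<le> 2" using wu by simp
    ultimately have "norm (\<beta> - (\<tau> * ?d) *\<^sub>R v j) \<le> \<delta> \<and> \<bar>\<alpha> - (\<tau> - 1)\<bar> \<le> \<delta>"
      by (rule bounds[OF f(3) _ f(4)])
    moreover have "(u - \<beta>) \<bullet> b = \<alpha>" using f(2)[of j] by simp
    moreover have "\<forall>i. i \<noteq> j \<longrightarrow> (u - \<beta>) \<bullet> a i = \<alpha>" using f(2) by (metis (full_types))
    ultimately show ?thesis using f(1) by blast
  qed
  then have ex: "\<forall>j. \<exists>\<beta> \<alpha>. R j \<beta> \<alpha>" unfolding R_def by blast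
  obtain \<beta> \<alpha> where "\<forall>j. R j (\<beta> j) (\<alpha> j)" using ex by metis
  then have f: "\<And>j. u \<bullet> \<beta> j = 0" "\<And>i j. i \<noteq> j \<Longrightarrow> (u - \<beta> j) \<bullet> a i = \<alpha> j" "\<And>j. (u - \<beta> j) \<bullet> b = \<alpha> j"
     "\<And>j. norm (\<beta> j - (\<tau> * ?d) *\<^sub>R v j) \<le> \<delta>" "\<And>j. \<bar>\<alpha> j - (\<tau> - 1)\<bar> \<le> \<delta>"
    unfolding R_def by blast+
  have \<epsilon>\<delta>: "\<epsilon> \<le> \<delta>" using d\<epsilon> \<epsilon>d \<epsilon> by linarith
  have "norm (a j - (v j - u)) \<le> \<delta>" for j using a[of j] \<epsilon>\<delta> by (simp add: \<epsilon>_def)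
  moreover have "norm (b - (\<tau> - 1) *\<^sub>R u) \<le> \<delta>" using b \<epsilon>\<delta> by (simp add: \<epsilon>_def)
  ultimately have "cap_config u v \<tau> \<delta> r \<beta> \<alpha> \<beta>0 \<alpha>0 a b P"
    using assms(1-8) P empty f f0 by unfold_locales
  then show thesis by (rule that)
qed

text \<open>The expression is \<open>\<tau> * (A * \<tau> + B)\<close>. If \<open>A\<close> and
  \<open>B\<close> both vanished, then \<open>a1 * p1 + a2 * p2 = 0\<close> and
  \<open>a1 + a2 = 0\<close>, impossible for distinct exponents. A nonzero affine function has at
  most one root, so \<open>\<tau>0\<close> or \<open>\<tau>0 / 2\<close> serves.\<close>

lemma leading_coefficient_nonzero:
  fixes a1 a2 p1 p2 D :: real
  assumes "(a1, a2) \<noteq> (0, 0)" "p1 \<noteq> p2" "D \<noteq> 0" "0 < \<tau>0"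
  obtains \<tau> where "0 < \<tau>" "\<tau> \<le> \<tau>0"
    "a1 * (p1 * (\<tau>\<^sup>2 * D) / 2 + (1 - p1) * \<tau>) + a2 * (p2 * (\<tau>\<^sup>2 * D) / 2 + (1 - p2) * \<tau>) \<noteq> 0"
proof -
  define A where "A = (a1 * p1 + a2 * p2) * D / 2"
  define B where "B = a1 * (1 - p1) + a2 * (1 - p2)"
  have f: "a1 * (p1 * (\<tau>\<^sup>2 * D) / 2 + (1 - p1) * \<tau>) + a2 * (p2 * (\<tau>\<^sup>2 * D) / 2 + (1 - p2) * \<tau>) = \<tau> * (A * \<tau> + B)" for \<tau>
    by (simp add: A_def B_def power2_eq_square field_simps)
  have AB: "A \<noteq> 0 \<or> B \<noteq> 0"
  proof (rule ccontr)
    assume "\<not> (A \<noteq> 0 \<or> B \<noteq> 0)"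
    then have "A = 0" "B = 0" by simp_all
    then have 1: "a1 * p1 + a2 * p2 = 0" using assms(3) by (simp add: A_def)
    have 2: "a1 + a2 = 0" using \<open>B = 0\<close> 1 by (simp add: B_def algebra_simps)
    have "a2 = - a1" using 2 by simp
    then have "a1 * (p1 - p2) = 0" using 1 by (simp add: algebra_simps)
    then show False using assms(1,2) 2 by auto
  qed
  show thesis
  proof (cases "A * \<tau>0 + B = 0")
    case False then show ?thesis using that[of \<tau>0] assms(4) f by simp
  next
    case True
    have "A * (\<tau>0 / 2) + B \<noteq> 0"
    proof
      assume h: "A * (\<tau>0 / 2) + B = 0"
      then have "A * \<tau>0 = 0" using True unfolding times_divide_eq_right by linarith
      then have "A = 0" using assms(4) by simp
      then show False using AB True by simp
    qed
    then have nz: "\<tau>0 / 2 * (A * (\<tau>0 / 2) + B) \<noteq> 0" using assms(4) by simp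
    show ?thesis
      by (rule that[of "\<tau>0 / 2"], use assms(4) in simp, use assms(4) in simp) (unfold f, rule nz)
  qed
qed

text \<open>The regions are images of small balls around the ideal anchors and the ideal apex under
  \<open>cap_map\<close>. The constants \<open>\<sigma>\<close>, \<open>c\<close> and
  \<open>m\<close> depend on neither \<open>r\<close> nor \<open>u\<close>, which makes the gain
  uniform over caps and intensities.\<close>

lemma cap_gain:
  fixes a1 a2 p1 p2 :: real
  assumes dim: "2 \<le> CARD('d)" and a: "(a1, a2) \<noteq> (0, 0)"
    and p: "0 \<le> p1" "p1 \<le> 1" "0 \<le> p2" "p2 \<le> 1" "p1 \<noteq> p2"
  obtains \<sigma> c m r0 :: real where "\<bar>\<sigma>\<bar> = 1" "0 < c" "0 < m" "0 < r0" "r0 \<le> 1 / 100"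
    "\<And>r (u :: real^'d). 0 < r \<Longrightarrow> r \<le> r0 \<Longrightarrow> norm u = 1 \<Longrightarrow>
      \<exists>(X :: 'd \<Rightarrow> (real^'d) set) W. (\<forall>j. X j \<in> sets borel \<and> X j \<subseteq> cap u r \<and> X j \<inter> W = {} \<and> measure lborel (X j) = m * r ^ (CARD('d) + 1)) \<and>
        W \<in> sets borel \<and> W \<subseteq> cap u r \<and> measure lborel W = m * r ^ (CARD('d) + 1) \<and> disjoint_family X \<and>
        (\<forall>P x w. finite P \<longrightarrow> 0 \<in> P \<longrightarrow> P \<subseteq> cball 0 1 \<longrightarrow> (\<forall>j. x j \<in> X j \<inter> P) \<longrightarrow> P \<inter> cap u r \<subseteq> range x \<longrightarrow> w \<in> W \<longrightarrow>
          c * r ^ (CARD('d) + 1) \<le> \<sigma> *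
          ((a1 * Lp_surface_area p1 (convex hull (insert w P)) + a2 * Lp_surface_area p2 (convex hull (insert w P)))
           - (a1 * Lp_surface_area p1 (convex hull P) + a2 * Lp_surface_area p2 (convex hull P))))"
proof -
  let ?d = "real CARD('d)"
  have d2: "2 \<le> ?d" using dim by simp
  define \<omega> where "\<omega> = measure lborel (ball 0 1 :: (real^'d) set)"
  have \<omega>: "0 < \<omega>" by (simp add: \<omega>_def content_ball_pos)
  define L where "L \<tau> = a1 * (p1 * (\<tau>\<^sup>2 * ?d * (?d - 1)) / 2 + (1 - p1) * \<tau>)
     + a2 * (p2 * (\<tau>\<^sup>2 * ?d * (?d - 1)) / 2 + (1 - p2) * \<tau>)" for \<tau>
  obtain \<tau> where \<tau>: "0 < \<tau>" "\<tau> \<le> 1 / (4 * ?d\<^sup>2)" "L \<tau> \<noteq> 0"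
    using leading_coefficient_nonzero[OF a p(5), of "?d * (?d - 1)" "1 / (4 * ?d\<^sup>2)"] d2
    unfolding L_def by (auto simp: mult.assoc)
  have \<tau>2: "4 * ?d\<^sup>2 * \<tau> \<le> 1" using \<tau>(2) d2 by (simp add: field_simps)
  have A: "0 < \<bar>a1\<bar> + \<bar>a2\<bar>" using a by auto
  \<comment> \<open>The first bound serves the foot conditions, the second keeps the errors below
    half of the main term.\<close>
  define \<delta> where "\<delta> = min (\<tau>\<^sup>2 / 100) (\<bar>L \<tau>\<bar> / (100 * (\<bar>a1\<bar> + \<bar>a2\<bar>)))"
  have \<delta>: "0 < \<delta>" "\<delta> \<le> \<tau>\<^sup>2 / 100"
    using \<tau> A by (simp add: \<delta>_def) (simp only: \<delta>_def min.cobounded1)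
  have \<delta>L: "100 * (\<bar>a1\<bar> + \<bar>a2\<bar>) * \<delta> \<le> \<bar>L \<tau>\<bar>"
  proof -
    have "\<delta> \<le> \<bar>L \<tau>\<bar> / (100 * (\<bar>a1\<bar> + \<bar>a2\<bar>))" by (simp add: \<delta>_def)
    then show ?thesis using A by (simp add: field_simps)
  qed
  define \<epsilon> where "\<epsilon> = \<delta> / (32 * ?d)"
  have \<epsilon>0: "0 < \<epsilon>" using \<delta> d2 by (simp add: \<epsilon>_def)
  have \<tau>s: "\<tau> \<le> 1 / 16"
  proof -
    have "(2::real)\<^sup>2 \<le> ?d\<^sup>2" using d2 by (intro power_mono) auto
    then have "4 * \<tau> \<le> ?d\<^sup>2 * \<tau>" using \<tau>(1) by (intro mult_right_mono) auto
    then show ?thesis using \<tau>2 by linarith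
  qed
  have \<tau>q: "\<tau>\<^sup>2 \<le> 1" using \<tau>(1) \<tau>s by (simp add: power_le_one)
  have \<delta>s: "\<delta> \<le> 1 / 100" using \<delta> \<tau>q by simp
  have \<epsilon>s: "\<epsilon> \<le> 1 / 100"
  proof -
    have "\<epsilon> \<le> \<delta>" unfolding \<epsilon>_def using \<delta>(1) d2 by (simp add: divide_le_eq)
    then show ?thesis using \<delta>s by simp
  qed
  define c where "c = \<bar>L \<tau>\<bar> / 2 * ((1 / (4 * ?d)) ^ CARD('d) * \<omega>)"
  have c0: "0 < c" using \<tau>(3) \<omega> d2 by (simp add: c_def)
  define m where "m = \<epsilon> ^ CARD('d) * \<omega>"
  have m0: "0 < m" using \<epsilon>0 \<omega> by (simp add: m_def)
  show thesis
  \<comment> \<open>\<open>\<delta>\<close> itself serves as \<open>r0\<close>: for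
    \<open>r \<le> \<delta> \<le> 1\<close> the square of \<open>r\<close> is also at most
    \<open>\<delta>\<close>.\<close>
  proof (rule that[of "sgn (L \<tau>)" c m "\<delta>"])
    show "\<bar>sgn (L \<tau>)\<bar> = 1" using \<tau>(3) by (simp add: sgn_if)
    show "0 < c" "0 < m" "0 < \<delta>" "\<delta> \<le> 1 / 100" by (rule c0 m0 \<delta>(1) \<delta>s)+
    fix r :: real and u :: "real^'d"
    assume r: "0 < r" "r \<le> \<delta>" and u: "norm u = 1"
    have "r\<^sup>2 \<le> r * 1" unfolding power2_eq_square using r \<delta>s by (intro mult_left_mono) auto
    then have re: "r\<^sup>2 \<le> \<delta>" using r by simp
    have rs: "r\<^sup>2 \<le> 1 / 100" using re \<delta>s by simp
    obtain v where fr: "simplex_frame u v" by (rule simplex_frame_exists[OF u])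
    have uu: "u \<bullet> u = 1" and uv: "\<And>i. u \<bullet> v i = 0" and vu: "\<And>i. v i \<bullet> u = 0"
      and vv: "\<And>i j. v i \<bullet> v j = (if i = j then 1 else 0) - 1 / ?d"
      using fr by (simp_all add: simplex_frame_def norm_eq_1 inner_commute)
    have v1: "norm (v i) \<le> 1" for i
    proof -
      have "(norm (v i))\<^sup>2 \<le> 1\<^sup>2" unfolding power2_norm_eq_inner vv by simp
      then show ?thesis by (rule power2_le_imp_le) simp
    qed
    define X where "X j = cap_map u r ` ball (v j - u) \<epsilon>" for j
    define W where "W = cap_map u r ` ball ((\<tau> - 1) *\<^sub>R u) \<epsilon>"
    have inj: "inj (cap_map u r)" using cap_unmap_map(1)[OF u r(1)] by (rule inj_on_inverseI)
    have tang: "norm ((z - (u \<bullet> z) *\<^sub>R u) - (y - (u \<bullet> y) *\<^sub>R u)) \<le> 2 * norm (z - y)" for z y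
    proof -
      have "(z - (u \<bullet> z) *\<^sub>R u) - (y - (u \<bullet> y) *\<^sub>R u) = (z - y) - (u \<bullet> (z - y)) *\<^sub>R u"
        by (simp add: inner_diff_right algebra_simps)
      then have "norm ((z - (u \<bullet> z) *\<^sub>R u) - (y - (u \<bullet> y) *\<^sub>R u)) \<le> norm (z - y) + \<bar>u \<bullet> (z - y)\<bar> * norm u"
        by (metis norm_scaleR norm_triangle_ineq4)
      moreover have "\<bar>u \<bullet> (z - y)\<bar> \<le> 1 * norm (z - y)" using Cauchy_Schwarz_ineq2[of u "z - y"] u by simp
      ultimately show ?thesis using u by simp
    qed
    have ax: "\<bar>u \<bullet> z - u \<bullet> y\<bar> \<le> norm (z - y)" for z y
      using Cauchy_Schwarz_ineq2[of u "z - y"] u by (simp add: inner_diff_right)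
    have Xc: "X j \<subseteq> cap u r" for j
    proof -
      have "cap_map u r z \<in> cap u r" if z: "z \<in> ball (v j - u) \<epsilon>" for z
      proof (rule cap_map_in_cap[OF u r(1) rs])
        have zd: "norm (z - (v j - u)) \<le> 1 / 100" using z \<epsilon>s by (simp add: dist_norm norm_minus_commute)
        have "u \<bullet> (v j - u) = - 1" by (simp add: inner_diff_right uv uu)
        then show "- 2 \<le> u \<bullet> z" "u \<bullet> z \<le> - (7 / 8)" using ax[of z "v j - u"] zd by linarith+
        have e: "(v j - u) - (u \<bullet> (v j - u)) *\<^sub>R u = v j" by (simp add: inner_diff_right uv uu)
        have "norm ((z - (u \<bullet> z) *\<^sub>R u) - v j) \<le> 2 * (1 / 100)"
          using tang[of z "v j - u", unfolded e] zd by linarith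
        then show "norm (z - (u \<bullet> z) *\<^sub>R u) \<le> 11 / 10"
          using v1[of j] norm_triangle_sub[of "z - (u \<bullet> z) *\<^sub>R u" "v j"] by linarith
      qed
      then show ?thesis by (auto simp: X_def)
    qed
    have Wc: "W \<subseteq> cap u r"
    proof -
      have "cap_map u r z \<in> cap u r" if z: "z \<in> ball ((\<tau> - 1) *\<^sub>R u) \<epsilon>" for z
      proof (rule cap_map_in_cap[OF u r(1) rs])
        have zd: "norm (z - (\<tau> - 1) *\<^sub>R u) \<le> 1 / 100" using z \<epsilon>s by (simp add: dist_norm norm_minus_commute)
        have "u \<bullet> ((\<tau> - 1) *\<^sub>R u) = \<tau> - 1" by (simp add: uu)
        then show "- 2 \<le> u \<bullet> z" "u \<bullet> z \<le> - (7 / 8)" using ax[of z "(\<tau> - 1) *\<^sub>R u"] zd \<tau>(1) \<tau>s by linarith+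
        have e: "((\<tau> - 1) *\<^sub>R u) - (u \<bullet> ((\<tau> - 1) *\<^sub>R u)) *\<^sub>R u = 0" by (simp add: uu)
        show "norm (z - (u \<bullet> z) *\<^sub>R u) \<le> 11 / 10"
          using tang[of z "(\<tau> - 1) *\<^sub>R u", unfolded e diff_zero] zd by linarith
      qed
      then show ?thesis by (auto simp: W_def)
    qed
    have far: "ball x \<epsilon> \<inter> ball y \<epsilon> = {}" if "1 / 4 \<le> (x - y) \<bullet> (x - y)" for x y :: "real^'d"
    proof -
      have "(1 / 2 :: real)\<^sup>2 = 1 / 4" by (simp add: power2_eq_square)
      then have "(1 / 2)\<^sup>2 \<le> (norm (x - y))\<^sup>2" using that unfolding power2_norm_eq_inner by simp
      then have "1 / 2 \<le> norm (x - y)" by (rule power2_le_imp_le) simp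
      then show ?thesis using \<epsilon>s by (intro disjoint_ballI) (simp add: dist_norm)
    qed
    have XW: "X j \<inter> W = {}" for j
    proof -
      have "(v j - u) - (\<tau> - 1) *\<^sub>R u = v j - \<tau> *\<^sub>R u" by (simp add: algebra_simps)
      then have "((v j - u) - (\<tau> - 1) *\<^sub>R u) \<bullet> ((v j - u) - (\<tau> - 1) *\<^sub>R u) = 1 - 1 / ?d + \<tau>\<^sup>2"
        unfolding \<open>_ = v j - \<tau> *\<^sub>R u\<close> by (simp add: inner_diff_left inner_diff_right uv vu uu vv power2_eq_square)
      moreover have "1 / ?d \<le> 1 / 2" using d2 by (simp add: field_simps)
      ultimately have "1 / 4 \<le> ((v j - u) - (\<tau> - 1) *\<^sub>R u) \<bullet> ((v j - u) - (\<tau> - 1) *\<^sub>R u)"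
        using zero_le_power2[of \<tau>] by linarith
      then show ?thesis using far image_Int[OF inj] unfolding X_def W_def by (metis image_empty)
    qed
    have XX: "disjoint_family X"
      unfolding disjoint_family_on_def
    proof (intro ballI impI)
      fix i j :: 'd assume "i \<noteq> j"
      then have "((v i - u) - (v j - u)) \<bullet> ((v i - u) - (v j - u)) = 2"
        by (simp add: inner_diff_left inner_diff_right vv)
      then show "X i \<inter> X j = {}"
        using far[of "v i - u" "v j - u"] image_Int[OF inj, of "ball (v i - u) \<epsilon>" "ball (v j - u) \<epsilon>"]
        unfolding X_def by simp
    qed
    have Xm: "measure lborel (X j) = m * r ^ (CARD('d) + 1)" for j
      unfolding X_def m_def \<omega>_def using \<epsilon>0 by (intro measure_cap_map_ball u r) simp
    have Wm: "measure lborel W = m * r ^ (CARD('d) + 1)"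
      unfolding W_def m_def \<omega>_def using \<epsilon>0 by (intro measure_cap_map_ball u r) simp
    have gain: "c * r ^ (CARD('d) + 1) \<le> sgn (L \<tau>) *
          ((a1 * Lp_surface_area p1 (convex hull (insert w P)) + a2 * Lp_surface_area p2 (convex hull (insert w P)))
           - (a1 * Lp_surface_area p1 (convex hull P) + a2 * Lp_surface_area p2 (convex hull P)))"
      if P: "finite P" "0 \<in> P" "P \<subseteq> cball 0 1" and x: "\<And>j. x j \<in> X j \<inter> P" and sub: "P \<inter> cap u r \<subseteq> range x" and w: "w \<in> W"
      for P x w
    proof -
      have "\<forall>j. \<exists>z. z \<in> ball (v j - u) \<epsilon> \<and> x j = cap_map u r z"
      proof
        fix j
        have "x j \<in> cap_map u r ` ball (v j - u) \<epsilon>" using x[of j] by (simp add: X_def)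
        then show "\<exists>z. z \<in> ball (v j - u) \<epsilon> \<and> x j = cap_map u r z" by blast
      qed
      then obtain y where y: "\<And>j. y j \<in> ball (v j - u) \<epsilon>" "\<And>j. x j = cap_map u r (y j)" by metis
      obtain b where b: "b \<in> ball ((\<tau> - 1) *\<^sub>R u) \<epsilon>" "w = cap_map u r b" using w by (auto simp: W_def)
      have xr: "range (\<lambda>j. cap_map u r (y j)) = range x" using y(2) by auto
      obtain \<beta> \<alpha> \<beta>0 \<alpha>0 where cfg: "cap_config u v \<tau> \<delta> r \<beta> \<alpha> \<beta>0 \<alpha>0 y b P"
      proof (rule cap_config_exists[OF dim fr \<tau>(1) \<tau>2 \<delta> r(1) re, of y b P])
        show "norm (y j - (v j - u)) \<le> \<delta> / (32 * ?d)" for j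
          using y(1)[of j] by (simp add: \<epsilon>_def[symmetric] dist_norm norm_minus_commute)
        show "norm (b - (\<tau> - 1) *\<^sub>R u) \<le> \<delta> / (32 * ?d)"
          using b(1) by (simp add: \<epsilon>_def[symmetric] dist_norm norm_minus_commute)
        show "range (\<lambda>j. cap_map u r (y j)) \<subseteq> P" unfolding xr using x by auto
        show "p \<in> range (\<lambda>j. cap_map u r (y j))" if "p \<in> P" "1 - 2 * r\<^sup>2 \<le> u \<bullet> p" for p
        proof -
          have "norm p \<le> 1" using that(1) P(3) by auto
          then have "p \<in> P \<inter> cap u r" using that by (simp add: cap_def)
          then show ?thesis unfolding xr using sub by blast
        qed
      qed (use P in auto)
      show ?thesis
        using cap_config.gain[OF cfg p(1-4), of a1 a2, folded L_def, OF \<delta>L]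
        unfolding c_def \<omega>_def b(2) cap_config.w_def[OF cfg] .
    qed
    show "\<exists>(X :: 'd \<Rightarrow> (real^'d) set) W. (\<forall>j. X j \<in> sets borel \<and> X j \<subseteq> cap u r \<and> X j \<inter> W = {} \<and> measure lborel (X j) = m * r ^ (CARD('d) + 1)) \<and>
        W \<in> sets borel \<and> W \<subseteq> cap u r \<and> measure lborel W = m * r ^ (CARD('d) + 1) \<and> disjoint_family X \<and>
        (\<forall>P x w. finite P \<longrightarrow> 0 \<in> P \<longrightarrow> P \<subseteq> cball 0 1 \<longrightarrow> (\<forall>j. x j \<in> X j \<inter> P) \<longrightarrow> P \<inter> cap u r \<subseteq> range x \<longrightarrow> w \<in> W \<longrightarrow>
          c * r ^ (CARD('d) + 1) \<le> sgn (L \<tau>) *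
          ((a1 * Lp_surface_area p1 (convex hull (insert w P)) + a2 * Lp_surface_area p2 (convex hull (insert w P)))
           - (a1 * Lp_surface_area p1 (convex hull P) + a2 * Lp_surface_area p2 (convex hull P))))"
    proof (intro exI[of _ X] exI[of _ W] conjI allI impI)
      show "X j \<in> sets borel" for j unfolding X_def using cap_map_image_open[OF u r(1) open_ball] by simp
      show "W \<in> sets borel" unfolding W_def using cap_map_image_open[OF u r(1) open_ball] by simp
      show "c * r ^ (CARD('d) + 1) \<le> sgn (L \<tau>) *
          ((a1 * Lp_surface_area p1 (convex hull (insert w P)) + a2 * Lp_surface_area p2 (convex hull (insert w P)))
           - (a1 * Lp_surface_area p1 (convex hull P) + a2 * Lp_surface_area p2 (convex hull P)))"
        if "finite P" "0 \<in> P" "P \<subseteq> cball 0 1" "\<forall>j. x j \<in> X j \<inter> P" "P \<inter> cap u r \<subseteq> range x" "w \<in> W" for P x w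
        by (rule gain[OF that(1-3) _ that(5,6)]) (use that(4) in blast)
    qed (use Xc Wc XW XX Xm Wm in auto)
  qed
qed


section \<open>Void events of a Poisson process\<close>

lemma num_points_eq_0_iff: "num_points X B = 0 \<longleftrightarrow> X \<inter> B = {}"
  by (auto simp: num_points_def emeasure_count_space)

lemma num_points_eq_1_iff: "num_points X B = 1 \<longleftrightarrow> (\<exists>x. X \<inter> B = {x})"
proof
  assume h: "num_points X B = 1"
  then have f: "finite (X \<inter> B)"
    by (auto simp: num_points_def emeasure_count_space split: if_splits)
  then have "of_nat (card (X \<inter> B)) = (of_nat 1 :: ennreal)" using h by (simp add: num_points_def emeasure_count_space)
  then have "card (X \<inter> B) = 1" by (simp only: of_nat_eq_iff)
  then show "\<exists>x. X \<inter> B = {x}" by (auto simp: card_1_singleton_iff)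
qed (auto simp: num_points_def emeasure_count_space)

text \<open>Expresses finiteness of a locally finite configuration through countably many void
  events.\<close>

lemma finite_iff_void_outside:
  assumes "\<And>B. bounded B \<Longrightarrow> finite (X \<inter> B :: 'a::metric_space set)"
  shows "finite X \<longleftrightarrow> (\<exists>n::nat. X \<inter> - cball a (real n) = {})"
proof
  assume "finite X"
  then have "bounded X" by (rule finite_imp_bounded)
  then obtain e where e: "\<And>x. x \<in> X \<Longrightarrow> dist a x \<le> e" using bounded_any_center[of X a] by blast
  obtain n :: nat where "e \<le> real n" using real_arch_simple by blast
  then have "X \<subseteq> cball a (real n)" using e by force
  then show "\<exists>n::nat. X \<inter> - cball a (real n) = {}" by blast
next
  assume "\<exists>n::nat. X \<inter> - cball a (real n) = {}"
  then obtain n :: nat where "X \<subseteq> cball a (real n)" by blast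
  then have "X = X \<inter> cball a (real n)" by blast
  then show "finite X" using assms[of "cball a (real n)"] by (metis bounded_cball)
qed

context poisson_process
begin

definition void_algebra :: "'a set \<Rightarrow> 'w measure" where
  "void_algebra W = sigma (space M) {{\<omega> \<in> space M. \<eta> \<omega> \<inter> B = {}} | B. B \<in> sets borel \<and> B \<inter> W = {}}"

lemma space_void_algebra [simp]: "space (void_algebra W) = space M"
  unfolding void_algebra_def by (intro space_measure_of) auto

lemma sets_void_algebra: "sets (void_algebra W)
    = sigma_sets (space M) {{\<omega> \<in> space M. \<eta> \<omega> \<inter> B = {}} | B. B \<in> sets borel \<and> B \<inter> W = {}}"
  unfolding void_algebra_def by (intro sets_measure_of) auto

lemma void_in_algebra: "B \<in> sets borel \<Longrightarrow> B \<inter> W = {} \<Longrightarrow> {\<omega> \<in> space M. \<eta> \<omega> \<inter> B = {}} \<in> sets (void_algebra W)"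
  unfolding sets_void_algebra by (intro sigma_sets.Basic) blast

lemma num_event: "B \<in> sets borel \<Longrightarrow> {\<omega> \<in> space M. num_points (\<eta> \<omega>) B = k} \<in> events"
  using num_points_measurable[of B] sets_intensity by simp

lemma void_event: "B \<in> sets borel \<Longrightarrow> {\<omega> \<in> space M. \<eta> \<omega> \<inter> B = {}} \<in> events"
  using num_event[of B 0] by (simp add: num_points_eq_0_iff)

lemma void_algebra_events: "sets (void_algebra W) \<subseteq> events"
  unfolding sets_void_algebra by (rule sets.sigma_sets_subset) (auto intro: void_event)

lemma void_algebra_measurable: "f \<in> borel_measurable (void_algebra W) \<Longrightarrow> f \<in> borel_measurable M"
  using void_algebra_events[of W] by (auto simp: measurable_def)

text \<open>Void events are stable under intersection, as the sets in question are united; on these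
  generators the claim is independence of the counts in two disjoint sets.\<close>

lemma indep_void_algebra:
  assumes W: "W \<in> sets borel"
  shows "indep_set (sets (void_algebra W)) (sigma_sets (space M) {{\<omega> \<in> space M. num_points (\<eta> \<omega>) W = k}})"
  unfolding sets_void_algebra
proof (rule indep_set_sigma_sets)
  let ?T = "{\<omega> \<in> space M. num_points (\<eta> \<omega>) W = k}"
  let ?V = "{{\<omega> \<in> space M. \<eta> \<omega> \<inter> B = {}} | B. B \<in> sets borel \<and> B \<inter> W = {}}"
  show "Int_stable ?V"
  proof (rule Int_stableI, clarsimp)
    fix B C :: "'a set" assume "B \<in> sets borel" "B \<inter> W = {}" "C \<in> sets borel" "C \<inter> W = {}"
    then show "\<exists>D. {\<omega> \<in> space M. \<eta> \<omega> \<inter> B = {}} \<inter> {\<omega> \<in> space M. \<eta> \<omega> \<inter> C = {}} = {\<omega> \<in> space M. \<eta> \<omega> \<inter> D = {}}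
        \<and> D \<in> sets borel \<and> D \<inter> W = {}"
      by (intro exI[of _ "B \<union> C"]) auto
  qed
  show "Int_stable {?T}" by (simp add: Int_stable_def)
  show "indep_set ?V {?T}"
    unfolding indep_sets2_eq
  proof (intro conjI ballI)
    show "?V \<subseteq> events" using void_event by auto
    show "{?T} \<subseteq> events" using num_event[OF W] by simp
    fix E T assume "E \<in> ?V" "T \<in> {?T}"
    then obtain B where B: "B \<in> sets borel" "B \<inter> W = {}" "E = {\<omega> \<in> space M. \<eta> \<omega> \<inter> B = {}}" and T: "T = ?T" by blast
    define C where "C i = (if i = 0 then B else W)" for i :: nat
    have ind: "indep_vars (\<lambda>_. borel) (\<lambda>i \<omega>. num_points (\<eta> \<omega>) (C i)) {..<2}"
    proof (rule num_points_indep)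
      show "C i \<in> sets \<mu>" for i using B W by (simp add: C_def sets_intensity)
      show "disjoint_family_on C {..<2}" using B(2) by (auto simp: disjoint_family_on_def C_def)
    qed
    have "prob (\<Inter>i\<in>{..<2}. (\<lambda>\<omega>. num_points (\<eta> \<omega>) (C i)) -` (if i = 0 then {0} else {k}) \<inter> space M)
       = (\<Prod>i\<in>{..<2}. prob ((\<lambda>\<omega>. num_points (\<eta> \<omega>) (C i)) -` (if i = 0 then {0} else {k}) \<inter> space M))"
      by (rule indep_varsD[OF ind]) (auto simp: lessThan_empty_iff)
    moreover have "(\<lambda>\<omega>. num_points (\<eta> \<omega>) (C 0)) -` {0} \<inter> space M = E"
      by (auto simp: B(3) C_def num_points_eq_0_iff)
    moreover have "(\<lambda>\<omega>. num_points (\<eta> \<omega>) (C (Suc 0))) -` {k} \<inter> space M = T"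
      by (auto simp: T C_def)
    ultimately show "prob (E \<inter> T) = prob E * prob T"
      by (simp add: numeral_2_eq_2 lessThan_Suc Int_commute mult.commute)
  qed
qed

lemma expectation_num_points_indep:
  assumes W: "W \<in> sets borel" and H: "H \<in> borel_measurable (void_algebra W)" "integrable M H"
  shows "expectation (\<lambda>\<omega>. H \<omega> * indicator {\<omega> \<in> space M. num_points (\<eta> \<omega>) W = k} \<omega>)
    = expectation H * prob {\<omega> \<in> space M. num_points (\<eta> \<omega>) W = k}"
proof -
  let ?T = "{\<omega> \<in> space M. num_points (\<eta> \<omega>) W = k}"
  have T: "?T \<in> events" by (rule num_event[OF W])
  have "indep_var borel H borel (indicator ?T :: 'w \<Rightarrow> real)"
    unfolding indep_var_eq
  proof (intro conjI)
    show "random_variable borel H" by (rule void_algebra_measurable[OF H(1)])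
    show "random_variable borel (indicator ?T :: 'w \<Rightarrow> real)" using T by simp
    have 1: "sigma_sets (space M) {H -` A \<inter> space M |A. A \<in> sets borel} \<subseteq> sets (void_algebra W)"
    proof -
      have "{H -` A \<inter> space M |A. A \<in> sets borel} \<subseteq> sets (void_algebra W)"
        using measurable_sets[OF H(1)] by auto
      then show ?thesis using sets.sigma_sets_subset[of _ "void_algebra W"] by simp
    qed
    have 2: "sigma_sets (space M) {indicator ?T -` A \<inter> space M |A. A \<in> sets (borel :: real measure)} \<subseteq> sigma_sets (space M) {?T}"
    proof (rule sigma_sets_mono, safe)
      fix A :: "real set"
      have "(indicator ?T :: 'w \<Rightarrow> real) -` A \<inter> space M =
        (if 1 \<in> A then ?T else {}) \<union> (if 0 \<in> A then space M - ?T else {})"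
      proof (rule set_eqI)
        fix x
        show "x \<in> (indicator ?T :: 'w \<Rightarrow> real) -` A \<inter> space M \<longleftrightarrow>
          x \<in> (if 1 \<in> A then ?T else {}) \<union> (if 0 \<in> A then space M - ?T else {})"
          by (cases "num_points (\<eta> x) W = k") (auto simp: indicator_def)
      qed
      also have "\<dots> \<in> sigma_sets (space M) {?T}"
      proof -
        have "?T \<in> sigma_sets (space M) {?T}" by (rule sigma_sets.Basic) simp
        then show ?thesis
          by (cases "1 \<in> A"; cases "0 \<in> A";
            simp only: if_True if_False; intro sigma_sets_Un sigma_sets.Compl sigma_sets.Empty)
      qed
      finally show "(indicator ?T :: 'w \<Rightarrow> real) -` A \<inter> space M \<in> sigma_sets (space M) {?T}" .
    qed
    show "indep_set (sigma_sets (space M) {H -` A \<inter> space M |A. A \<in> sets borel})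
       (sigma_sets (space M) {indicator ?T -` A \<inter> space M |A. A \<in> sets (borel :: real measure)})"
    proof -
      let ?A = "sigma_sets (space M) {H -` A \<inter> space M |A. A \<in> sets borel}"
      let ?B = "sigma_sets (space M) {indicator ?T -` A \<inter> space M |A. A \<in> sets (borel :: real measure)}"
      have i: "sets (void_algebra W) \<subseteq> events \<and> sigma_sets (space M) {?T} \<subseteq> events \<and>
         (\<forall>a\<in>sets (void_algebra W). \<forall>b\<in>sigma_sets (space M) {?T}. prob (a \<inter> b) = prob a * prob b)"
        using indep_void_algebra[OF W, of k] unfolding indep_sets2_eq .
      show ?thesis unfolding indep_sets2_eq
      proof (intro conjI ballI)
        show "?A \<subseteq> events" by (rule order_trans[OF 1 conjunct1[OF i]])
        show "?B \<subseteq> events" by (rule order_trans[OF 2 conjunct1[OF conjunct2[OF i]]])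
        fix a b assume a: "a \<in> ?A" and b: "b \<in> ?B"
        show "prob (a \<inter> b) = prob a * prob b"
          by (rule bspec[OF bspec[OF conjunct2[OF conjunct2[OF i]] subsetD[OF 1 a]] subsetD[OF 2 b]])
      qed
    qed
  qed
  then have "expectation (\<lambda>\<omega>. H \<omega> * indicator ?T \<omega>) = expectation H * expectation (indicator ?T)"
    using H(2) T by (intro indep_var_lebesgue_integral) (auto intro!: integrable_real_indicator simp: emeasure_eq_measure)
  then show ?thesis using T by simp
qed

end

text \<open>There is more than one point in \<open>X\<close> exactly if two disjoint sets of a
  countable basis are both hit within \<open>X\<close>, by the Hausdorff property; the event is thus
  built from countably many void events.\<close>

lemma single_in_void_algebra:
  fixes \<eta> :: "'w \<Rightarrow> 'a::euclidean_space set"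
  assumes pp: "poisson_process M \<mu> \<eta>" and X: "X \<in> sets borel" "X \<inter> W = {}"
  shows "{\<omega> \<in> space M. \<exists>x. \<eta> \<omega> \<inter> X = {x}} \<in> sets (poisson_process.void_algebra M \<eta> W)"
proof -
  interpret poisson_process M \<mu> \<eta> by (rule pp)
  obtain \<B> :: "'a set set" where \<B>: "countable \<B>" "topological_basis \<B>"
    using ex_countable_basis by blast
  let ?v = "\<lambda>B. {\<omega> \<in> space M. \<eta> \<omega> \<inter> B = {}}"
  have op: "U \<in> \<B> \<Longrightarrow> open U" for U using \<B>(2) topological_basis_open by blast
  have eq: "{\<omega> \<in> space M. \<exists>x. \<eta> \<omega> \<inter> X = {x}} = space M - (?v X \<union>
     (\<Union>p\<in>{p \<in> \<B> \<times> \<B>. fst p \<inter> snd p = {}}. (space M - ?v (X \<inter> fst p)) \<inter> (space M - ?v (X \<inter> snd p))))"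
    (is "?L = ?R")
  proof (intro equalityI subsetI)
    fix \<omega> assume "\<omega> \<in> ?L"
    then obtain x where x: "\<omega> \<in> space M" "\<eta> \<omega> \<inter> X = {x}" by blast
    have "\<omega> \<notin> ?v X" using x(2) by (simp add: Int_commute)
    moreover have "\<omega> \<notin> (space M - ?v (X \<inter> fst p)) \<inter> (space M - ?v (X \<inter> snd p))"
      if "p \<in> {p \<in> \<B> \<times> \<B>. fst p \<inter> snd p = {}}" for p
    proof
      assume "\<omega> \<in> (space M - ?v (X \<inter> fst p)) \<inter> (space M - ?v (X \<inter> snd p))"
      then obtain y z where "y \<in> \<eta> \<omega> \<inter> (X \<inter> fst p)" "z \<in> \<eta> \<omega> \<inter> (X \<inter> snd p)" using x(1) by blast
      moreover from this have "y = x" "z = x" using x(2) by blast+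
      ultimately show False using that by blast
    qed
    ultimately show "\<omega> \<in> ?R" using x(1) by blast
  next
    fix \<omega> assume w: "\<omega> \<in> ?R"
    then obtain x where x: "x \<in> \<eta> \<omega> \<inter> X" by blast
    have "y = x" if y: "y \<in> \<eta> \<omega> \<inter> X" for y
    proof (rule ccontr)
      assume "y \<noteq> x"
      then obtain U V where UV: "open U" "open V" "y \<in> U" "x \<in> V" "U \<inter> V = {}" using hausdorff by metis
      obtain U' where U': "U' \<in> \<B>" "y \<in> U'" "U' \<subseteq> U" using topological_basisE[OF \<B>(2) UV(1,3)] by blast
      obtain V' where V': "V' \<in> \<B>" "x \<in> V'" "V' \<subseteq> V" using topological_basisE[OF \<B>(2) UV(2,4)] by blast
      have "(U', V') \<in> {p \<in> \<B> \<times> \<B>. fst p \<inter> snd p = {}}" using U' V' UV(5) by auto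
      moreover have "\<omega> \<in> (space M - ?v (X \<inter> fst (U', V'))) \<inter> (space M - ?v (X \<inter> snd (U', V')))"
        using w U' V' x y by auto
      ultimately show False using w by blast
    qed
    then have "\<eta> \<omega> \<inter> X = {x}" using x by blast
    then show "\<omega> \<in> ?L" using w by blast
  qed
  have vU: "?v (X \<inter> U) \<in> sets (void_algebra W)" if "U \<in> \<B>" for U
    using X op[OF that] by (intro void_in_algebra) auto
  have vX: "?v X \<in> sets (void_algebra W)" using X by (intro void_in_algebra)
  have sp: "space M \<in> sets (void_algebra W)" using sets.top[of "void_algebra W"] by simp
  have cnt: "countable {p \<in> \<B> \<times> \<B>. fst p \<inter> snd p = {}}"
    by (rule countable_subset[OF Collect_subset countable_SIGMA[OF \<B>(1) \<B>(1)]])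
  have "(space M - ?v (X \<inter> fst p)) \<inter> (space M - ?v (X \<inter> snd p)) \<in> sets (void_algebra W)"
    if "p \<in> {p \<in> \<B> \<times> \<B>. fst p \<inter> snd p = {}}" for p
    using that by (intro sets.Int sets.Diff sp vU) (simp_all add: mem_Times_iff)
  then show ?thesis unfolding eq by (intro sets.Diff sets.Un sp vX sets.countable_UN''[OF cnt])
qed

lemma Lp_surface_area_singleton_zero:
  assumes "2 \<le> CARD('d)"
  shows "Lp_surface_area p (convex hull {0 :: real^'d}) = 0"
proof -
  have "F \<notin> facets (convex hull {0 :: real^'d})" for F
  proof
    assume "F \<in> facets (convex hull {0 :: real^'d})"
    then have "F \<subseteq> {0}" and dim: "aff_dim F = int CARD('d) - 1"
      using face_of_imp_subset[of F "convex hull {0}"] by (simp_all add: facets_def)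
    then have "aff_dim F \<le> aff_dim {0 :: real^'d}" by (intro aff_dim_subset)
    then show False using dim assms by simp
  qed
  then have "facets (convex hull {0 :: real^'d}) = {}" by blast
  then show ?thesis by (simp add: Lp_surface_area_def)
qed

lemma Lp_surface_area_infinite:
  fixes X :: "(real^'d) set"
  assumes lf: "\<And>B. bounded B \<Longrightarrow> finite (X \<inter> B)" and inf: "infinite X"
  shows "Lp_surface_area p (convex hull (insert 0 X)) = 0"
proof -
  have "\<not> polytope (convex hull (insert 0 X))"
  proof
    assume "polytope (convex hull (insert 0 X))"
    then have "bounded (convex hull (insert 0 X))" by (rule polytope_imp_bounded)
    then have "bounded X" using hull_subset[of "insert 0 X" convex] bounded_subset by blast
    then show False using lf[of X] inf by simp
  qed
  then show ?thesis by (simp add: Lp_surface_area_def)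
qed

text \<open>Configurations that are infinite outside \<open>W\<close> are replaced by the empty one.
  The value stays 0: an infinite locally finite set does not span a polytope, and in dimension at
  least 2 a single point has no facets.\<close>

lemma surface_area_void_measurable:
  fixes \<eta> :: "'w \<Rightarrow> (real^'d) set"
  assumes dim: "2 \<le> CARD('d)" and pp: "poisson_process M \<mu> \<eta>" and W: "W \<in> sets borel"
  shows "(\<lambda>\<omega>. Lp_surface_area p (convex hull (insert 0 (\<eta> \<omega> - W)))) \<in> borel_measurable (poisson_process.void_algebra M \<eta> W)"
proof -
  interpret poisson_process M \<mu> \<eta> by (rule pp)
  have lf: "finite ((\<eta> \<omega> - W) \<inter> B)" if "\<omega> \<in> space M" "bounded B" for \<omega> B
    using locally_finite[OF that] by (rule finite_subset[rotated]) auto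
  define X where "X \<omega> = (if finite (\<eta> \<omega> - W) then \<eta> \<omega> - W else {})" for \<omega>
  let ?v = "\<lambda>B. {\<omega> \<in> space M. \<eta> \<omega> \<inter> B = {}}"
  have fin: "{\<omega> \<in> space M. finite (\<eta> \<omega> - W)} \<in> sets (void_algebra W)"
  proof -
    have "{\<omega> \<in> space M. finite (\<eta> \<omega> - W)} = (\<Union>n. ?v (- cball 0 (real n) - W))"
    proof -
      have "finite (\<eta> \<omega> - W) \<longleftrightarrow> (\<exists>n. \<eta> \<omega> \<inter> (- cball 0 (real n) - W) = {})" if "\<omega> \<in> space M" for \<omega>
      proof -
        have "(\<eta> \<omega> - W) \<inter> - cball 0 (real n) = \<eta> \<omega> \<inter> (- cball 0 (real n) - W)" for n by blast
        then show ?thesis using finite_iff_void_outside[OF lf[OF that], of 0] by (simp only:)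
      qed
      then show ?thesis by blast
    qed
    also have "\<dots> \<in> sets (void_algebra W)"
      using W by (intro sets.countable_UN void_in_algebra image_subsetI) auto
    finally show ?thesis .
  qed
  have "(\<lambda>\<omega>. Lp_surface_area p (convex hull (insert 0 (X \<omega>)))) \<in> borel_measurable (void_algebra W)"
  proof (rule Lp_surface_area_measurable)
    show "finite (X \<omega>)" for \<omega> by (simp add: X_def)
    fix B :: "(real^'d) set" assume B: "B \<in> sets borel"
    have "{\<omega> \<in> space (void_algebra W). X \<omega> \<inter> B = {}} = ?v (B - W) \<union> (space M - {\<omega> \<in> space M. finite (\<eta> \<omega> - W)})"
      by (auto simp: X_def split: if_splits)
    also have "\<dots> \<in> sets (void_algebra W)"
      using B W fin sets.top[of "void_algebra W"] by (intro sets.Un sets.Diff void_in_algebra) auto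
    finally show "{\<omega> \<in> space (void_algebra W). X \<omega> \<inter> B = {}} \<in> sets (void_algebra W)" .
  qed
  moreover have "Lp_surface_area p (convex hull (insert 0 (X \<omega>))) = Lp_surface_area p (convex hull (insert 0 (\<eta> \<omega> - W)))"
    if "\<omega> \<in> space (void_algebra W)" for \<omega>
    using that Lp_surface_area_singleton_zero[OF dim, of p] Lp_surface_area_infinite[of "\<eta> \<omega> - W" p] lf[of \<omega>] by (auto simp: X_def)
  ultimately show ?thesis using measurable_cong[of "void_algebra W" "\<lambda>\<omega>. Lp_surface_area p (convex hull (insert 0 (X \<omega>)))"
        "\<lambda>\<omega>. Lp_surface_area p (convex hull (insert 0 (\<eta> \<omega> - W)))" borel] by blast
qed


section \<open>Orthogonal statistics of disjoint caps\<close>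

text \<open>Let \<open>S\<close> be the sum of the \<open>G i\<close>. The expected square of
  \<open>Z - expectation Z - t * \<sigma> * S\<close> is nonnegative; orthogonality bounds the
  second moment of \<open>S\<close> by \<open>card I\<close> times the square of \<open>B\<close>,
  and \<open>t\<close> maximises the resulting quadratic lower bound.\<close>

lemma variance_lower_bound:
  fixes Z :: "'w \<Rightarrow> real" and G :: "'i \<Rightarrow> 'w \<Rightarrow> real"
  assumes M: "prob_space M" and Z: "Z \<in> borel_measurable M" "AE \<omega> in M. \<bar>Z \<omega>\<bar> \<le> K"
    and I: "finite I" and G: "\<And>i. i \<in> I \<Longrightarrow> G i \<in> borel_measurable M" "\<And>i \<omega>. i \<in> I \<Longrightarrow> \<bar>G i \<omega>\<bar> \<le> B" and B: "0 < B"
    and mean: "\<And>i. i \<in> I \<Longrightarrow> integral\<^sup>L M (G i) = 0"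
    and orth: "\<And>i j. i \<in> I \<Longrightarrow> j \<in> I \<Longrightarrow> i \<noteq> j \<Longrightarrow> integral\<^sup>L M (\<lambda>\<omega>. G i \<omega> * G j \<omega>) = 0"
    and cov: "\<And>i. i \<in> I \<Longrightarrow> g \<le> \<sigma> * integral\<^sup>L M (\<lambda>\<omega>. Z \<omega> * G i \<omega>)" and \<sigma>: "\<bar>\<sigma>\<bar> = 1" and g: "0 \<le> g"
  shows "real (card I) * g\<^sup>2 / B\<^sup>2 \<le> prob_space.variance M Z"
proof -
  interpret prob_space M by (rule M)
  define S where "S \<omega> = (\<Sum>i\<in>I. G i \<omega>)" for \<omega>
  define t where "t = g / B\<^sup>2"
  let ?E = "expectation Z"
  note [measurable] = Z(1)
  have Gm [measurable]: "i \<in> I \<Longrightarrow> G i \<in> borel_measurable M" for i by (rule G(1))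
  have iZ: "integrable M Z" using Z by (intro integrable_const_bound[of _ K]) auto
  have iG: "integrable M (G i)" if "i \<in> I" for i using G(2)[OF that] Gm[OF that] by (intro integrable_const_bound[of _ B]) auto
  have iGG: "integrable M (\<lambda>\<omega>. G i \<omega> * G j \<omega>)" if "i \<in> I" "j \<in> I" for i j
    using abs_mult_le[OF G(2)[OF that(1)] G(2)[OF that(2)]] Gm[OF that(1)] Gm[OF that(2)]
    by (intro integrable_const_bound[of _ "B * B"]) auto
  have iZG: "integrable M (\<lambda>\<omega>. Z \<omega> * G i \<omega>)" if "i \<in> I" for i
  proof (rule integrable_const_bound[of _ "K * B"])
    show "AE \<omega> in M. norm (Z \<omega> * G i \<omega>) \<le> K * B"
      using Z(2) by eventually_elim (use abs_mult_le[OF _ G(2)[OF that]] in auto)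
  qed (use Gm[OF that] in measurable)
  have iZZ: "integrable M (\<lambda>\<omega>. (Z \<omega>)\<^sup>2)"
  proof (rule integrable_const_bound[of _ "K * K"])
    show "AE \<omega> in M. norm ((Z \<omega>)\<^sup>2) \<le> K * K"
      using Z(2)
    proof eventually_elim
      case (elim \<omega>)
      then show ?case using abs_mult_le[OF elim elim] by (simp add: power2_eq_square)
    qed
  qed simp
  have ES: "expectation S = 0" unfolding S_def using iG mean by (subst Bochner_Integration.integral_sum) auto
  have iS: "integrable M S" unfolding S_def using iG by (intro Bochner_Integration.integrable_sum) auto
  have iZS: "integrable M (\<lambda>\<omega>. Z \<omega> * S \<omega>)" unfolding S_def sum_distrib_left using iZG by (intro Bochner_Integration.integrable_sum) auto
  have SS: "(S \<omega>)\<^sup>2 = (\<Sum>i\<in>I. \<Sum>j\<in>I. G i \<omega> * G j \<omega>)" for \<omega> by (simp add: S_def power2_eq_square sum_product)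
  have iSS: "integrable M (\<lambda>\<omega>. (S \<omega>)\<^sup>2)" unfolding SS using iGG by (intro Bochner_Integration.integrable_sum) auto
  have "expectation (\<lambda>\<omega>. (S \<omega>)\<^sup>2) = (\<Sum>i\<in>I. \<Sum>j\<in>I. expectation (\<lambda>\<omega>. G i \<omega> * G j \<omega>))"
    unfolding SS using iGG by (simp add: Bochner_Integration.integral_sum)
  also have "\<dots> = (\<Sum>i\<in>I. expectation (\<lambda>\<omega>. G i \<omega> * G i \<omega>))"
  proof (rule sum.cong[OF refl])
    fix i assume i: "i \<in> I"
    have "(\<Sum>j\<in>I - {i}. expectation (\<lambda>\<omega>. G i \<omega> * G j \<omega>)) = 0" using orth[OF i] by (intro sum.neutral) auto
    then show "(\<Sum>j\<in>I. expectation (\<lambda>\<omega>. G i \<omega> * G j \<omega>)) = expectation (\<lambda>\<omega>. G i \<omega> * G i \<omega>)"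
      using I i by (subst sum.remove[of _ i]) auto
  qed
  also have "\<dots> \<le> (\<Sum>i\<in>I. B * B)"
  proof (rule sum_mono)
    fix i assume i: "i \<in> I"
    have "G i \<omega> * G i \<omega> \<le> B * B" for \<omega> using abs_mult_le[OF G(2)[OF i] G(2)[OF i], of \<omega> \<omega>] by linarith
    then have "expectation (\<lambda>\<omega>. G i \<omega> * G i \<omega>) \<le> expectation (\<lambda>_. B * B)" using iGG[OF i i] by (intro integral_mono) auto
    then show "expectation (\<lambda>\<omega>. G i \<omega> * G i \<omega>) \<le> B * B" by (simp add: prob_space)
  qed
  also have "\<dots> = real (card I) * B\<^sup>2" by (simp add: power2_eq_square)
  finally have ESS: "expectation (\<lambda>\<omega>. (S \<omega>)\<^sup>2) \<le> real (card I) * B\<^sup>2" .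
  have "expectation (\<lambda>\<omega>. Z \<omega> * S \<omega>) = (\<Sum>i\<in>I. expectation (\<lambda>\<omega>. Z \<omega> * G i \<omega>))"
    unfolding S_def sum_distrib_left using iZG by (simp add: Bochner_Integration.integral_sum)
  then have "\<sigma> * expectation (\<lambda>\<omega>. Z \<omega> * S \<omega>) = (\<Sum>i\<in>I. \<sigma> * expectation (\<lambda>\<omega>. Z \<omega> * G i \<omega>))" by (simp add: sum_distrib_left)
  also have "\<dots> \<ge> (\<Sum>i\<in>I. g)" using cov by (intro sum_mono) auto
  finally have EZS: "real (card I) * g \<le> \<sigma> * expectation (\<lambda>\<omega>. Z \<omega> * S \<omega>)" by simp
  have s2: "\<sigma> * \<sigma> = 1" using \<sigma> by (metis abs_mult_self_eq mult_1)
  have t0: "0 \<le> t" using g B by (simp add: t_def)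
  have iV: "integrable M (\<lambda>\<omega>. (Z \<omega> - ?E)\<^sup>2)"
    using iZZ iZ by (simp add: power2_diff)
  have iC: "integrable M (\<lambda>\<omega>. (Z \<omega> - ?E) * S \<omega>)"
    using iZS iS by (simp add: left_diff_distrib)
  have "0 \<le> expectation (\<lambda>\<omega>. (Z \<omega> - ?E - t * \<sigma> * S \<omega>)\<^sup>2)" by (intro Bochner_Integration.integral_nonneg) auto
  also have "(\<lambda>\<omega>. (Z \<omega> - ?E - t * \<sigma> * S \<omega>)\<^sup>2) = (\<lambda>\<omega>. (Z \<omega> - ?E)\<^sup>2 - 2 * (t * \<sigma>) * ((Z \<omega> - ?E) * S \<omega>) + t\<^sup>2 * (S \<omega>)\<^sup>2)"
  proof
    fix \<omega>
    have "(Z \<omega> - ?E - t * \<sigma> * S \<omega>)\<^sup>2 = (Z \<omega> - ?E)\<^sup>2 - 2 * (t * \<sigma>) * ((Z \<omega> - ?E) * S \<omega>) + t\<^sup>2 * (\<sigma> * \<sigma>) * (S \<omega>)\<^sup>2"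
      by (simp add: power2_eq_square algebra_simps)
    then show "(Z \<omega> - ?E - t * \<sigma> * S \<omega>)\<^sup>2 = (Z \<omega> - ?E)\<^sup>2 - 2 * (t * \<sigma>) * ((Z \<omega> - ?E) * S \<omega>) + t\<^sup>2 * (S \<omega>)\<^sup>2" by (simp add: s2)
  qed
  also have "expectation \<dots> = variance Z - 2 * (t * \<sigma>) * expectation (\<lambda>\<omega>. (Z \<omega> - ?E) * S \<omega>) + t\<^sup>2 * expectation (\<lambda>\<omega>. (S \<omega>)\<^sup>2)"
    using iV iC iSS by simp
  also have "expectation (\<lambda>\<omega>. (Z \<omega> - ?E) * S \<omega>) = expectation (\<lambda>\<omega>. Z \<omega> * S \<omega>)"
    using iZS iS ES by (simp add: left_diff_distrib)
  finally have "2 * t * (\<sigma> * expectation (\<lambda>\<omega>. Z \<omega> * S \<omega>)) - t\<^sup>2 * expectation (\<lambda>\<omega>. (S \<omega>)\<^sup>2) \<le> variance Z" by (simp add: mult_ac)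
  moreover have "2 * t * (real (card I) * g) \<le> 2 * t * (\<sigma> * expectation (\<lambda>\<omega>. Z \<omega> * S \<omega>))" using EZS t0 by (intro mult_left_mono) auto
  moreover have "t\<^sup>2 * expectation (\<lambda>\<omega>. (S \<omega>)\<^sup>2) \<le> t\<^sup>2 * (real (card I) * B\<^sup>2)" using ESS by (intro mult_left_mono) auto
  moreover have "2 * t * (real (card I) * g) - t\<^sup>2 * (real (card I) * B\<^sup>2) = real (card I) * g\<^sup>2 / B\<^sup>2"
    using B by (simp add: t_def power2_eq_square field_simps)
  ultimately show ?thesis by linarith
qed

section \<open>Packing disjoint caps\<close>

text \<open>A point \<open>p\<close> of the cap at \<open>v\<close> satisfies \<open>(norm (p -
  v))\<^sup>2 \<le> 2 - 2 * (v \<bullet> p) \<le> 4 * r\<^sup>2\<close>, so caps have radius at most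
  \<open>2 * r\<close> around their apex.\<close>

lemma cap_disjoint:
  fixes u u' :: "'a::euclidean_space"
  assumes "norm u = 1" "norm u' = 1" "0 < r" "4 * r < dist u u'"
  shows "cap u r \<inter> cap u' r = {}"
proof -
  have near: "dist p v \<le> 2 * r" if "norm v = 1" "p \<in> cap v r" for p v :: 'a
  proof -
    have "(norm (p - v))\<^sup>2 = (norm p)\<^sup>2 + (norm v)\<^sup>2 - 2 * (v \<bullet> p)"
      unfolding power2_norm_eq_inner by (simp add: inner_diff_left inner_diff_right inner_commute)
    also have "(norm p)\<^sup>2 \<le> 1" using that power_mono[of "norm p" 1 2] by (simp add: cap_def)
    finally have "(norm (p - v))\<^sup>2 \<le> (2 * r)\<^sup>2" using that by (simp add: cap_def power_mult_distrib)
    then have "norm (p - v) \<le> 2 * r" by (rule power2_le_imp_le) (use assms(3) in simp)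
    then show ?thesis by (simp add: dist_norm)
  qed
  have "\<not> (p \<in> cap u r \<and> p \<in> cap u' r)" for p
  proof
    assume p: "p \<in> cap u r \<and> p \<in> cap u' r"
    have "dist p u \<le> 2 * r" by (rule near[OF assms(1) conjunct1[OF p]])
    moreover have "dist p u' \<le> 2 * r" by (rule near[OF assms(2) conjunct2[OF p]])
    moreover have "dist u u' \<le> dist p u + dist p u'" by (rule dist_triangle3)
    ultimately show False using assms(4) by linarith
  qed
  then show ?thesis by blast
qed

text \<open>Greedy choice by volume. The hypothesis says that k - 1 balls of radius
  \<open>6 * r\<close> have total volume below the share \<open>r\<close> of the unit ball, while
  the shell between radii \<open>1 - r\<close> and 1 has at least that share. An uncovered point of
  the shell moves by less than \<open>r\<close> when projected to the sphere.\<close>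

lemma separated_set_exists:
  fixes r :: real
  assumes r: "0 < r" "r \<le> 1" and k: "real k * (6 * r) ^ CARD('d) < r + (6 * r) ^ CARD('d)"
  shows "\<exists>U :: (real^'d) set. finite U \<and> card U = k \<and> (\<forall>u\<in>U. norm u = 1) \<and> pairwise (\<lambda>u v. 4 * r < dist u v) U"
  using k
proof (induction k)
  case 0
  then show ?case by (intro exI[of _ "{}"]) auto
next
  case (Suc k)
  let ?\<omega> = "measure lborel (ball 0 1 :: (real^'d) set)"
  have \<omega>: "0 < ?\<omega>" by (simp add: content_ball_pos)
  have pos: "0 \<le> (6 * r) ^ CARD('d)" using r by simp
  have kr: "real k * (6 * r) ^ CARD('d) < r" using Suc.prems by (simp add: distrib_right)
  then have "real k * (6 * r) ^ CARD('d) < r + (6 * r) ^ CARD('d)" using pos by linarith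
  then obtain U :: "(real^'d) set" where U: "finite U" "card U = k" "\<And>u. u \<in> U \<Longrightarrow> norm u = 1" "pairwise (\<lambda>u v. 4 * r < dist u v) U"
    using Suc.IH by blast
  have "\<not> (ball 0 1 \<subseteq> cball 0 (1 - r) \<union> (\<Union>u\<in>U. ball u (6 * r)) :: bool)"
  proof
    assume sub: "ball (0 :: real^'d) 1 \<subseteq> cball 0 (1 - r) \<union> (\<Union>u\<in>U. ball u (6 * r))"
    have m1: "cball (0 :: real^'d) (1 - r) \<in> lmeasurable" "(\<Union>u\<in>U. ball u (6 * r)) \<in> lmeasurable"
      using U(1) by (auto intro!: fmeasurable.finite_UN)
    have "?\<omega> = measure lebesgue (ball (0 :: real^'d) 1)" by (simp add: measure_completion)
    also have "\<dots> \<le> measure lebesgue (cball 0 (1 - r) \<union> (\<Union>u\<in>U. ball u (6 * r)))"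
      using sub m1 by (intro measure_mono_fmeasurable) auto
    also have "\<dots> \<le> measure lebesgue (cball (0 :: real^'d) (1 - r)) + measure lebesgue (\<Union>u\<in>U. ball u (6 * r))"
      using m1 by (intro measure_Un_le) auto
    also have "measure lebesgue (\<Union>u\<in>U. ball u (6 * r)) \<le> (\<Sum>u\<in>U. measure lebesgue (ball u (6 * r)))"
      using U(1) by (intro measure_UNION_le) auto
    also have "\<dots> = (\<Sum>u\<in>U. (6 * r) ^ CARD('d) * ?\<omega>)"
      using content_ball_conv_unit_ball[of "6 * r" "_ :: real^'d"] r by (intro sum.cong) (auto simp: measure_completion)
    also have "\<dots> = real k * (6 * r) ^ CARD('d) * ?\<omega>" by (simp add: U(2))
    also have "measure lebesgue (cball (0 :: real^'d) (1 - r)) = (1 - r) ^ CARD('d) * ?\<omega>"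
      using content_ball_conv_unit_ball[of "1 - r" "0 :: real^'d"] r
      by (simp add: measure_completion content_cball_conv_ball)
    finally have "1 * ?\<omega> \<le> ((1 - r) ^ CARD('d) + real k * (6 * r) ^ CARD('d)) * ?\<omega>" by (simp add: algebra_simps)
    then have "1 \<le> (1 - r) ^ CARD('d) + real k * (6 * r) ^ CARD('d)" using \<omega> by (rule mult_right_le_imp_le)
    moreover have "(1 - r) ^ CARD('d) \<le> (1 - r) ^ 1"
      using r by (intro power_decreasing) (auto simp: Suc_leI)
    ultimately show False using kr by simp
  qed
  then obtain x :: "real^'d" where x0: "x \<in> ball 0 1" "x \<notin> cball 0 (1 - r)" "x \<notin> (\<Union>u\<in>U. ball u (6 * r))" by blast
  have x: "norm x < 1" "1 - r < norm x" using x0(1,2) by auto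
  have xU: "6 * r \<le> dist u x" if "u \<in> U" for u using x0(3) that by (meson UN_I mem_ball not_le)
  have nx: "0 < norm x" using x r by linarith
  define y where "y = x /\<^sub>R norm x"
  have y1: "norm y = 1" using nx by (simp add: y_def)
  have "x - y = (norm x - 1) *\<^sub>R y" using nx by (simp add: y_def algebra_simps)
  then have xy: "dist x y < r" using x y1 by (simp add: dist_norm)
  have far: "4 * r < dist u y" if "u \<in> U" for u
    using xU[OF that] xy dist_triangle[of u x y] r dist_commute[of x y] by linarith
  then have "y \<notin> U" using r by fastforce
  then show ?case
    using U y1 far by (intro exI[of _ "insert y U"]) (auto simp: pairwise_insert dist_commute)
qed

lemma cap_packing:
  fixes r :: real
  assumes r: "0 < r" "r \<le> 1"
  obtains U :: "(real^'d) set" where "finite U" "\<And>u. u \<in> U \<Longrightarrow> norm u = 1"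
    "\<And>u v. u \<in> U \<Longrightarrow> v \<in> U \<Longrightarrow> u \<noteq> v \<Longrightarrow> cap u r \<inter> cap v r = {}" "r / (6 * r) ^ CARD('d) \<le> real (card U)"
proof -
  let ?q = "r / (6 * r) ^ CARD('d)"
  have pos: "0 < (6 * r) ^ CARD('d)" using r by simp
  define n where "n = nat \<lceil>?q\<rceil>"
  have q0: "0 \<le> ?q" using r by simp
  have n: "?q \<le> real n" "real n < ?q + 1" using q0 by (simp_all add: n_def) linarith+
  have "real n * (6 * r) ^ CARD('d) < (?q + 1) * (6 * r) ^ CARD('d)" using n(2) pos by (rule mult_strict_right_mono)
  also have "\<dots> = r + (6 * r) ^ CARD('d)" using pos by (simp add: distrib_right)
  finally have lt: "real n * (6 * r) ^ CARD('d) < r + (6 * r) ^ CARD('d)" .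
  obtain U :: "(real^'d) set" where U0: "finite U \<and> card U = n \<and> (\<forall>u\<in>U. norm u = 1) \<and> pairwise (\<lambda>u v. 4 * r < dist u v) U"
    using separated_set_exists[OF r lt] by (rule exE)
  then have U: "finite U" "card U = n" "\<And>u. u \<in> U \<Longrightarrow> norm u = 1" "pairwise (\<lambda>u v. 4 * r < dist u v) U"
    by auto
  have "cap u r \<inter> cap v r = {}" if "u \<in> U" "v \<in> U" "u \<noteq> v" for u v
    using U(4) that by (intro cap_disjoint[OF U(3) U(3) r(1)]) (auto simp: pairwise_def)
  then show thesis using n(1) by (intro that[OF U(1) U(3)]) (auto simp: U(2))
qed

section \<open>The Poisson process in the ball and its cap statistics\<close>

lemma ball_intensity_measure:
  fixes B :: "'a::euclidean_space set"
  assumes "B \<in> sets borel" "0 \<le> s"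
  shows "emeasure (ball_intensity s) B = ennreal (s * measure lborel (B \<inter> cball 0 1))"
    "measure (ball_intensity s) B = s * measure lborel (B \<inter> cball 0 1)"
proof -
  have fin: "emeasure lborel (B \<inter> cball 0 1) = ennreal (measure lborel (B \<inter> cball 0 1))"
  proof (rule emeasure_eq_ennreal_measure)
    have "bounded (B \<inter> cball 0 1)" using bounded_cball bounded_subset by blast
    then show "emeasure lborel (B \<inter> cball 0 1) \<noteq> top" using emeasure_bounded_finite[of "B \<inter> cball 0 1"] by simp
  qed
  have "emeasure (ball_intensity s) B = (\<integral>\<^sup>+x. ennreal (s * indicator (cball 0 1) x) * indicator B x \<partial>lborel)"
    unfolding ball_intensity_def
    using assms(1) by (intro emeasure_density measurable_compose[OF _ measurable_ennreal] borel_measurable_times borel_measurable_indicator) auto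
  also have "\<dots> = (\<integral>\<^sup>+x. ennreal s * indicator (B \<inter> cball 0 1) x \<partial>lborel)"
    by (intro nn_integral_cong) (auto simp: indicator_def)
  also have "\<dots> = ennreal s * emeasure lborel (B \<inter> cball 0 1)" using assms(1) by (intro nn_integral_cmult_indicator) auto
  finally show 1: "emeasure (ball_intensity s) B = ennreal (s * measure lborel (B \<inter> cball 0 1))"
    unfolding fin using assms(2) by (simp add: ennreal_mult)
  show "measure (ball_intensity s) B = s * measure lborel (B \<inter> cball 0 1)"
    unfolding measure_def 1 using assms(2) by simp
qed

locale ball_poisson = poisson_process M "ball_intensity s" \<eta>
  for M :: "'w measure" and s :: real and \<eta> :: "'w \<Rightarrow> (real^'d) set" +
  assumes s: "0 \<le> s"
begin

lemma prob_num_points: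
  assumes B: "B \<in> sets borel"
  shows "prob {\<omega> \<in> space M. num_points (\<eta> \<omega>) B = of_nat k} =
    (s * measure lborel (B \<inter> cball 0 1)) ^ k / fact k * exp (- (s * measure lborel (B \<inter> cball 0 1)))"
  using num_points_poisson[of B k] B ball_intensity_measure[OF B s] sets_intensity by simp

lemma AE_in_ball: "AE \<omega> in M. \<eta> \<omega> \<subseteq> cball 0 1"
proof -
  let ?C = "- cball 0 1 :: (real^'d) set"
  have "prob {\<omega> \<in> space M. num_points (\<eta> \<omega>) ?C = of_nat 0} = 1"
    by (subst prob_num_points) auto
  then have "prob {\<omega> \<in> space M. \<eta> \<omega> \<inter> ?C = {}} = 1" by (simp add: num_points_eq_0_iff)
  then have "AE \<omega> in M. \<omega> \<in> {\<omega> \<in> space M. \<eta> \<omega> \<inter> ?C = {}}" using prob_eq_1[OF void_event[of ?C]] by simp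
  then show ?thesis by eventually_elim auto
qed

lemma prob_exactly:
  fixes B :: "'i \<Rightarrow> (real^'d) set" and R :: "(real^'d) set"
  assumes J: "finite J" and B: "\<And>j. j \<in> J \<Longrightarrow> B j \<in> sets borel" "\<And>j. j \<in> J \<Longrightarrow> B j \<subseteq> cball 0 1"
    and R: "R \<in> sets borel" "R \<subseteq> cball 0 1" and disj: "disjoint_family_on B J" "\<And>j. j \<in> J \<Longrightarrow> B j \<inter> R = {}"
  shows "prob {\<omega> \<in> space M. (\<forall>j\<in>J. num_points (\<eta> \<omega>) (B j) = 1) \<and> \<eta> \<omega> \<inter> R = {}}
    = (\<Prod>j\<in>J. s * measure lborel (B j) * exp (- (s * measure lborel (B j)))) * exp (- (s * measure lborel R))"
proof -
  let ?n = "card J"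
  obtain f where f: "bij_betw f {..<?n} J" using ex_bij_betw_nat_finite[OF J] by (auto simp: atLeast0LessThan)
  define C where "C i = (if i < ?n then B (f i) else R)" for i
  have fJ: "f i \<in> J" if "i < ?n" for i using f that by (auto simp: bij_betw_def)
  have inj: "f i \<noteq> f j" if "i < ?n" "j < ?n" "i \<noteq> j" for i j using f that by (auto simp: bij_betw_def inj_on_def)
  have ind: "indep_vars (\<lambda>_. borel) (\<lambda>i \<omega>. num_points (\<eta> \<omega>) (C i)) {..<Suc ?n}"
  proof (rule num_points_indep)
    show "C i \<in> sets (ball_intensity s)" if "i < Suc ?n" for i using B(1)[OF fJ] R by (auto simp: C_def sets_intensity)
    show "disjoint_family_on C {..<Suc ?n}"
      unfolding disjoint_family_on_def
    proof (intro ballI impI)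
      fix i j assume ij: "i \<in> {..<Suc ?n}" "j \<in> {..<Suc ?n}" "i \<noteq> j"
      show "C i \<inter> C j = {}"
      proof (cases "i < ?n"; cases "j < ?n")
        assume "i < ?n" "j < ?n"
        then show ?thesis using disj(1) inj[of i j] fJ ij by (auto simp: C_def disjoint_family_on_def)
      next
        assume "i < ?n" "\<not> j < ?n" then show ?thesis using disj(2)[OF fJ] by (simp add: C_def)
      next
        assume "\<not> i < ?n" "j < ?n" then show ?thesis using disj(2)[OF fJ] by (simp add: C_def Int_commute)
      next
        assume "\<not> i < ?n" "\<not> j < ?n" then show ?thesis using ij by simp
      qed
    qed
  qed
  let ?A = "\<lambda>i. if i < ?n then {1 :: ennreal} else {0}"
  have "prob (\<Inter>i\<in>{..<Suc ?n}. (\<lambda>\<omega>. num_points (\<eta> \<omega>) (C i)) -` ?A i \<inter> space M)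
       = (\<Prod>i\<in>{..<Suc ?n}. prob ((\<lambda>\<omega>. num_points (\<eta> \<omega>) (C i)) -` ?A i \<inter> space M))"
    by (rule indep_varsD[OF ind]) (auto simp: lessThan_empty_iff)
  also have "(\<Inter>i\<in>{..<Suc ?n}. (\<lambda>\<omega>. num_points (\<eta> \<omega>) (C i)) -` ?A i \<inter> space M)
     = {\<omega> \<in> space M. (\<forall>j\<in>J. num_points (\<eta> \<omega>) (B j) = 1) \<and> \<eta> \<omega> \<inter> R = {}}" (is "?L = ?R'")
  proof (rule set_eqI)
    fix \<omega>
    have "\<omega> \<in> ?L \<longleftrightarrow> \<omega> \<in> space M \<and> (\<forall>i<Suc ?n. num_points (\<eta> \<omega>) (C i) \<in> ?A i)" by auto
    also have "\<dots> \<longleftrightarrow> \<omega> \<in> space M \<and> (\<forall>i<?n. num_points (\<eta> \<omega>) (B (f i)) = 1) \<and> num_points (\<eta> \<omega>) R = 0"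
      by (auto simp: C_def less_Suc_eq)
    also have "(\<forall>i<?n. num_points (\<eta> \<omega>) (B (f i)) = 1) \<longleftrightarrow> (\<forall>j\<in>f ` {..<?n}. num_points (\<eta> \<omega>) (B j) = 1)" by auto
    also have "f ` {..<?n} = J" using f by (simp add: bij_betw_def)
    finally show "\<omega> \<in> ?L \<longleftrightarrow> \<omega> \<in> ?R'" by (simp add: num_points_eq_0_iff)
  qed
  also have "(\<Prod>i\<in>{..<Suc ?n}. prob ((\<lambda>\<omega>. num_points (\<eta> \<omega>) (C i)) -` ?A i \<inter> space M))
    = (\<Prod>i\<in>{..<?n}. prob {\<omega> \<in> space M. num_points (\<eta> \<omega>) (B (f i)) = of_nat 1}) * prob {\<omega> \<in> space M. num_points (\<eta> \<omega>) R = of_nat 0}"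
  proof -
    have 1: "(\<lambda>\<omega>. num_points (\<eta> \<omega>) (C i)) -` ?A i \<inter> space M = {\<omega> \<in> space M. num_points (\<eta> \<omega>) (B (f i)) = of_nat 1}" if "i < ?n" for i
      using that by (auto simp: C_def)
    have 2: "(\<lambda>\<omega>. num_points (\<eta> \<omega>) (C ?n)) -` ?A ?n \<inter> space M = {\<omega> \<in> space M. num_points (\<eta> \<omega>) R = of_nat 0}"
      by (auto simp: C_def)
    show ?thesis unfolding lessThan_Suc using 1 2 by (simp add: mult.commute)
  qed
  also have "(\<Prod>i\<in>{..<?n}. prob {\<omega> \<in> space M. num_points (\<eta> \<omega>) (B (f i)) = of_nat 1})
     = (\<Prod>j\<in>J. prob {\<omega> \<in> space M. num_points (\<eta> \<omega>) (B j) = of_nat 1})"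
    by (rule prod.reindex_bij_betw[OF f])
  also have "\<dots> = (\<Prod>j\<in>J. s * measure lborel (B j) * exp (- (s * measure lborel (B j))))"
    using B by (intro prod.cong refl) (subst prob_num_points, auto simp: Int_absorb2)
  also have "prob {\<omega> \<in> space M. num_points (\<eta> \<omega>) R = of_nat 0} = exp (- (s * measure lborel R))"
    using R by (subst prob_num_points) (auto simp: Int_absorb2)
  finally show ?thesis .
qed

end

text \<open>The normalisation gives \<open>W\<close> and every \<open>X j\<close> the same expected
  number \<open>m\<close> of points, whatever the intensity \<open>s\<close>.\<close>

definition cap_data :: "real \<Rightarrow> real \<Rightarrow> (real^'d) set \<Rightarrow> ('d \<Rightarrow> (real^'d) set) \<Rightarrow> (real^'d) set \<Rightarrow> bool" where
  "cap_data s m C X W \<longleftrightarrow> C \<in> sets borel \<and> C \<subseteq> cball 0 1 \<and> W \<in> sets borel \<and> W \<subseteq> C \<and> s * measure lborel W = m \<and>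
     (\<forall>j. X j \<in> sets borel \<and> X j \<subseteq> C \<and> X j \<inter> W = {} \<and> s * measure lborel (X j) = m) \<and> disjoint_family X"

context ball_poisson
begin

text \<open>\<open>W\<close> is exempt from the emptiness condition, so the event depends on the
  points outside \<open>W\<close> alone and is independent of the number of points in
  \<open>W\<close>.\<close>

definition anchored :: "(real^'d) set \<Rightarrow> ('d \<Rightarrow> (real^'d) set) \<Rightarrow> (real^'d) set \<Rightarrow> 'w set" where
  "anchored C X W = {\<omega> \<in> space M. (\<forall>j. \<exists>x. \<eta> \<omega> \<inter> X j = {x}) \<and> \<eta> \<omega> \<inter> (C - (\<Union>j. X j) - W) = {}}"

definition occupied :: "(real^'d) set \<Rightarrow> nat \<Rightarrow> 'w set" where
  "occupied W k = {\<omega> \<in> space M. num_points (\<eta> \<omega>) W = of_nat k}"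

text \<open>The factor \<open>m\<close>, the intensity of \<open>W\<close>, makes the statistic orthogonal to every function of
  the points outside \<open>W\<close>.\<close>

definition cap_stat :: "real \<Rightarrow> (real^'d) set \<Rightarrow> ('d \<Rightarrow> (real^'d) set) \<Rightarrow> (real^'d) set \<Rightarrow> 'w \<Rightarrow> real" where
  "cap_stat m C X W \<omega> = indicator (anchored C X W) \<omega> * (indicator (occupied W 1) \<omega> - m * indicator (occupied W 0) \<omega>)"

lemma occupied_0: "occupied W 0 = {\<omega> \<in> space M. \<eta> \<omega> \<inter> W = {}}"
  by (simp add: occupied_def num_points_eq_0_iff)

lemma occupied_1: "occupied W 1 = {\<omega> \<in> space M. \<exists>x. \<eta> \<omega> \<inter> W = {x}}"
  by (simp add: occupied_def num_points_eq_1_iff)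

lemma anchored_in_algebra:
  assumes cd: "cap_data s m C X W" and V: "\<And>j. X j \<inter> V = {}" "(C - W) \<inter> V = {}"
  shows "anchored C X W \<in> sets (void_algebra V)"
proof -
  have Xb: "X j \<in> sets borel" for j using cd by (simp add: cap_data_def)
  have 1: "{\<omega> \<in> space M. \<exists>x. \<eta> \<omega> \<inter> X j = {x}} \<in> sets (void_algebra V)" for j
    by (rule single_in_void_algebra[OF poisson_process_axioms Xb V(1)])
  have "C - (\<Union>j. X j) - W \<in> sets borel" using cd Xb by (auto simp: cap_data_def)
  then have 2: "{\<omega> \<in> space M. \<eta> \<omega> \<inter> (C - (\<Union>j. X j) - W) = {}} \<in> sets (void_algebra V)"
    using V(2) by (intro void_in_algebra) auto
  have "anchored C X W = (\<Inter>j. {\<omega> \<in> space M. \<exists>x. \<eta> \<omega> \<inter> X j = {x}}) \<inter> {\<omega> \<in> space M. \<eta> \<omega> \<inter> (C - (\<Union>j. X j) - W) = {}}"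
    by (auto simp: anchored_def)
  also have "\<dots> \<in> sets (void_algebra V)" using 1 2 by (intro sets.Int sets.finite_INT) auto
  finally show ?thesis .
qed

lemma anchored_in_algebra_self: "cap_data s m C X W \<Longrightarrow> anchored C X W \<in> sets (void_algebra W)"
  by (rule anchored_in_algebra) (auto simp: cap_data_def)

lemma anchored_event: "cap_data s m C X W \<Longrightarrow> anchored C X W \<in> events"
  using anchored_in_algebra_self void_algebra_events by blast

lemma occupied_event: "W \<in> sets borel \<Longrightarrow> occupied W k \<in> events"
  unfolding occupied_def by (rule num_event)

lemma cap_stat_measurable:
  assumes cd: "cap_data s m C X W" and V: "C \<inter> V = {}"
  shows "cap_stat m C X W \<in> borel_measurable (void_algebra V)"
proof -
  have sub: "\<And>j. X j \<subseteq> C" "W \<subseteq> C" and Wb: "W \<in> sets borel" using cd by (auto simp: cap_data_def)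
  have "anchored C X W \<in> sets (void_algebra V)" using V sub by (intro anchored_in_algebra[OF cd]) blast+
  moreover have WV: "W \<inter> V = {}" using V sub by blast
  then have "occupied W 0 \<in> sets (void_algebra V)" "occupied W 1 \<in> sets (void_algebra V)"
    unfolding occupied_0 occupied_1
    using void_in_algebra[OF Wb WV] single_in_void_algebra[OF poisson_process_axioms Wb WV] by auto
  ultimately show ?thesis unfolding cap_stat_def[abs_def]
    by (intro borel_measurable_times borel_measurable_diff borel_measurable_indicator borel_measurable_const)
qed

lemma cap_stat_measurable_M: "cap_data s m C X W \<Longrightarrow> cap_stat m C X W \<in> borel_measurable M"
  using cap_stat_measurable[of m C X W "{}"] void_algebra_measurable by simp

lemma cap_stat_bound: "0 \<le> m \<Longrightarrow> \<bar>cap_stat m C X W \<omega>\<bar> \<le> 1 + m"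
  by (auto simp: cap_stat_def indicator_def)

lemma prob_occupied:
  assumes "cap_data s m C X W"
  shows "prob (occupied W 1) = m * exp (- m)" "prob (occupied W 0) = exp (- m)"
proof -
  have W: "W \<in> sets borel" "W \<inter> cball 0 1 = W" "s * measure lborel W = m" using assms by (auto simp: cap_data_def)
  show "prob (occupied W 1) = m * exp (- m)" "prob (occupied W 0) = exp (- m)"
    unfolding occupied_def prob_num_points[OF W(1)] W by simp_all
qed

text \<open>\<open>H\<close> times the indicator of \<open>anchored\<close> is independent of the
  count in \<open>W\<close>, and for a Poisson variable with mean \<open>m\<close> the probability
  of 1 is \<open>m\<close> times that of 0, so the two terms cancel.\<close>

lemma expectation_cap_stat:
  assumes cd: "cap_data s m C X W" and H: "H \<in> borel_measurable (void_algebra W)" "AE \<omega> in M. \<bar>H \<omega>\<bar> \<le> K"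
  shows "expectation (\<lambda>\<omega>. H \<omega> * cap_stat m C X W \<omega>) = 0"
proof -
  let ?A = "anchored C X W"
  have Wb: "W \<in> sets borel" using cd by (simp add: cap_data_def)
  have HA: "(\<lambda>\<omega>. H \<omega> * indicator ?A \<omega>) \<in> borel_measurable (void_algebra W)"
    using H(1) anchored_in_algebra_self[OF cd] by simp
  have bound: "AE \<omega> in M. norm (H \<omega> * indicator ?A \<omega>) \<le> K"
    using H(2) by eventually_elim (auto simp: indicator_def)
  have int: "integrable M (\<lambda>\<omega>. H \<omega> * indicator ?A \<omega>)"
    using bound void_algebra_measurable[OF HA] by (rule integrable_const_bound)
  have intk: "integrable M (\<lambda>\<omega>. H \<omega> * indicator ?A \<omega> * indicator (occupied W k) \<omega>)" for k
    by (rule integrable_real_mult_indicator[OF occupied_event[OF Wb] int])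
  have ek: "expectation (\<lambda>\<omega>. H \<omega> * indicator ?A \<omega> * indicator (occupied W k) \<omega>)
      = expectation (\<lambda>\<omega>. H \<omega> * indicator ?A \<omega>) * prob (occupied W k)" for k
    unfolding occupied_def by (rule expectation_num_points_indep[OF Wb HA int])
  have "(\<lambda>\<omega>. H \<omega> * cap_stat m C X W \<omega>) = (\<lambda>\<omega>. H \<omega> * indicator ?A \<omega> * indicator (occupied W 1) \<omega>
     - m * (H \<omega> * indicator ?A \<omega> * indicator (occupied W 0) \<omega>))"
    by (auto simp: cap_stat_def algebra_simps)
  then have "expectation (\<lambda>\<omega>. H \<omega> * cap_stat m C X W \<omega>)
    = expectation (\<lambda>\<omega>. H \<omega> * indicator ?A \<omega>) * prob (occupied W 1) - m * (expectation (\<lambda>\<omega>. H \<omega> * indicator ?A \<omega>) * prob (occupied W 0))"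
    using intk by (simp add: ek)
  then show ?thesis unfolding prob_occupied[OF cd] by simp
qed

text \<open>The counts in the \<open>X j\<close>, in the rest of the cap and in \<open>W\<close> are
  independent; the bound \<open>K\<close> on the intensity of the cap bounds the probability that
  the rest is empty from below.\<close>

lemma prob_anchored_occupied:
  assumes cd: "cap_data s m C X W" and m: "0 < m" and K: "s * measure lborel C \<le> K"
  shows "(m * exp (- m)) ^ CARD('d) * exp (- K) * (m * exp (- m)) \<le> prob (anchored C X W \<inter> occupied W 1)"
proof -
  let ?A = "anchored C X W" and ?R = "C - (\<Union>j. X j) - W"
  have Wb: "W \<in> sets borel" and Cb: "C \<in> sets borel" "C \<subseteq> cball 0 1" and Xb: "\<And>j. X j \<in> sets borel" "\<And>j. X j \<subseteq> C"
    and Xm: "\<And>j. s * measure lborel (X j) = m" and dj: "disjoint_family X"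
    using cd by (auto simp: cap_data_def)
  have Rb: "?R \<in> sets borel" using Wb Cb Xb by auto
  have A: "?A = {\<omega> \<in> space M. (\<forall>j\<in>UNIV. num_points (\<eta> \<omega>) (X j) = 1) \<and> \<eta> \<omega> \<inter> ?R = {}}"
    by (simp add: anchored_def num_points_eq_1_iff)
  have "prob ?A = (\<Prod>j\<in>(UNIV :: 'd set). s * measure lborel (X j) * exp (- (s * measure lborel (X j)))) * exp (- (s * measure lborel ?R))"
    unfolding A using Xb Cb Rb dj by (intro prob_exactly) auto
  also have "\<dots> = (m * exp (- m)) ^ CARD('d) * exp (- (s * measure lborel ?R))" unfolding Xm by simp
  also have "\<dots> \<ge> (m * exp (- m)) ^ CARD('d) * exp (- K)"
  proof (rule mult_left_mono)
    have "bounded C" using Cb(2) bounded_cball bounded_subset by blast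
    then have "C \<in> fmeasurable lborel" using Cb(1) emeasure_bounded_finite[of C] by (intro fmeasurableI) auto
    then have "measure lborel ?R \<le> measure lborel C" using Rb by (intro measure_mono_fmeasurable) auto
    then have "s * measure lborel ?R \<le> K" using K mult_left_mono[of "measure lborel ?R" "measure lborel C" s] s by linarith
    then show "exp (- K) \<le> exp (- (s * measure lborel ?R))" by simp
  qed (use m in simp)
  finally have pA: "(m * exp (- m)) ^ CARD('d) * exp (- K) \<le> prob ?A" .
  have AV: "(indicator ?A :: 'w \<Rightarrow> real) \<in> borel_measurable (void_algebra W)"
    using anchored_in_algebra_self[OF cd] by simp
  have Ai: "integrable M (indicator ?A :: 'w \<Rightarrow> real)"
    using anchored_event[OF cd] by (intro integrable_real_indicator) (auto simp: emeasure_eq_measure)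
  have "prob (?A \<inter> occupied W 1) = expectation (indicator (?A \<inter> occupied W 1))"
    using anchored_event[OF cd] occupied_event[OF Wb] by simp
  also have "\<dots> = expectation (\<lambda>\<omega>. indicator ?A \<omega> * indicator (occupied W 1) \<omega>)"
    by (simp add: indicator_inter_arith[abs_def])
  also have "\<dots> = prob ?A * (m * exp (- m))"
    using expectation_num_points_indep[OF Wb AV Ai, of "of_nat 1"] anchored_event[OF cd] prob_occupied(1)[OF cd]
    unfolding occupied_def by simp
  also have "\<dots> \<ge> (m * exp (- m)) ^ CARD('d) * exp (- K) * (m * exp (- m))"
    using pA m by (intro mult_right_mono) auto
  finally show ?thesis .
qed

text \<open>Let \<open>Y\<close> be the functional of the points outside \<open>W\<close>; it is
  uncorrelated with the statistic and may be subtracted. Where \<open>W\<close> is empty it equals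
  the full functional, so the difference counts only where \<open>W\<close> holds exactly one point,
  and there \<open>gain\<close> applies.\<close>

lemma covariance_cap_stat:
  fixes F :: "(real^'d) set \<Rightarrow> real"
  assumes cd: "cap_data s m C X W" and m: "0 < m" and K: "s * measure lborel C \<le> K" and C0: "0 \<notin> C"
    and FV: "\<And>V. V \<in> sets borel \<Longrightarrow> (\<lambda>\<omega>. F (insert 0 (\<eta> \<omega> - V))) \<in> borel_measurable (void_algebra V)"
    and Fb: "\<And>P. finite P \<Longrightarrow> 0 \<in> P \<Longrightarrow> P \<subseteq> cball 0 1 \<Longrightarrow> \<bar>F P\<bar> \<le> L"
    and \<sigma>: "\<bar>\<sigma>\<bar> = 1" and g: "0 \<le> g"
    and gain: "\<And>P x w. finite P \<Longrightarrow> 0 \<in> P \<Longrightarrow> P \<subseteq> cball 0 1 \<Longrightarrow> (\<forall>j. x j \<in> X j \<inter> P) \<Longrightarrow> P \<inter> C \<subseteq> range x \<Longrightarrow> w \<in> W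
       \<Longrightarrow> g \<le> \<sigma> * (F (insert w P) - F P)"
  shows "g * ((m * exp (- m)) ^ CARD('d) * exp (- K) * (m * exp (- m)))
    \<le> \<sigma> * expectation (\<lambda>\<omega>. F (insert 0 (\<eta> \<omega>)) * cap_stat m C X W \<omega>)"
proof -
  let ?A = "anchored C X W" and ?G = "cap_stat m C X W"
  define Z where "Z \<omega> = F (insert 0 (\<eta> \<omega>))" for \<omega>
  define Y where "Y \<omega> = F (insert 0 (\<eta> \<omega> - W))" for \<omega>
  have Wb: "W \<in> sets borel" and XW: "\<And>j. X j \<inter> W = {}" using cd by (auto simp: cap_data_def)
  have Zm: "Z \<in> borel_measurable M" using void_algebra_measurable[OF FV[of "{}"]] by (simp add: Z_def[abs_def])
  have Ym: "Y \<in> borel_measurable (void_algebra W)" using FV[OF Wb] by (simp add: Y_def[abs_def])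
  have fin: "AE \<omega> in M. finite (\<eta> \<omega>) \<and> \<eta> \<omega> \<subseteq> cball 0 1"
    using AE_in_ball AE_space
  proof eventually_elim
    case (elim \<omega>)
    then have "\<eta> \<omega> = \<eta> \<omega> \<inter> cball 0 1" by blast
    then show ?case using locally_finite[OF elim(2) bounded_cball] elim(1) by metis
  qed
  have Zb: "AE \<omega> in M. \<bar>Z \<omega>\<bar> \<le> L" using fin by eventually_elim (unfold Z_def, rule Fb, auto)
  have Yb: "AE \<omega> in M. \<bar>Y \<omega>\<bar> \<le> L" using fin by eventually_elim (unfold Y_def, rule Fb, auto)
  have Gm: "?G \<in> borel_measurable M" by (rule cap_stat_measurable_M[OF cd])
  have Gb: "\<bar>?G \<omega>\<bar> \<le> 1 + m" for \<omega> using cap_stat_bound m by simp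
  have iZ: "integrable M (\<lambda>\<omega>. Z \<omega> * ?G \<omega>)"
  proof (rule integrable_const_bound)
    show "AE \<omega> in M. norm (Z \<omega> * ?G \<omega>) \<le> L * (1 + m)"
      using Zb by eventually_elim (simp only: real_norm_def, rule abs_mult_le[OF _ Gb])
  qed (use Zm Gm in measurable)
  have iY: "integrable M (\<lambda>\<omega>. Y \<omega> * ?G \<omega>)"
  proof (rule integrable_const_bound)
    show "AE \<omega> in M. norm (Y \<omega> * ?G \<omega>) \<le> L * (1 + m)"
      using Yb by eventually_elim (simp only: real_norm_def, rule abs_mult_le[OF _ Gb])
  qed (use void_algebra_measurable[OF Ym] Gm in measurable)
  have EY: "expectation (\<lambda>\<omega>. Y \<omega> * ?G \<omega>) = 0" by (rule expectation_cap_stat[OF cd Ym Yb])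
  have point: "AE \<omega> in M. g * indicator (?A \<inter> occupied W 1) \<omega> \<le> \<sigma> * (Z \<omega> * ?G \<omega> - Y \<omega> * ?G \<omega>)"
    using fin AE_space
  proof eventually_elim
    case (elim \<omega>)
    show ?case
    proof (cases "\<omega> \<in> ?A")
      case False then show ?thesis by (simp add: cap_stat_def)
    next
      case A: True
      show ?thesis
      proof (cases "\<omega> \<in> occupied W 1")
        case True
        then obtain w where w: "\<eta> \<omega> \<inter> W = {w}" using True unfolding occupied_1 by blast
        then have n0: "\<omega> \<notin> occupied W 0" by (auto simp: occupied_0)
        let ?P = "insert 0 (\<eta> \<omega> - W)"
        have "\<forall>j. \<exists>x. \<eta> \<omega> \<inter> X j = {x}" using A by (simp add: anchored_def)
        then obtain x where x: "\<And>j. \<eta> \<omega> \<inter> X j = {x j}" by metis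
        have "g \<le> \<sigma> * (F (insert w ?P) - F ?P)"
        proof (rule gain)
          show "finite ?P" "0 \<in> ?P" "?P \<subseteq> cball 0 1" using elim by auto
          show "\<forall>j. x j \<in> X j \<inter> ?P" using x XW by blast
          show "?P \<inter> C \<subseteq> range x"
          proof
            fix p assume p: "p \<in> ?P \<inter> C"
            \<comment> \<open>The added origin lies outside the cap, so \<open>p\<close> is a point
              of the process.\<close>
            then have p': "p \<in> \<eta> \<omega>" "p \<notin> W" "p \<in> C" using C0 by auto
            have "\<eta> \<omega> \<inter> (C - (\<Union>j. X j) - W) = {}" using A by (simp add: anchored_def)
            then obtain j where "p \<in> X j" using p' by blast
            then have "p = x j" using x[of j] p'(1) by blast
            then show "p \<in> range x" by blast
          qed
          show "w \<in> W" using w by blast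
        qed
        moreover have "insert w ?P = insert 0 (\<eta> \<omega>)" using w by blast
        ultimately show ?thesis using A True n0 by (simp add: cap_stat_def Z_def Y_def)
      next
        case False
        show ?thesis
        proof (cases "\<omega> \<in> occupied W 0")
          case True
          then have "\<eta> \<omega> - W = \<eta> \<omega>" by (auto simp: occupied_0)
          then show ?thesis using False by (simp add: Z_def Y_def)
        next
          case False
          then show ?thesis using \<open>\<omega> \<notin> occupied W 1\<close> by (simp add: cap_stat_def)
        qed
      qed
    qed
  qed
  have AO: "?A \<inter> occupied W 1 \<in> events" using anchored_event[OF cd] occupied_event[OF Wb] by blast
  have "g * ((m * exp (- m)) ^ CARD('d) * exp (- K) * (m * exp (- m))) \<le> g * prob (?A \<inter> occupied W 1)"
    using prob_anchored_occupied[OF cd m K] g by (rule mult_left_mono)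
  also have "\<dots> = expectation (\<lambda>\<omega>. g * indicator (?A \<inter> occupied W 1) \<omega>)" using AO by simp
  also have "\<dots> \<le> expectation (\<lambda>\<omega>. \<sigma> * (Z \<omega> * ?G \<omega> - Y \<omega> * ?G \<omega>))"
    using point iZ iY AO
    by (intro integral_mono_AE) (auto intro!: integrable_real_indicator simp: emeasure_eq_measure)
  also have "\<dots> = \<sigma> * (expectation (\<lambda>\<omega>. Z \<omega> * ?G \<omega>) - expectation (\<lambda>\<omega>. Y \<omega> * ?G \<omega>))" using iZ iY by simp
  finally show ?thesis unfolding EY by (simp add: Z_def)
qed

end

section \<open>Choice of the scale and conclusion\<close>

theorem theorem4p1:
  fixes M :: "real \<Rightarrow> 'w measure"
    and \<eta> :: "real \<Rightarrow> 'w \<Rightarrow> (real ^ 'd) set"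
    and d p1 p2 :: real
    and A :: "real \<Rightarrow> real \<Rightarrow> 'w \<Rightarrow> real"
  defines "d \<equiv> real CARD('d)"
    and "A \<equiv> \<lambda>p s \<omega>. Lp_surface_area p (convex hull (\<eta> s \<omega> \<union> {0}))"
  assumes dim: "CARD('d) \<ge> 2"
    and poisson: "\<And>s. s \<ge> 1 \<Longrightarrow> poisson_process (M s) (ball_intensity s) (\<eta> s)"
    and p1: "p1 \<in> {0..1}" and p2: "p2 \<in> {0..1}" and p_neq: "p1 \<noteq> p2"
  shows "\<forall>\<alpha>1 \<alpha>2 :: real. (\<alpha>1, \<alpha>2) \<noteq> (0, 0) \<longrightarrow>
    (\<exists>c>0. \<forall>\<^sub>F s in at_top.
      prob_space.variance (M s) (\<lambda>\<omega>. \<alpha>1 * A p1 s \<omega> + \<alpha>2 * A p2 s \<omega>)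
        \<ge> c * s powr (- (d + 3) / (d + 1)))"
proof (intro allI impI)
  fix a1 a2 :: real
  assume a: "(a1, a2) \<noteq> (0, 0)"
  define F where "F P = a1 * Lp_surface_area p1 (convex hull P) + a2 * Lp_surface_area p2 (convex hull P)" for P :: "(real^'d) set"
  have p: "0 \<le> p1" "p1 \<le> 1" "0 \<le> p2" "p2 \<le> 1" using p1 p2 by auto
  obtain \<sigma> c m r0 where \<sigma>: "\<bar>\<sigma>\<bar> = 1" and c: "0 < c" and m: "0 < m" and r0: "0 < r0" "r0 \<le> 1 / 100"
    and gain: "\<And>r (u :: real^'d). 0 < r \<Longrightarrow> r \<le> r0 \<Longrightarrow> norm u = 1 \<Longrightarrow>
      \<exists>(X :: 'd \<Rightarrow> (real^'d) set) W. (\<forall>j. X j \<in> sets borel \<and> X j \<subseteq> cap u r \<and> X j \<inter> W = {} \<and> measure lborel (X j) = m * r ^ (CARD('d) + 1)) \<and>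
        W \<in> sets borel \<and> W \<subseteq> cap u r \<and> measure lborel W = m * r ^ (CARD('d) + 1) \<and> disjoint_family X \<and>
        (\<forall>P x w. finite P \<longrightarrow> 0 \<in> P \<longrightarrow> P \<subseteq> cball 0 1 \<longrightarrow> (\<forall>j. x j \<in> X j \<inter> P) \<longrightarrow> P \<inter> cap u r \<subseteq> range x \<longrightarrow> w \<in> W \<longrightarrow>
          c * r ^ (CARD('d) + 1) \<le> \<sigma> * (F (insert w P) - F P))"
    using cap_gain[OF dim a p p_neq] unfolding F_def by metis
  define K where "K = 3 ^ CARD('d) * measure lborel (ball 0 1 :: (real^'d) set)"
  define q where "q = (m * exp (- m)) ^ CARD('d) * exp (- K) * (m * exp (- m))"
  define L where "L = (\<bar>a1\<bar> + \<bar>a2\<bar>) * measure lborel (ball 0 2 :: (real^'d) set)"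
  have q: "0 < q" using m by (simp add: q_def)
  \<comment> \<open>There are at least \<open>r / (6 * r) ^ CARD('d)\<close> caps, each with
    covariance at least \<open>c * q * r ^ (CARD('d) + 1)\<close> and a statistic bounded by
    \<open>1 + m\<close>.\<close>
  define C where "C = (c * q)\<^sup>2 / ((1 + m)\<^sup>2 * 6 ^ CARD('d))"
  have C: "0 < C" using c q m by (simp add: C_def)
  have Fb: "\<bar>F P\<bar> \<le> L" if "finite P" "0 \<in> P" "P \<subseteq> cball 0 1" for P
  proof -
    have Q: "polytope (convex hull P)" "convex hull P \<noteq> {}" "convex hull P \<subseteq> cball 0 1"
      using that by (auto simp: polytope_convex_hull subset_hull)
    have "\<bar>F P\<bar> \<le> \<bar>a1\<bar> * \<bar>Lp_surface_area p1 (convex hull P)\<bar> + \<bar>a2\<bar> * \<bar>Lp_surface_area p2 (convex hull P)\<bar>"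
      unfolding F_def abs_mult[symmetric] by (rule abs_triangle_ineq)
    also have "\<dots> \<le> L" unfolding L_def distrib_right
      by (intro add_mono mult_left_mono Lp_surface_area_bounded[OF Q] p) auto
    finally show ?thesis .
  qed
  have main: "C * s powr (- (d + 3) / (d + 1)) \<le> prob_space.variance (M s) (\<lambda>\<omega>. a1 * A p1 s \<omega> + a2 * A p2 s \<omega>)"
    if s1: "1 \<le> s" and sr: "s powr (- 1 / (d + 1)) \<le> r0" for s
  proof -
    \<comment> \<open>At this scale \<open>s * r ^ (CARD('d) + 1) = 1\<close>, which keeps the
      intensity of each cap bounded and that of its regions equal to \<open>m\<close>.\<close>
    define r where "r = s powr (- 1 / (d + 1))"
    have d0: "0 \<le> d" by (simp add: d_def)
    have r: "0 < r" "r \<le> r0" "r \<le> 1" using s1 sr r0 by (auto simp: r_def)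
    have rn: "r ^ n = s powr (- real n / (d + 1))" for n
      using s1 r by (simp add: r_def powr_powr flip: powr_realpow)
    have "- real (CARD('d) + 1) / (d + 1) = - 1" using d0 by (simp add: d_def field_simps)
    then have rs: "s * r ^ (CARD('d) + 1) = 1" unfolding rn using s1 by (simp add: powr_minus)
    have rd: "r ^ (CARD('d) + 3) = s powr (- (d + 3) / (d + 1))" unfolding rn by (simp add: d_def)
    interpret poisson_process "M s" "ball_intensity s" "\<eta> s" by (rule poisson[OF s1])
    interpret ball_poisson "M s" s "\<eta> s" by unfold_locales (use s1 in simp)
    obtain U :: "(real^'d) set" where U: "finite U" "\<And>u. u \<in> U \<Longrightarrow> norm u = 1"
      "\<And>u v. u \<in> U \<Longrightarrow> v \<in> U \<Longrightarrow> u \<noteq> v \<Longrightarrow> cap u r \<inter> cap v r = {}" "r / (6 * r) ^ CARD('d) \<le> real (card U)"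
      using cap_packing[OF r(1,3)] by metis
    have "\<forall>u\<in>U. \<exists>(X :: 'd \<Rightarrow> (real^'d) set) W. cap_data s m (cap u r) X W \<and>
        (\<forall>P x w. finite P \<longrightarrow> 0 \<in> P \<longrightarrow> P \<subseteq> cball 0 1 \<longrightarrow> (\<forall>j. x j \<in> X j \<inter> P) \<longrightarrow> P \<inter> cap u r \<subseteq> range x \<longrightarrow> w \<in> W \<longrightarrow>
          c * r ^ (CARD('d) + 1) \<le> \<sigma> * (F (insert w P) - F P))"
    proof
      fix u assume "u \<in> U"
      have "closed (cap u r)" "cap u r \<subseteq> cball 0 1" by (rule closed_cap) (auto simp: cap_def)
      moreover have "s * (m * r ^ (CARD('d) + 1)) = m" using rs by (simp add: mult.left_commute)
      ultimately show "\<exists>(X :: 'd \<Rightarrow> (real^'d) set) W. cap_data s m (cap u r) X W \<and>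
        (\<forall>P x w. finite P \<longrightarrow> 0 \<in> P \<longrightarrow> P \<subseteq> cball 0 1 \<longrightarrow> (\<forall>j. x j \<in> X j \<inter> P) \<longrightarrow> P \<inter> cap u r \<subseteq> range x \<longrightarrow> w \<in> W \<longrightarrow>
          c * r ^ (CARD('d) + 1) \<le> \<sigma> * (F (insert w P) - F P))"
        using gain[OF r(1,2) U(2)[OF \<open>u \<in> U\<close>]] unfolding cap_data_def by (metis borel_closed)
    qed
    then obtain X :: "real^'d \<Rightarrow> 'd \<Rightarrow> (real^'d) set" and W
      where cd: "\<And>u. u \<in> U \<Longrightarrow> cap_data s m (cap u r) (X u) (W u)"
        and gainU: "\<And>u P x w. u \<in> U \<Longrightarrow> finite P \<Longrightarrow> 0 \<in> P \<Longrightarrow> P \<subseteq> cball 0 1 \<Longrightarrow> (\<forall>j. x j \<in> X u j \<inter> P) \<Longrightarrow>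
           P \<inter> cap u r \<subseteq> range x \<Longrightarrow> w \<in> W u \<Longrightarrow> c * r ^ (CARD('d) + 1) \<le> \<sigma> * (F (insert w P) - F P)"
      by metis
    define G where "G u = cap_stat m (cap u r) (X u) (W u)" for u
    define Z where "Z \<omega> = F (insert 0 (\<eta> s \<omega>))" for \<omega>
    have FV: "(\<lambda>\<omega>. F (insert 0 (\<eta> s \<omega> - V))) \<in> borel_measurable (void_algebra V)" if "V \<in> sets borel" for V
      unfolding F_def
      by (intro borel_measurable_add borel_measurable_times borel_measurable_const
          surface_area_void_measurable[OF dim poisson_process_axioms that])
    have Zm: "Z \<in> borel_measurable (M s)" using void_algebra_measurable[OF FV[of "{}"]] by (simp add: Z_def[abs_def])
    have Zb: "AE \<omega> in M s. \<bar>Z \<omega>\<bar> \<le> L"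
      using AE_in_ball AE_space
    proof eventually_elim
      case (elim \<omega>)
      then have "finite (\<eta> s \<omega>)" using locally_finite[OF elim(2) bounded_cball[of 0 1]] by (metis Int_absorb2)
      then show ?case unfolding Z_def using elim by (intro Fb) auto
    qed
    have Gb: "\<bar>G u \<omega>\<bar> \<le> 1 + m" for u \<omega> unfolding G_def using m by (intro cap_stat_bound) simp
    have "real (card U) * (c * r ^ (CARD('d) + 1) * q)\<^sup>2 / (1 + m)\<^sup>2 \<le> variance Z"
    proof (rule variance_lower_bound[OF prob_space_axioms Zm Zb U(1)])
      show "G u \<in> borel_measurable (M s)" if "u \<in> U" for u
        unfolding G_def by (rule cap_stat_measurable_M[OF cd[OF that]])
      show "expectation (G u) = 0" if "u \<in> U" for u
        using expectation_cap_stat[OF cd[OF that], of "\<lambda>_. 1" 1] by (simp add: G_def)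
      show "expectation (\<lambda>\<omega>. G u \<omega> * G v \<omega>) = 0" if uv: "u \<in> U" "v \<in> U" "u \<noteq> v" for u v
      proof -
        have "W v \<subseteq> cap v r" using cd[OF uv(2)] by (simp add: cap_data_def)
        then have "cap u r \<inter> W v = {}" using U(3)[OF uv] by blast
        then have "G u \<in> borel_measurable (void_algebra (W v))" unfolding G_def by (rule cap_stat_measurable[OF cd[OF uv(1)]])
        then show ?thesis unfolding G_def[of v] by (rule expectation_cap_stat[OF cd[OF uv(2)]]) (rule AE_I2, rule Gb)
      qed
      show "c * r ^ (CARD('d) + 1) * q \<le> \<sigma> * expectation (\<lambda>\<omega>. Z \<omega> * G u \<omega>)" if u: "u \<in> U" for u
        unfolding G_def Z_def q_def
      proof (rule covariance_cap_stat[OF cd[OF u] m _ _ FV Fb \<sigma> _ gainU[OF u]])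
        have "s * measure lborel (cap u r) \<le> s * (K * r ^ (CARD('d) + 1))"
          using measure_cap_le[OF U(2)[OF u] r(1)] s1 by (intro mult_left_mono) (auto simp: K_def)
        then show "s * measure lborel (cap u r) \<le> K" using rs by (simp add: mult.left_commute)
        have "r\<^sup>2 \<le> r0 * r0" unfolding power2_eq_square using r by (intro mult_mono) auto
        also have "\<dots> \<le> 1 / 100 * (1 / 100)" using r0 by (intro mult_mono) auto
        finally show "0 \<notin> cap u r" by (simp add: cap_def)
        show "0 \<le> c * r ^ (CARD('d) + 1)" using c r by simp
      qed
      show "0 \<le> c * r ^ (CARD('d) + 1) * q" using c r q by simp
    qed (use m Gb \<sigma> in auto)
    moreover have "C * r ^ (CARD('d) + 3) \<le> real (card U) * (c * r ^ (CARD('d) + 1) * q)\<^sup>2 / (1 + m)\<^sup>2"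
    proof -
      have "C * r ^ (CARD('d) + 3) = r / (6 * r) ^ CARD('d) * ((c * r ^ (CARD('d) + 1) * q)\<^sup>2 / (1 + m)\<^sup>2)"
        using r m by (simp add: C_def power_add power_mult_distrib power2_eq_square power3_eq_cube field_simps)
      also have "\<dots> \<le> real (card U) * ((c * r ^ (CARD('d) + 1) * q)\<^sup>2 / (1 + m)\<^sup>2)"
        using U(4) by (rule mult_right_mono) simp
      finally show ?thesis by simp
    qed
    moreover have "Z = (\<lambda>\<omega>. a1 * A p1 s \<omega> + a2 * A p2 s \<omega>)" by (simp add: Z_def[abs_def] F_def A_def)
    ultimately show ?thesis unfolding rd by simp
  qed
  have "((\<lambda>s. s powr (- 1 / (d + 1))) \<longlongrightarrow> 0) at_top"
    by (intro tendsto_neg_powr filterlim_ident) (simp add: d_def add_nonneg_pos)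
  then have "\<forall>\<^sub>F s in at_top. s powr (- 1 / (d + 1)) < r0" using r0(1) by (rule order_tendstoD)
  then have "\<forall>\<^sub>F s in at_top. C * s powr (- (d + 3) / (d + 1))
      \<le> prob_space.variance (M s) (\<lambda>\<omega>. a1 * A p1 s \<omega> + a2 * A p2 s \<omega>)"
    using eventually_ge_at_top[of 1] by eventually_elim (rule main, auto)
  then show "\<exists>c>0. \<forall>\<^sub>F s in at_top. c * s powr (- (d + 3) / (d + 1))
      \<le> prob_space.variance (M s) (\<lambda>\<omega>. a1 * A p1 s \<omega> + a2 * A p2 s \<omega>)"
    using C by blast
qed

end
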